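(* Let $d\in\mathbb{N}^*$ be fixed. For each $n\in\mathbb{N}^*$, let $(Y_1,Y_2,\ldots)$ be a rejection sampling sequence in the discrete torus $\mathbb{T}_n^d$, let $\mathcal{B}_n^{\mathsf{rs}}(k)=\bigcup_{i=1}^k\overline{B}(Y_i,k-i)$ for all $k\in\mathbb{N}$, and let $\tau_n^{\mathsf{rs}}=\inf\{k\in\mathbb{N}:\mathcal{B}_n^{\mathsf{rs}}(k)=\mathbb{T}_n^d\}$. Then, as $n\to\infty$, \[\frac{\tau_n^{\mathsf{rs}}}{n^{d/(d+1)}}\longrightarrow T\quad\text{in probability,}\] where $T=T(d)\in(0,\infty)$ is the explosion time of the maximal solution $y:[0,T)\to\mathbb{R}$ of the Cauchy problem \[\begin{cases}y^{(d+1)}(t)=2^d\cdot y(t)\cdot y^{(d)}(t),\quad t\in\mathbb{R}_+,\\ y(0)=\cdots=y^{(d-1)}(0)=0\ \text{ and }\ y^{(d)}(0)=1.\end{cases}\] Moreover, \[\sup_{t\in[0,T)}\left|\frac{\#\left(\mathbb{T}_n^d\setminus\mathcal{B}_n^{\mathsf{rs}}\left(\left\lfloor t\cdot n^{d/(d+1)}\right\rfloor\right)\right)}{n^d}-\frac{1}{y^{(d)}(t)}\right|\longrightarrow 0\quad\text{in probability as }n\to\infty.\]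
   Context: Notation: $\mathbb{N}=\{0,1,2,\ldots\}$, $\mathbb{N}^*=\{1,2,\ldots\}$; $\#S$ is the cardinality of a finite set $S$. For $n\in\mathbb{N}^*$, $\mathbb{T}_n^d$ is the discrete Euclidean torus $\mathbb{Z}^d/n\mathbb{Z}^d$ with side length $n$, equipped with its natural (nearest-neighbour) graph structure. $\overline{B}(x,r)$ denotes the closed ball of radius $r$ around the vertex $x$ for the graph distance in $\mathbb{T}_n^d$ (the dependence on $n$ is omitted). Rejection sampling sequence: a sequence $(Y_1,Y_2,\ldots)$ of random variables with values in $\mathbb{T}_n^d$ (depending on $n$) such that for each $k\in\mathbb{N}$, conditionally on $Y_1,\ldots,Y_k$, the random variable $Y_{k+1}$ has uniform distribution on the complement in $\mathbb{T}_n^d$ of $\bigcup_{i=1}^k\overline{B}(Y_i,k-i)$, provided that $\bigcup_{i=1}^k\overline{B}(Y_i,k-i)\subsetneq\mathbb{T}_n^d$ (the union being empty for $k=0$). No condition is imposed on $Y_{k+1}$ once the union is the whole torus; the laws of $\mathcal{B}_n^{\mathsf{rs}}(\cdot)$ and of $\tau_n^{\mathsf{rs}}$ do not depend on this freedom, since once $\mathcal{B}_n^{\mathsf{rs}}(k)=\mathbb{T}_n^d$ one has $\mathcal{B}_n^{\mathsf{rs}}(k+1)=\mathbb{T}_n^d$. Known fact (from the literature on the generalised Blasius equation): the maximal solution $y$ of the Cauchy problem $y^{(d+1)}(t)=2^d\cdot y(t)\cdot y^{(d)}(t)$ for $t\in\mathbb{R}_+$, with initial conditions $y(0)=\cdots=y^{(d-1)}(0)=0$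 and $y^{(d)}(0)=1$, blows up in finite time, i.e. its maximal interval of existence to the right of $0$ is $[0,T)$ with $T\in(0,\infty)$, and $y^{(d)}(t)$ is of order $(T-t)^{-(d+1)}$ as $t\to T^-$ (i.e. the ratio of the two is bounded above and below by positive constants for $t$ near $T$). *)

theory Defs
  imports "HOL-Probability.Probability"
begin

text \<open>The torus \<open>\<int>\<^sup>d / n\<int>\<^sup>d\<close>: each class is represented by its residues in \<open>{0, \<dots>, n - 1}\<close>.\<close>

definition torus :: "nat \<Rightarrow> nat \<Rightarrow> (nat \<Rightarrow> nat) set" where
  "torus d n = ({..<d} \<rightarrow>\<^sub>E {..<n})"

definition torus_edges :: "nat \<Rightarrow> nat \<Rightarrow> ((nat \<Rightarrow> nat) \<times> (nat \<Rightarrow> nat)) set" where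
  "torus_edges d n = {(x, y). x \<in> torus d n \<and> y \<in> torus d n \<and> x \<noteq> y \<and>
     (\<exists>i<d. (y i = (x i + 1) mod n \<or> x i = (y i + 1) mod n) \<and>
       (\<forall>j<d. j \<noteq> i \<longrightarrow> y j = x j))}"

text \<open>The torus is connected, so the \<open>LEAST\<close> ranges over a nonempty set for all vertices
  \<open>x\<close>, \<open>y\<close>; \<open>E ^^ k\<close> relates the end points of walks of length \<open>k\<close>.\<close>

definition torus_dist :: "nat \<Rightarrow> nat \<Rightarrow> (nat \<Rightarrow> nat) \<Rightarrow> (nat \<Rightarrow> nat) \<Rightarrow> nat" where
  "torus_dist d n x y = (LEAST k. (x, y) \<in> torus_edges d n ^^ k)"

definition torus_cball :: "nat \<Rightarrow> nat \<Rightarrow> (nat \<Rightarrow> nat) \<Rightarrow> nat \<Rightarrow> (nat \<Rightarrow> nat) set" where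
  "torus_cball d n x r = {y \<in> torus d n. torus_dist d n x y \<le> r}"

text \<open>In what follows a sequence \<open>y\<close> of vertices is indexed from 1; its entry \<open>y 0\<close> is never used.\<close>

definition burnt :: "nat \<Rightarrow> nat \<Rightarrow> (nat \<Rightarrow> nat \<Rightarrow> nat) \<Rightarrow> nat \<Rightarrow> (nat \<Rightarrow> nat) set" where
  "burnt d n y k = (\<Union>i\<in>{1..k}. torus_cball d n (y i) (k - i))"

definition covering_time :: "nat \<Rightarrow> nat \<Rightarrow> (nat \<Rightarrow> nat \<Rightarrow> nat) \<Rightarrow> nat" where
  "covering_time d n y = Inf {k. burnt d n y k = torus d n}"

text \<open>The infimum is always over a nonempty set, so the default value \<open>Inf {} = 0\<close> plays no role.\<close>

lemma burnt_eventually_torus: "\<exists>k. burnt d n y k = torus d n"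
proof -
  have fin: "finite (torus d n)"
    by (simp add: torus_def finite_PiE)
  define r where "r = Max (insert 0 (torus_dist d n (y 1) ` torus d n))"
  have "torus_dist d n (y 1) x \<le> r" if "x \<in> torus d n" for x
    unfolding r_def using fin that by (intro Max_ge) auto
  then have "torus d n \<subseteq> torus_cball d n (y 1) (Suc r - 1)"
    by (auto simp: torus_cball_def)
  then have "torus d n \<subseteq> burnt d n y (Suc r)"
    unfolding burnt_def by (intro UN_upper[THEN subset_trans[rotated]]) auto
  moreover have "burnt d n y (Suc r) \<subseteq> torus d n"
    by (auto simp: burnt_def torus_cball_def)
  ultimately show ?thesis
    by blast
qed

text \<open>All variables are discrete, so conditioning on \<open>Y\<^sub>1, \<dots>, Y\<^sub>k\<close> is conditioning on each of their
  joint values of positive probability. For \<open>k = 0\<close> the last clause says that \<open>Y\<^sub>1\<close> is uniform.\<close>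

definition rejection_sampling ::
  "nat \<Rightarrow> nat \<Rightarrow> 'a measure \<Rightarrow> (nat \<Rightarrow> 'a \<Rightarrow> (nat \<Rightarrow> nat)) \<Rightarrow> bool" where
  "rejection_sampling d n M Y \<longleftrightarrow>
     prob_space M \<and>
     (\<forall>k\<ge>1. Y k \<in> measurable M (count_space (torus d n))) \<and>
     (\<forall>k y. burnt d n y k \<noteq> torus d n \<and> \<P>(\<omega> in M. \<forall>i\<in>{1..k}. Y i \<omega> = y i) > 0 \<longrightarrow>
        (\<forall>x\<in>torus d n.
           \<P>(\<omega> in M. Y (k + 1) \<omega> = x \<bar> \<forall>i\<in>{1..k}. Y i \<omega> = y i)
             = pmf (pmf_of_set (torus d n - burnt d n y k)) x))"

text \<open>Convergence in probability to a constant, for variables that may live on different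
  probability spaces. Measurability is demanded explicitly, because \<open>measure\<close> vanishes on
  nonmeasurable sets.\<close>

definition tendsto_in_prob ::
  "(nat \<Rightarrow> 'a measure) \<Rightarrow> (nat \<Rightarrow> 'a \<Rightarrow> real) \<Rightarrow> real \<Rightarrow> bool" where
  "tendsto_in_prob M X c \<longleftrightarrow>
     (\<forall>\<^sub>F n in sequentially. X n \<in> borel_measurable (M n)) \<and>
     (\<forall>\<epsilon>>0. (\<lambda>n. \<P>(\<omega> in M n. \<bar>X n \<omega> - c\<bar> > \<epsilon>)) \<longlonglongrightarrow> 0)"

text \<open>The \<open>k\<close>-th derivative of a function on \<open>S\<close>, one-sided at end points that belong to \<open>S\<close>.\<close>

definition nth_deriv_on :: "real set \<Rightarrow> nat \<Rightarrow> (real \<Rightarrow> real) \<Rightarrow> real \<Rightarrow> real" where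
  "nth_deriv_on S k f = ((\<lambda>g t. vector_derivative g (at t within S)) ^^ k) f"

definition time_interval :: "ereal \<Rightarrow> real set" where
  "time_interval T = {t. 0 \<le> t \<and> ereal t < T}"

definition blasius_solution :: "nat \<Rightarrow> ereal \<Rightarrow> (real \<Rightarrow> real) \<Rightarrow> bool" where
  "blasius_solution d T y \<longleftrightarrow>
     0 < T \<and>
     (\<forall>k\<le>d. nth_deriv_on (time_interval T) k y differentiable_on time_interval T) \<and>
     (\<forall>t\<in>time_interval T.
        nth_deriv_on (time_interval T) (d + 1) y t
          = 2 ^ d * y t * nth_deriv_on (time_interval T) d y t) \<and>
     (\<forall>k<d. nth_deriv_on (time_interval T) k y 0 = 0) \<and>
     nth_deriv_on (time_interval T) d y 0 = 1"

text \<open>Values of \<open>y\<close> outside \<open>[0, T)\<close> are irrelevant. The right end point \<open>T\<close>, a priori possibly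
  infinite, is the explosion time.\<close>

definition maximal_blasius_solution :: "nat \<Rightarrow> ereal \<Rightarrow> (real \<Rightarrow> real) \<Rightarrow> bool" where
  "maximal_blasius_solution d T y \<longleftrightarrow>
     blasius_solution d T y \<and>
     \<not> (\<exists>T' z. T < T' \<and> blasius_solution d T' z \<and> (\<forall>t\<in>time_interval T. z t = y t))"

end

theory Submission
  imports Defs
begin

text \<open>Write \<open>U\<^sub>k\<close> for the set of vertices not burnt at time \<open>k\<close>, \<open>u\<^sub>k = |U\<^sub>k| / n^d\<close>, \<open>b(r)\<close> for the size of a
  ball of radius \<open>r\<close>, and \<open>N = n powr (d/(d+1))\<close>, so that \<open>N^(d+1) = n^d\<close>.

  The key observation is exact. Fix a vertex \<open>x\<close> and a target time \<open>k\<close>. If no fire lit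
  up to time \<open>i < k\<close> reaches \<open>x\<close> by time \<open>k\<close>, then the whole ball of radius \<open>k - i - 1\<close> around \<open>x\<close> is
  still contained in \<open>U\<^sub>i\<close> (lemma \<open>avoids_imp_cball_unburnt\<close>). Hence the next fire, uniform on \<open>U\<^sub>i\<close>,
  burns \<open>x\<close> by time \<open>k\<close> with conditional probability exactly \<open>b(k-i-1) / |U\<^sub>i|\<close>. Dividing the
  indicator that \<open>x\<close> has survived by the product of the factors \<open>1 - b(k-i-1) / |U\<^sub>i|\<close> gives a
  martingale, for which two vertices at distance more than \<open>2k\<close> are non-positively correlated, because
  their balls are disjoint. The second moment of the sum over \<open>x\<close> then shows (lemma
  \<open>S_concentrated\<close>) that \<open>u\<^sub>k\<close> is close to that product with high probability, as long as \<open>u\<close> is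
  bounded away from \<open>0\<close>. Since \<open>b(r)\<close> is asymptotic to \<open>(2r)^d / d!\<close>, on the time scale \<open>N\<close> the function
  \<open>v = 1/u\<close> approximately solves the Volterra equation
  \<open>ln v(t) = (2^d / d!) * (integral over [0,t] of (t-s)^d v(s))\<close>, which is the integral form of the
  Cauchy problem, for \<open>w = y^(d)\<close>.

  Convergence at a fixed time \<open>t < T\<close> needs no linearisation: if \<open>w\<close> is the solution then
  \<open>s \<mapsto> l^(d+1) w(l s)\<close> solves the equation with the constant \<open>(d+1) ln l\<close> added to the right-hand side.
  For \<open>l\<close> slightly above and slightly below \<open>1\<close> this yields strict barriers between which \<open>1/u\<close> is
  confined by induction over time (lemmas \<open>good_alive\<close> and \<open>good_upper\<close>; \<open>unburnt_fraction_converges\<close>).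
  Concentration is only needed at finitely many target times, since \<open>u\<close> is monotone.

  Near the explosion time, once \<open>u\<close> is below a small \<open>\<delta>\<close>, every vertex survives another \<open>m\<close> steps with
  probability at most \<open>exp (- (b(0) + \<dots> + b(m-1)) / (\<delta> n^d))\<close>. Applied along geometrically decreasing
  durations and thresholds, this burns the whole torus within a further time that is a small multiple
  of \<open>N\<close> (lemma \<open>prob_covering_late\<close>). Uniformity in \<open>t\<close> follows from the monotonicity of \<open>u\<close> and of \<open>1/w\<close>.

  On the analytic side, the same dyadic argument shows that solutions of the Volterra equation blow up
  in finite time; a solution that stays bounded on \<open>[0,T)\<close> extends beyond \<open>T\<close> by monotone Picard
  iteration, so the maximal solution satisfies \<open>w(t) \<rightarrow> \<infinity>\<close> as \<open>t \<rightarrow> T\<close> (lemma \<open>maximal_blasius_profile\<close>).\<close>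

section \<open>Graph distance and ball sizes in the torus\<close>

text \<open>Distance of two residues \<open>a\<close>, \<open>b\<close> in the cycle of length \<open>n\<close>; meaningful for \<open>a, b < n\<close>.\<close>

definition cyc_dist :: "nat \<Rightarrow> nat \<Rightarrow> nat \<Rightarrow> nat" where
  "cyc_dist n a b = min (nat \<bar>int a - int b\<bar>) (n - nat \<bar>int a - int b\<bar>)"

text \<open>The sum of the cyclic distances of the coordinates. It is the graph distance of the torus,
  see \<open>torus_dist_eq\<close> below.\<close>

definition l1_dist :: "nat \<Rightarrow> nat \<Rightarrow> (nat \<Rightarrow> nat) \<Rightarrow> (nat \<Rightarrow> nat) \<Rightarrow> nat" where
  "l1_dist d n x y = (\<Sum>i<d. cyc_dist n (x i) (y i))"

lemma cyc_dist_sym: "cyc_dist n a b = cyc_dist n b a"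
  by (simp add: cyc_dist_def abs_minus_commute)

lemma cyc_dist_0_iff: "a < n \<Longrightarrow> b < n \<Longrightarrow> cyc_dist n a b = 0 \<longleftrightarrow> a = b"
  unfolding cyc_dist_def by linarith

lemma Suc_mod_if: "(a::nat) < n \<Longrightarrow> (a + 1) mod n = (if a + 1 = n then 0 else a + 1)"
  by (simp add: mod_Suc)

lemma cyc_dist_add: "cyc_dist n a (a + k) = min k (n - k)" "cyc_dist n (a + k) a = min k (n - k)"
  by (simp_all add: cyc_dist_def)

lemma cyc_dist_Suc:
  assumes "a < n" "b + 1 < n"
  shows "cyc_dist n a (b + 1) \<le> cyc_dist n a b + 1 \<and> cyc_dist n a b \<le> cyc_dist n a (b + 1) + 1"
proof (cases "a \<le> b")
  case True
  then obtain k where "b = a + k" using le_Suc_ex by blast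
  then show ?thesis
    using cyc_dist_add(1)[of n a k] cyc_dist_add(1)[of n a "k + 1"] by (auto simp: min_def)
next
  case False
  then obtain k where "a = b + 1 + k" using le_Suc_ex[of "b + 1" a] by auto
  then show ?thesis
    using cyc_dist_add(2)[of n "b + 1" k] cyc_dist_add(2)[of n b "k + 1"] by (auto simp: min_def)
qed

lemma cyc_dist_wrap:
  assumes "a < n"
  shows "cyc_dist n a 0 \<le> cyc_dist n a (n - 1) + 1 \<and> cyc_dist n a (n - 1) \<le> cyc_dist n a 0 + 1"
proof -
  obtain k where "n - 1 = a + k" using assms by (intro that[of "n - 1 - a"]) simp
  then show ?thesis
    using cyc_dist_add(1)[of n a k] cyc_dist_add(2)[of n 0 a] assms by (auto simp: min_def)
qed

lemma cyc_dist_step: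
  assumes "a < n" "b < n" "c < n" "c = (b + 1) mod n \<or> b = (c + 1) mod n"
  shows "cyc_dist n a c \<le> cyc_dist n a b + 1"
  using assms cyc_dist_Suc[OF assms(1)] cyc_dist_wrap[OF assms(1)]
  unfolding Suc_mod_if[OF assms(2)] Suc_mod_if[OF assms(3)] by (auto split: if_splits)

text \<open>From \<open>b \<noteq> a\<close> some neighbour of \<open>b\<close> in the cycle is closer to \<open>a\<close> by one. The case distinction
  is on which of the two arcs between \<open>a\<close> and \<open>b\<close> is a shortest one.\<close>

lemma cyc_dist_pred:
  assumes "a < n" "b < n" "cyc_dist n a b = Suc r"
  shows "\<exists>c<n. c \<noteq> b \<and> (b = (c + 1) mod n \<or> c = (b + 1) mod n) \<and> cyc_dist n a c = r"
proof (cases "b < a")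
  case True
  then obtain k where k: "a = b + 1 + k" using le_Suc_ex[of "b + 1" a] by auto
  note c = cyc_dist_add(2)[of n b "k + 1"] cyc_dist_add(2)[of n "b + 1" k]
  show ?thesis
  proof (cases "2 * (k + 1) \<le> n")
    case True
    then have "cyc_dist n a (b + 1) = r" using c k assms by (auto simp: min_def split: if_splits)
    then show ?thesis using k assms by (intro exI[of _ "b + 1"]) (auto simp: Suc_mod_if)
  next
    case big: False
    show ?thesis
    proof (cases "b = 0")
      case True
      then have "a + (n - 1 - a) = n - 1" using assms by simp
      then have "cyc_dist n a (n - 1) = r"
        using cyc_dist_add(1)[of n a "n - 1 - a"] c k big True assms by (auto simp: min_def split: if_splits)
      then show ?thesis using k True assms by (intro exI[of _ "n - 1"]) auto
    next
      case False
      then have "cyc_dist n a (b - 1) = r"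
        using cyc_dist_add(2)[of n "b - 1" "k + 2"] c k big assms by (auto simp: min_def split: if_splits)
      then show ?thesis using False assms by (intro exI[of _ "b - 1"]) auto
    qed
  qed
next
  case False
  then obtain k where k: "b = a + k" using le_Suc_ex[of a b] by auto
  have "k \<noteq> 0" using assms k cyc_dist_add(1)[of n a 0] by (auto intro: ccontr)
  note c = cyc_dist_add(1)[of n a k]
  show ?thesis
  proof (cases "2 * k \<le> n")
    case True
    then have "cyc_dist n a (b - 1) = r"
      using cyc_dist_add(1)[of n a "k - 1"] c k \<open>k \<noteq> 0\<close> assms by (auto simp: min_def split: if_splits)
    then show ?thesis using k \<open>k \<noteq> 0\<close> assms by (intro exI[of _ "b - 1"]) auto
  next
    case big: False
    show ?thesis
    proof (cases "b + 1 = n")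
      case True
      then have "cyc_dist n a 0 = r"
        using cyc_dist_add(2)[of n 0 a] c k big True assms by (auto simp: min_def split: if_splits)
      then show ?thesis using k True \<open>k \<noteq> 0\<close> assms by (intro exI[of _ 0]) auto
    next
      case False
      then have "cyc_dist n a (b + 1) = r"
        using cyc_dist_add(1)[of n a "k + 1"] c k big assms by (auto simp: min_def split: if_splits)
      then show ?thesis using False assms by (intro exI[of _ "b + 1"]) (auto simp: Suc_mod_if)
    qed
  qed
qed

lemma torus_less: "x \<in> torus d n \<Longrightarrow> i < d \<Longrightarrow> x i < n"
  unfolding torus_def by (auto simp: PiE_def Pi_def)

lemma finite_torus [simp]: "finite (torus d n)"
  by (simp add: torus_def finite_PiE)

lemma card_torus: "card (torus d n) = n ^ d"
  by (simp add: torus_def card_PiE)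

lemma l1_dist_sym: "l1_dist d n x y = l1_dist d n y x"
  by (simp add: l1_dist_def cyc_dist_sym)

lemma l1_dist_0_iff:
  assumes "x \<in> torus d n" "y \<in> torus d n"
  shows "l1_dist d n x y = 0 \<longleftrightarrow> x = y"
proof
  assume "l1_dist d n x y = 0"
  then have "x i = y i" if "i < d" for i
    using that assms by (auto simp: l1_dist_def cyc_dist_0_iff torus_less)
  then show "x = y"
    using assms unfolding torus_def by (intro PiE_ext) auto
qed (simp add: l1_dist_def cyc_dist_def)

lemma l1_dist_edge:
  assumes "x \<in> torus d n" "(y, z) \<in> torus_edges d n"
  shows "l1_dist d n x z \<le> l1_dist d n x y + 1"
proof -
  from assms(2) obtain i where yz: "y \<in> torus d n" "z \<in> torus d n" and i: "i < d"
    "z i = (y i + 1) mod n \<or> y i = (z i + 1) mod n" "\<And>j. j < d \<Longrightarrow> j \<noteq> i \<Longrightarrow> z j = y j"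
    unfolding torus_edges_def by blast
  have "l1_dist d n x z = cyc_dist n (x i) (z i) + (\<Sum>j\<in>{..<d} - {i}. cyc_dist n (x j) (z j))"
    unfolding l1_dist_def using i by (subst sum.remove[of _ i]) auto
  also have "(\<Sum>j\<in>{..<d} - {i}. cyc_dist n (x j) (z j)) = (\<Sum>j\<in>{..<d} - {i}. cyc_dist n (x j) (y j))"
    using i by (intro sum.cong) auto
  also have "cyc_dist n (x i) (z i) \<le> cyc_dist n (x i) (y i) + 1"
    using i yz assms by (intro cyc_dist_step) (auto simp: torus_less)
  also have "cyc_dist n (x i) (y i) + 1 + (\<Sum>j\<in>{..<d} - {i}. cyc_dist n (x j) (y j)) = l1_dist d n x y + 1"
    unfolding l1_dist_def using i by (subst (2) sum.remove[of _ i]) auto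
  finally show ?thesis by simp
qed

lemma l1_dist_le_walk:
  assumes "x \<in> torus d n" "(x, y) \<in> torus_edges d n ^^ k"
  shows "l1_dist d n x y \<le> k"
  using assms(2)
proof (induction k arbitrary: y)
  case 0
  then show ?case by (simp add: l1_dist_def cyc_dist_def)
next
  case (Suc k)
  then obtain z where "(x, z) \<in> torus_edges d n ^^ k" "(z, y) \<in> torus_edges d n" by auto
  with Suc.IH[of z] l1_dist_edge[OF assms(1)] show ?case by fastforce
qed

lemma walk_l1_dist:
  assumes "x \<in> torus d n" "y \<in> torus d n"
  shows "(x, y) \<in> torus_edges d n ^^ l1_dist d n x y"
  using assms(2)
proof (induction "l1_dist d n x y" arbitrary: y)
  case 0
  then have "l1_dist d n x y = 0" by simp
  then show ?case using 0 assms(1) l1_dist_0_iff[of x d n y] unfolding \<open>l1_dist d n x y = 0\<close> by simp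
next
  case (Suc r)
  have "\<exists>i<d. cyc_dist n (x i) (y i) \<noteq> 0"
  proof (rule ccontr)
    assume "\<not> ?thesis"
    then have "l1_dist d n x y = 0" by (simp add: l1_dist_def)
    with Suc.hyps(2) show False by simp
  qed
  then obtain i where i: "i < d" "cyc_dist n (x i) (y i) \<noteq> 0" by blast
  then obtain q where q: "cyc_dist n (x i) (y i) = Suc q" by (auto simp: gr0_conv_Suc)
  obtain c where c: "c < n" "c \<noteq> y i" "y i = (c + 1) mod n \<or> c = (y i + 1) mod n"
    "cyc_dist n (x i) c = q"
    using cyc_dist_pred[OF _ _ q] torus_less[OF assms(1) i(1)] torus_less[OF Suc.prems i(1)] by blast
  define z where "z = y(i := c)"
  have zi: "z i = c" by (simp add: z_def)
  have z: "z \<in> torus d n"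
    using Suc.prems c i unfolding z_def torus_def by (auto simp: PiE_def extensional_def)
  have "l1_dist d n x z = cyc_dist n (x i) (z i) + (\<Sum>j\<in>{..<d} - {i}. cyc_dist n (x j) (z j))"
    unfolding l1_dist_def using i by (subst sum.remove[of _ i]) auto
  also have "(\<Sum>j\<in>{..<d} - {i}. cyc_dist n (x j) (z j)) = (\<Sum>j\<in>{..<d} - {i}. cyc_dist n (x j) (y j))"
    by (intro sum.cong) (auto simp: z_def)
  finally have "Suc (l1_dist d n x z) = cyc_dist n (x i) (y i) + (\<Sum>j\<in>{..<d} - {i}. cyc_dist n (x j) (y j))"
    by (simp add: zi c q)
  also have "\<dots> = l1_dist d n x y"
    unfolding l1_dist_def using i by (subst (2) sum.remove[of _ i]) auto
  finally have r: "l1_dist d n x z = r" using Suc.hyps(2) by simp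
  have "(x, z) \<in> torus_edges d n ^^ r" using Suc.hyps(1)[of z] r z by auto
  moreover have "(z, y) \<in> torus_edges d n"
    unfolding torus_edges_def using z Suc.prems i c
    by (auto simp: z_def fun_eq_iff intro!: exI[of _ i])
  ultimately show ?case unfolding Suc.hyps(2)[symmetric] by auto
qed

lemma l1_dist_triangle:
  assumes "x \<in> torus d n" "y \<in> torus d n" "z \<in> torus d n"
  shows "l1_dist d n x z \<le> l1_dist d n x y + l1_dist d n y z"
proof -
  have "(x, z) \<in> torus_edges d n ^^ (l1_dist d n x y + l1_dist d n y z)"
    unfolding relpow_add using assms walk_l1_dist by blast
  then show ?thesis using assms l1_dist_le_walk by blast
qed

lemma torus_dist_eq:
  assumes "x \<in> torus d n" "y \<in> torus d n"
  shows "torus_dist d n x y = l1_dist d n x y"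
  unfolding torus_dist_def
  by (intro Least_equality walk_l1_dist l1_dist_le_walk assms)

lemma torus_dist_sym:
  "x \<in> torus d n \<Longrightarrow> y \<in> torus d n \<Longrightarrow> torus_dist d n x y = torus_dist d n y x"
  by (simp add: torus_dist_eq l1_dist_sym)

lemma torus_dist_triangle:
  "x \<in> torus d n \<Longrightarrow> y \<in> torus d n \<Longrightarrow> z \<in> torus d n \<Longrightarrow>
    torus_dist d n x z \<le> torus_dist d n x y + torus_dist d n y z"
  by (simp add: torus_dist_eq l1_dist_triangle)

text \<open>The number of residues at cyclic distance \<open>j\<close> from a given one. For even \<open>n\<close> the antipode,
  at distance \<open>n / 2\<close>, is unique.\<close>

definition cyc_mult :: "nat \<Rightarrow> nat \<Rightarrow> nat" where
  "cyc_mult n j = (if j = 0 then 1 else if 2 * j < n then 2 else if 2 * j = n then 1 else 0)"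

lemma cyc_dist_eq_iff:
  assumes "a < n" "c < n" "2 * j \<le> n"
  shows "cyc_dist n c a = j \<longleftrightarrow> a = c + j \<or> c = a + j \<or> a + j = c + n \<or> c + j = a + n"
proof (cases "a \<le> c")
  case True
  then obtain k where k: "c = a + k" using le_Suc_ex by blast
  then have *: "cyc_dist n c a = min k (n - k)" by (simp add: cyc_dist_def)
  show ?thesis
  proof (cases "k \<le> n - k")
    case True
    then show ?thesis unfolding * min_absorb1[OF True] using assms k by linarith
  next
    case False
    then have "min k (n - k) = n - k" by simp
    then show ?thesis unfolding * using False assms k by linarith
  qed
next
  case False
  then obtain k where k: "a = c + k" using le_Suc_ex nat_le_linear by blast
  then have *: "cyc_dist n c a = min k (n - k)" by (simp add: cyc_dist_def)
  show ?thesis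
  proof (cases "k \<le> n - k")
    case True
    then show ?thesis unfolding * min_absorb1[OF True] using assms k by linarith
  next
    case False
    then have "min k (n - k) = n - k" by simp
    then show ?thesis unfolding * using False assms k by linarith
  qed
qed

lemma card_cyc_dist:
  assumes "c < n"
  shows "card {a\<in>{..<n}. cyc_dist n c a = j} = cyc_mult n j"
proof (cases "2 * j \<le> n")
  case True
  define p q where "p = (if c + j < n then c + j else c + j - n)"
    and "q = (if j \<le> c then c - j else c + n - j)"
  have "a = c + j \<or> c = a + j \<or> a + j = c + n \<or> c + j = a + n \<longleftrightarrow> a = p \<or> a = q" if "a < n" for a
    using that assms True unfolding p_def q_def by auto
  moreover have "p < n" "q < n" using assms True unfolding p_def q_def by auto
  ultimately have eq: "{a\<in>{..<n}. cyc_dist n c a = j} = {p, q}"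
    using cyc_dist_eq_iff[OF _ assms True] by auto
  have "p = q \<longleftrightarrow> j = 0 \<or> 2 * j = n"
    using assms True unfolding p_def q_def by auto
  then show ?thesis using True unfolding eq cyc_mult_def by auto
next
  case False
  have "cyc_dist n c a \<noteq> j" if "a < n" for a
    using False unfolding cyc_dist_def min_def by auto
  then have "{a\<in>{..<n}. cyc_dist n c a = j} = {}" by auto
  then show ?thesis using False by (simp only: cyc_mult_def) auto
qed

text \<open>The size of a closed ball of radius \<open>r\<close>, which does not depend on its centre; the recursion
  splits off the last coordinate.\<close>

fun ball_size :: "nat \<Rightarrow> nat \<Rightarrow> nat \<Rightarrow> nat" where
  "ball_size n 0 r = 1"
| "ball_size n (Suc d) r = (\<Sum>j\<le>r. cyc_mult n j * ball_size n d (r - j))"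

lemma card_l1_ball:
  assumes "\<And>i. i < d \<Longrightarrow> x i < n"
  shows "card {y\<in>torus d n. l1_dist d n x y \<le> r} = ball_size n d r"
  using assms
proof (induction d arbitrary: r)
  case 0
  then show ?case by (simp add: torus_def l1_dist_def)
next
  case (Suc d)
  let ?A = "\<lambda>j. {a\<in>{..<n}. cyc_dist n (x d) a = j}"
  let ?B = "\<lambda>j. {y\<in>torus d n. l1_dist d n x y \<le> r - j}"
  let ?C = "\<lambda>j. (\<lambda>(a, y). y(d := a)) ` (?A j \<times> ?B j)"
  have inj: "inj_on (\<lambda>(a, y). y(d := a)) ({..<n} \<times> torus d n)"
  proof (rule inj_onI, clarify)
    fix a y b z assume *: "y(d := a) = z(d := b)" "y \<in> torus d n" "z \<in> torus d n"
    then have "a = b" by (metis fun_upd_same)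
    moreover have "y = z"
      using * unfolding torus_def
      by (intro PiE_ext[of _ "{..<d}" "\<lambda>_. {..<n}"]) (auto simp: fun_eq_iff, metis less_irrefl)
    ultimately show "a = b \<and> y = z" by simp
  qed
  have decomp: "{y\<in>torus (Suc d) n. l1_dist (Suc d) n x y \<le> r} = (\<Union>j\<le>r. ?C j)"
  proof (intro set_eqI iffI)
    fix y assume y: "y \<in> {y\<in>torus (Suc d) n. l1_dist (Suc d) n x y \<le> r}"
    define z where "z = y(d := undefined)"
    have z: "z \<in> torus d n"
      using y unfolding z_def torus_def by (auto simp: PiE_def extensional_def)
    have l: "l1_dist d n x z = l1_dist d n x y"
      unfolding l1_dist_def by (intro sum.cong) (auto simp: z_def)
    have le: "l1_dist d n x y + cyc_dist n (x d) (y d) \<le> r"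
      using y by (simp add: l1_dist_def)
    have "y = (\<lambda>(a, y). y(d := a)) (y d, z)" by (simp add: z_def)
    moreover have "(y d, z) \<in> ?A (cyc_dist n (x d) (y d)) \<times> ?B (cyc_dist n (x d) (y d))"
      using z l le y torus_less[of y "Suc d" n d] by auto
    ultimately have "y \<in> ?C (cyc_dist n (x d) (y d))" by blast
    moreover have "cyc_dist n (x d) (y d) \<le> r" using le by simp
    ultimately show "y \<in> (\<Union>j\<le>r. ?C j)" by blast
  next
    fix y assume "y \<in> (\<Union>j\<le>r. ?C j)"
    then obtain j a z where j: "j \<le> r" "a < n" "cyc_dist n (x d) a = j" "z \<in> torus d n"
      "l1_dist d n x z \<le> r - j" "y = z(d := a)" by auto
    have "y \<in> torus (Suc d) n"
      using j unfolding torus_def by (auto simp: PiE_def extensional_def Pi_def less_Suc_eq)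
    moreover have "l1_dist (Suc d) n x y = l1_dist d n x z + j"
      using j unfolding l1_dist_def by (auto intro!: sum.cong)
    ultimately show "y \<in> {y\<in>torus (Suc d) n. l1_dist (Suc d) n x y \<le> r}" using j by auto
  qed
  have "disjoint_family_on ?C {..r}"
  proof -
    have "?C i \<inter> ?C j = {}" if "i \<noteq> j" for i j
    proof -
      have "?C i \<inter> ?C j = (\<lambda>(a, y). y(d := a)) ` ((?A i \<times> ?B i) \<inter> (?A j \<times> ?B j))"
        using inj by (intro inj_on_image_Int[symmetric]) auto
      also have "(?A i \<times> ?B i) \<inter> (?A j \<times> ?B j) = {}" using that by auto
      finally show ?thesis by (simp only: image_empty)
    qed
    then show ?thesis by (auto simp: disjoint_family_on_def)
  qed
  then have "card (\<Union>j\<le>r. ?C j) = (\<Sum>j\<le>r. card (?C j))"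
    by (intro card_UN_disjoint) (auto simp: disjoint_family_on_def)
  also have "\<dots> = (\<Sum>j\<le>r. card (?A j \<times> ?B j))"
    by (intro sum.cong refl card_image inj_on_subset[OF inj]) auto
  also have "\<dots> = (\<Sum>j\<le>r. cyc_mult n j * ball_size n d (r - j))"
    using Suc.prems card_cyc_dist[of "x d" n]
    by (intro sum.cong refl) (simp add: card_cartesian_product Suc.IH del: Collect_conj_eq)
  finally show ?case using decomp by simp
qed

lemma card_torus_cball:
  assumes "x \<in> torus d n"
  shows "card (torus_cball d n x r) = ball_size n d r"
proof -
  have "torus_cball d n x r = {y\<in>torus d n. l1_dist d n x y \<le> r}"
    using assms by (auto simp: torus_cball_def torus_dist_eq)
  then show ?thesis using assms card_l1_ball[of d x n r] by (simp add: torus_less)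
qed

lemma ball_size_mono: "r \<le> s \<Longrightarrow> ball_size n d r \<le> ball_size n d s"
proof (induction d arbitrary: r s)
  case (Suc d)
  have "(\<Sum>j\<le>r. cyc_mult n j * ball_size n d (r - j)) \<le> (\<Sum>j\<le>r. cyc_mult n j * ball_size n d (s - j))"
    using Suc by (intro sum_mono mult_left_mono) auto
  also have "\<dots> \<le> (\<Sum>j\<le>s. cyc_mult n j * ball_size n d (s - j))"
    using Suc.prems by (intro sum_mono2) auto
  finally show ?case by simp
qed simp

text \<open>Both bounds are sharp to leading order; the lower one needs that the ball does not wrap around.\<close>

lemma ball_size_upper: "ball_size n d r \<le> 2 ^ d * ((r + d) choose d)"
proof (induction d arbitrary: r)
  case (Suc d)
  have "ball_size n (Suc d) r \<le> (\<Sum>j\<le>r. 2 * (2 ^ d * ((r - j + d) choose d)))"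
    unfolding ball_size.simps by (intro sum_mono mult_mono Suc.IH) (auto simp: cyc_mult_def)
  also have "\<dots> = 2 ^ Suc d * (\<Sum>j\<le>r. (r - j + d) choose d)"
    by (simp add: sum_distrib_left mult.assoc)
  also have "(\<Sum>j\<le>r. (r - j + d) choose d) = (\<Sum>j\<le>r. (d + j) choose d)"
    by (rule sum.reindex_bij_witness[of _ "\<lambda>j. r - j" "\<lambda>j. r - j"]) (auto simp: add.commute)
  also have "\<dots> = (\<Sum>j\<le>r. (d + j) choose j)"
    by (intro sum.cong refl) (metis add_diff_cancel_left' binomial_symmetric le_add1)
  also have "\<dots> = Suc (d + r) choose r" by (rule sum_choose_lower)
  also have "\<dots> = (r + Suc d) choose Suc d"
    using binomial_symmetric[of r "Suc (d + r)"] by (simp add: add.commute)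
  finally show ?case .
qed simp

lemma ball_size_lower: "2 * r < n \<Longrightarrow> 2 ^ d * (r choose d) \<le> ball_size n d r"
proof (induction d arbitrary: r)
  case (Suc d)
  have "2 ^ Suc d * (r choose Suc d) = (\<Sum>i<r. 2 * (2 ^ d * (i choose d)))"
  proof (cases r)
    case (Suc q)
    have "r choose Suc d = (\<Sum>i<r. i choose d)"
      using sum_choose_upper[of d q] Suc by (simp add: lessThan_Suc_atMost)
    then show ?thesis by (simp add: sum_distrib_left mult.assoc)
  qed simp
  also have "\<dots> = (\<Sum>j\<in>{1..r}. 2 * (2 ^ d * ((r - j) choose d)))"
    by (rule sum.reindex_bij_witness[of _ "\<lambda>j. r - j" "\<lambda>j. r - j"]) auto
  also have "\<dots> \<le> (\<Sum>j\<in>{1..r}. cyc_mult n j * ball_size n d (r - j))"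
    using Suc by (intro sum_mono mult_mono Suc.IH) (auto simp: cyc_mult_def)
  also have "\<dots> \<le> (\<Sum>j\<le>r. cyc_mult n j * ball_size n d (r - j))"
    by (intro sum_mono2) auto
  finally show ?case by simp
qed simp

section \<open>Burnt sets\<close>

lemma Icc_Suc: "{1..Suc k} = insert (Suc k) {1..k}"
  by auto

text \<open>The set of vertices that are not burnt at time \<open>k\<close>.\<close>

definition unburnt :: "nat \<Rightarrow> nat \<Rightarrow> (nat \<Rightarrow> nat \<Rightarrow> nat) \<Rightarrow> nat \<Rightarrow> (nat \<Rightarrow> nat) set" where
  "unburnt d n y k = torus d n - burnt d n y k"

text \<open>None of the fires lit at times \<open>1, \<dots>, i\<close> reaches \<open>x\<close> by time \<open>k\<close>, where \<open>i \<le> k\<close>. For \<open>i = k\<close> this means that \<open>x\<close>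
  is not burnt at time \<open>k\<close>.\<close>

definition avoids :: "nat \<Rightarrow> nat \<Rightarrow> (nat \<Rightarrow> nat \<Rightarrow> nat) \<Rightarrow> nat \<Rightarrow> nat \<Rightarrow> (nat \<Rightarrow> nat) \<Rightarrow> bool" where
  "avoids d n y k i x \<longleftrightarrow> (\<forall>j\<in>{1..i}. y j \<notin> torus_cball d n x (k - j))"

text \<open>A sequence of points indexed from 1 need not consist of vertices; the graph distance
  is only meaningful when it does.\<close>

definition valid_upto :: "nat \<Rightarrow> nat \<Rightarrow> nat \<Rightarrow> (nat \<Rightarrow> nat \<Rightarrow> nat) \<Rightarrow> bool" where
  "valid_upto d n k y \<longleftrightarrow> (\<forall>j\<in>{1..k}. y j \<in> torus d n)"

lemma torus_cball_sym:
  "x \<in> torus d n \<Longrightarrow> y \<in> torus d n \<Longrightarrow> y \<in> torus_cball d n x r \<longleftrightarrow> x \<in> torus_cball d n y r"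
  by (auto simp: torus_cball_def torus_dist_sym)

lemma torus_cball_subset: "torus_cball d n x r \<subseteq> torus d n"
  by (auto simp: torus_cball_def)

lemma burnt_subset: "burnt d n y k \<subseteq> torus d n"
  by (auto simp: burnt_def torus_cball_def)

lemma unburnt_subset: "unburnt d n y k \<subseteq> torus d n"
  by (auto simp: unburnt_def)

lemma finite_unburnt [simp]: "finite (unburnt d n y k)"
  by (rule finite_subset[OF unburnt_subset finite_torus])

lemma unburnt_empty_iff: "unburnt d n y k = {} \<longleftrightarrow> burnt d n y k = torus d n"
  using burnt_subset[of d n y k] by (auto simp: unburnt_def)

lemma burnt_mono: "k \<le> l \<Longrightarrow> burnt d n y k \<subseteq> burnt d n y l"
proof
  fix x assume "k \<le> l" "x \<in> burnt d n y k"
  then obtain i where "i \<in> {1..l}" "x \<in> torus_cball d n (y i) (l - i)"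
    by (fastforce simp: burnt_def torus_cball_def)
  then show "x \<in> burnt d n y l" unfolding burnt_def by blast
qed

lemma unburnt_antimono: "k \<le> l \<Longrightarrow> unburnt d n y l \<subseteq> unburnt d n y k"
  using burnt_mono[of k l d n y] by (auto simp: unburnt_def)

lemma card_unburnt_antimono: "k \<le> l \<Longrightarrow> card (unburnt d n y l) \<le> card (unburnt d n y k)"
  by (intro card_mono unburnt_antimono) auto

lemma burnt_cong: "(\<And>j. j \<in> {1..k} \<Longrightarrow> y j = y' j) \<Longrightarrow> burnt d n y k = burnt d n y' k"
  by (auto simp: burnt_def)

lemma unburnt_cong: "(\<And>j. j \<in> {1..k} \<Longrightarrow> y j = y' j) \<Longrightarrow> unburnt d n y k = unburnt d n y' k"
  unfolding unburnt_def using burnt_cong[of k y y' d n] by simp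

lemma valid_upto_mono: "valid_upto d n l y \<Longrightarrow> k \<le> l \<Longrightarrow> valid_upto d n k y"
  by (auto simp: valid_upto_def)

lemma avoids_Suc:
  "avoids d n y k (Suc i) x \<longleftrightarrow> avoids d n y k i x \<and> y (Suc i) \<notin> torus_cball d n x (k - Suc i)"
  unfolding avoids_def Icc_Suc by auto

lemma unburnt_iff_avoids:
  assumes "valid_upto d n k y"
  shows "x \<in> unburnt d n y k \<longleftrightarrow> x \<in> torus d n \<and> avoids d n y k k x"
  using assms torus_cball_sym
  by (auto simp: unburnt_def burnt_def avoids_def valid_upto_def)

lemma avoids_imp_unburnt:
  assumes "valid_upto d n i y" "avoids d n y k i x" "i \<le> k" "x \<in> torus d n"
  shows "x \<in> unburnt d n y i"
proof -
  have "avoids d n y i i x"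
    unfolding avoids_def
  proof
    fix j assume "j \<in> {1..i}"
    with assms show "y j \<notin> torus_cball d n x (i - j)"
      by (auto simp: avoids_def torus_cball_def dest!: bspec[of _ _ j])
  qed
  then show ?thesis using assms unburnt_iff_avoids by blast
qed

text \<open>The geometric heart of the argument: a fire that has burnt, by time \<open>i\<close>, a point of the ball of radius
  \<open>k - i - 1\<close> around \<open>x\<close> reaches \<open>x\<close> by time \<open>k - 1\<close>.\<close>

lemma avoids_imp_cball_unburnt:
  assumes "valid_upto d n i y" "avoids d n y k i x" "i < k" "x \<in> torus d n"
  shows "torus_cball d n x (k - Suc i) \<subseteq> unburnt d n y i"
proof
  fix z assume z: "z \<in> torus_cball d n x (k - Suc i)"
  then have zt: "z \<in> torus d n" "torus_dist d n x z \<le> k - Suc i" by (auto simp: torus_cball_def)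
  have "avoids d n y i i z"
    unfolding avoids_def
  proof
    fix j assume j: "j \<in> {1..i}"
    then have yj: "y j \<in> torus d n" using assms by (auto simp: valid_upto_def)
    have "\<not> torus_dist d n x (y j) \<le> k - j"
      using assms j yj by (auto simp: avoids_def torus_cball_def)
    moreover have "torus_dist d n x (y j) \<le> torus_dist d n x z + torus_dist d n z (y j)"
      using torus_dist_triangle assms zt yj by blast
    ultimately show "y j \<notin> torus_cball d n z (i - j)"
      using zt j assms(3) by (auto simp: torus_cball_def)
  qed
  then show "z \<in> unburnt d n y i" using assms zt unburnt_iff_avoids by blast
qed

lemma cballs_disjoint:
  assumes "x \<in> torus d n" "x' \<in> torus d n" "torus_dist d n x x' > 2 * r"
  shows "torus_cball d n x r \<inter> torus_cball d n x' r = {}"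
proof (rule ccontr)
  assume "\<not> ?thesis"
  then obtain z where z: "z \<in> torus d n" "torus_dist d n x z \<le> r" "torus_dist d n x' z \<le> r"
    by (auto simp: torus_cball_def)
  have "torus_dist d n x x' \<le> torus_dist d n x z + torus_dist d n z x'"
    using torus_dist_triangle assms z by blast
  moreover have "torus_dist d n z x' = torus_dist d n x' z" using torus_dist_sym assms z by blast
  ultimately show False using z assms by simp
qed

lemma ball_size_pos: "ball_size n d r > 0"
proof (induction d)
  case (Suc d)
  have "0 < cyc_mult n 0 * ball_size n d r" using Suc by (simp add: cyc_mult_def)
  also have "\<dots> = (\<Sum>j\<in>{0}. cyc_mult n j * ball_size n d (r - j))" by simp
  also have "\<dots> \<le> (\<Sum>j\<le>r. cyc_mult n j * ball_size n d (r - j))"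
    by (intro sum_mono2) auto
  finally show ?case by simp
qed simp

lemma l1_dist_bound:
  assumes "x \<in> torus d n" "y \<in> torus d n"
  shows "l1_dist d n x y \<le> d * n"
proof -
  have "l1_dist d n x y \<le> (\<Sum>i<d. n)" unfolding l1_dist_def
    by (intro sum_mono) (auto simp: cyc_dist_def)
  then show ?thesis by simp
qed

lemma burnt_all:
  assumes "y 1 \<in> torus d n" "k \<ge> Suc (d * n)"
  shows "burnt d n y k = torus d n"
proof -
  have "torus d n \<subseteq> torus_cball d n (y 1) (k - 1)"
    using assms l1_dist_bound[OF assms(1)] by (force simp: torus_cball_def torus_dist_eq)
  moreover have "torus_cball d n (y 1) (k - 1) \<subseteq> burnt d n y k"
    unfolding burnt_def using assms by (intro UN_upper) auto
  ultimately show ?thesis using burnt_subset by blast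
qed

lemma covering_time_le_iff: "covering_time d n y \<le> k \<longleftrightarrow> burnt d n y k = torus d n"
proof
  assume "covering_time d n y \<le> k"
  moreover have "burnt d n y (covering_time d n y) = torus d n"
    unfolding covering_time_def using burnt_eventually_torus
    by (metis (mono_tags, lifting) Inf_nat_def1 empty_iff mem_Collect_eq)
  ultimately show "burnt d n y k = torus d n" using burnt_mono burnt_subset by blast
next
  assume "burnt d n y k = torus d n"
  then show "covering_time d n y \<le> k" unfolding covering_time_def
    by (intro cInf_lower) auto
qed

section \<open>Expectations of functions of the first steps\<close>

text \<open>A function of a sequence that only depends on its entries \<open>1, \<dots>, k\<close>. The process takes finitely many
  values up to time \<open>k\<close>, so such functions are measurable and integrable, and conditional
  expectations reduce to finite sums.\<close>

definition adapted :: "nat \<Rightarrow> ((nat \<Rightarrow> nat \<Rightarrow> nat) \<Rightarrow> 'b) \<Rightarrow> bool" where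
  "adapted k F \<longleftrightarrow> (\<forall>y y'. (\<forall>j\<in>{1..k}. y j = y' j) \<longrightarrow> F y = F y')"

lemma adaptedD: "adapted k F \<Longrightarrow> (\<And>j. j \<in> {1..k} \<Longrightarrow> y j = y' j) \<Longrightarrow> F y = F y'"
  unfolding adapted_def by blast

lemma adapted_mono: "adapted k F \<Longrightarrow> k \<le> l \<Longrightarrow> adapted l F"
  unfolding adapted_def by auto

lemma adapted_comp: "adapted k F \<Longrightarrow> adapted k (\<lambda>y. g (F y))"
  unfolding adapted_def by metis

lemma adapted_comp2: "adapted k F \<Longrightarrow> adapted k G \<Longrightarrow> adapted k (\<lambda>y. g (F y) (G y))"
  unfolding adapted_def by metis

lemma adapted_unburnt: "i \<le> k \<Longrightarrow> adapted k (\<lambda>y. unburnt d n y i)"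
  unfolding adapted_def by (auto intro!: unburnt_cong)

lemma adapted_avoids: "i \<le> l \<Longrightarrow> adapted l (\<lambda>y. avoids d n y k i x)"
  unfolding adapted_def avoids_def by auto

text \<open>A rejection sampling sequence on a single torus.\<close>

locale rejection_process =
  fixes d n :: nat and M :: "'a measure" and Y :: "nat \<Rightarrow> 'a \<Rightarrow> nat \<Rightarrow> nat"
  assumes n_pos: "n \<ge> 1" and rejection: "rejection_sampling d n M Y"
begin

sublocale prob_space M
  using rejection by (simp add: rejection_sampling_def)

abbreviation path :: "'a \<Rightarrow> nat \<Rightarrow> nat \<Rightarrow> nat" where
  "path \<omega> \<equiv> \<lambda>i. Y i \<omega>"

text \<open>The expectation of a function of the trajectory.\<close>

definition expec :: "((nat \<Rightarrow> nat \<Rightarrow> nat) \<Rightarrow> real) \<Rightarrow> real" where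
  "expec F = (\<integral>\<omega>. F (path \<omega>) \<partial>M)"

text \<open>The event that the first \<open>k\<close> steps of the process agree with those of \<open>y\<close>.\<close>

definition cyl :: "nat \<Rightarrow> (nat \<Rightarrow> nat \<Rightarrow> nat) \<Rightarrow> 'a set" where
  "cyl k y = {\<omega>\<in>space M. \<forall>i\<in>{1..k}. Y i \<omega> = y i}"

text \<open>The possible values of the first \<open>k\<close> steps.\<close>

definition histories :: "nat \<Rightarrow> (nat \<Rightarrow> nat \<Rightarrow> nat) set" where
  "histories k = ({1..k} \<rightarrow>\<^sub>E torus d n)"

lemma Y_measurable: "k \<ge> 1 \<Longrightarrow> Y k \<in> measurable M (count_space (torus d n))"
  using rejection by (simp add: rejection_sampling_def)

lemma Y_in_torus: "k \<ge> 1 \<Longrightarrow> \<omega> \<in> space M \<Longrightarrow> Y k \<omega> \<in> torus d n"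
  using measurable_space[OF Y_measurable] by simp

lemma valid_path: "\<omega> \<in> space M \<Longrightarrow> valid_upto d n k (path \<omega>)"
  by (auto simp: valid_upto_def Y_in_torus)

lemma finite_histories [simp]: "finite (histories k)"
  by (simp add: histories_def finite_PiE)

lemma valid_histories: "h \<in> histories k \<Longrightarrow> valid_upto d n k h"
  by (auto simp: histories_def valid_upto_def)

lemma sets_Y_eq:
  assumes "k \<ge> 1"
  shows "{\<omega>\<in>space M. Y k \<omega> = x} \<in> sets M"
proof (cases "x \<in> torus d n")
  case True
  have "Y k -` {x} \<inter> space M \<in> sets M"
    by (rule measurable_sets[OF Y_measurable[OF assms]]) (use True in auto)
  moreover have "Y k -` {x} \<inter> space M = {\<omega>\<in>space M. Y k \<omega> = x}" by auto
  ultimately show ?thesis by simp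
next
  case False
  then have "{\<omega>\<in>space M. Y k \<omega> = x} = {}" using Y_in_torus[OF assms] by auto
  then show ?thesis by (simp only: sets.empty_sets)
qed

lemma sets_cyl [measurable, simp]: "cyl k y \<in> sets M"
proof -
  have "cyl k y = space M - (\<Union>i\<in>{1..k}. space M - {\<omega>\<in>space M. Y i \<omega> = y i})"
    by (auto simp: cyl_def)
  moreover have "(\<Union>i\<in>{1..k}. space M - {\<omega>\<in>space M. Y i \<omega> = y i}) \<in> sets M"
    by (intro sets.finite_UN sets.Diff sets_Y_eq) auto
  ultimately show ?thesis by auto
qed

lemma adapted_decomp:
  fixes F :: "_ \<Rightarrow> real"
  assumes "adapted k F" "\<omega> \<in> space M"
  shows "F (path \<omega>) = (\<Sum>h\<in>histories k. F h * indicator (cyl k h) \<omega>)"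
proof -
  define h0 where "h0 = restrict (path \<omega>) {1..k}"
  have h0: "h0 \<in> histories k" using Y_in_torus assms by (auto simp: h0_def histories_def)
  have ind: "indicator (cyl k h) \<omega> = (if h = h0 then 1 else 0 :: real)" if "h \<in> histories k" for h
  proof -
    have "\<omega> \<in> cyl k h \<longleftrightarrow> h = h0"
    proof
      assume "\<omega> \<in> cyl k h"
      then show "h = h0" using that h0 unfolding histories_def
        by (intro PiE_ext) (auto simp: cyl_def h0_def)
    qed (use assms in \<open>auto simp: cyl_def h0_def\<close>)
    then show ?thesis by (auto simp: indicator_def)
  qed
  have "(\<Sum>h\<in>histories k. F h * indicator (cyl k h) \<omega>) = (\<Sum>h\<in>histories k. if h = h0 then F h else 0)"
    by (intro sum.cong) (auto simp: ind)
  also have "\<dots> = F h0" using h0 by simp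
  also have "\<dots> = F (path \<omega>)" by (rule adaptedD[OF assms(1)]) (simp add: h0_def)
  finally show ?thesis by simp
qed

lemma adapted_measurable:
  fixes F :: "_ \<Rightarrow> real"
  assumes "adapted k F"
  shows "(\<lambda>\<omega>. F (path \<omega>)) \<in> borel_measurable M"
proof -
  have "(\<lambda>\<omega>. \<Sum>h\<in>histories k. F h * indicator (cyl k h) \<omega>) \<in> borel_measurable M"
    by measurable
  then show ?thesis
    by (rule measurable_cong[THEN iffD1, rotated]) (use adapted_decomp[OF assms] in auto)
qed

lemma adapted_sets:
  assumes "adapted k P"
  shows "{\<omega>\<in>space M. P (path \<omega>)} \<in> sets M"
proof -
  have "(\<lambda>\<omega>. (\<lambda>y. of_bool (P y) :: real) (path \<omega>)) \<in> borel_measurable M"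
    by (rule adapted_measurable[OF adapted_comp[OF assms]])
  then have "(\<lambda>\<omega>. of_bool (P (path \<omega>)) :: real) -` {1} \<inter> space M \<in> sets M"
    by (rule measurable_sets) simp
  moreover have "(\<lambda>\<omega>. of_bool (P (path \<omega>)) :: real) -` {1} \<inter> space M = {\<omega>\<in>space M. P (path \<omega>)}"
    by auto
  ultimately show ?thesis by simp
qed

lemma integrable_adapted:
  fixes F :: "_ \<Rightarrow> real"
  assumes "adapted k F"
  shows "integrable M (\<lambda>\<omega>. F (path \<omega>))"
proof -
  have "integrable M (\<lambda>\<omega>. \<Sum>h\<in>histories k. F h * indicator (cyl k h) \<omega>)"
    by (intro Bochner_Integration.integrable_sum integrable_mult_right integrable_real_indicator)
      (auto simp: less_top[symmetric])
  then show ?thesis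
    by (rule Bochner_Integration.integrable_cong[THEN iffD1, rotated -1]) (use adapted_decomp[OF assms] in auto)
qed

lemma expec_eq_sum:
  assumes "adapted k F"
  shows "expec F = (\<Sum>h\<in>histories k. F h * prob (cyl k h))"
proof -
  have "expec F = (\<integral>\<omega>. (\<Sum>h\<in>histories k. F h * indicator (cyl k h) \<omega>) \<partial>M)"
    unfolding expec_def by (intro Bochner_Integration.integral_cong refl adapted_decomp assms)
  also have "\<dots> = (\<Sum>h\<in>histories k. \<integral>\<omega>. F h * indicator (cyl k h) \<omega> \<partial>M)"
    by (intro Bochner_Integration.integral_sum integrable_mult_right integrable_real_indicator)
      (auto simp: less_top[symmetric])
  also have "\<dots> = (\<Sum>h\<in>histories k. F h * prob (cyl k h))"
    by (intro sum.cong refl) simp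
  finally show ?thesis .
qed

lemma cyl_Suc: "cyl (Suc k) (h(Suc k := x)) = {\<omega>\<in>cyl k h. Y (Suc k) \<omega> = x}"
proof -
  have "(\<forall>i\<in>{1..k}. Y i \<omega> = (h(Suc k := x)) i) \<longleftrightarrow> (\<forall>i\<in>{1..k}. Y i \<omega> = h i)" for \<omega>
    by (intro ball_cong) auto
  then show ?thesis unfolding cyl_def Icc_Suc by auto
qed

lemma prob_cyl_Suc:
  assumes "unburnt d n h k \<noteq> {}" "x \<in> torus d n"
  shows "prob (cyl (Suc k) (h(Suc k := x))) =
    (if x \<in> unburnt d n h k then prob (cyl k h) / card (unburnt d n h k) else 0)"
proof (cases "prob (cyl k h) > 0")
  case True
  have "burnt d n h k \<noteq> torus d n" using assms unburnt_empty_iff by blast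
  with True rejection assms(2) have "\<P>(\<omega> in M. Y (k + 1) \<omega> = x \<bar> \<forall>i\<in>{1..k}. Y i \<omega> = h i)
             = pmf (pmf_of_set (torus d n - burnt d n h k)) x"
    unfolding rejection_sampling_def cyl_def by blast
  also have "\<dots> = (if x \<in> unburnt d n h k then 1 / card (unburnt d n h k) else 0)"
    using assms(1) by (simp add: unburnt_def[symmetric] indicator_def)
  also have "\<P>(\<omega> in M. Y (k + 1) \<omega> = x \<bar> \<forall>i\<in>{1..k}. Y i \<omega> = h i)
    = prob {\<omega>\<in>space M. Y (Suc k) \<omega> = x \<and> (\<forall>i\<in>{1..k}. Y i \<omega> = h i)} / prob (cyl k h)"
    by (simp add: cond_prob_def cyl_def)
  also have "{\<omega>\<in>space M. Y (Suc k) \<omega> = x \<and> (\<forall>i\<in>{1..k}. Y i \<omega> = h i)} = cyl (Suc k) (h(Suc k := x))"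
    unfolding cyl_Suc by (auto simp: cyl_def)
  finally show ?thesis using True by (auto simp: field_simps split: if_splits)
next
  case False
  then have "prob (cyl k h) = 0" using measure_nonneg[of M "cyl k h"] by linarith
  moreover have "prob (cyl (Suc k) (h(Suc k := x))) \<le> prob (cyl k h)"
    by (intro finite_measure_mono) (auto simp: cyl_Suc)
  ultimately show ?thesis using measure_nonneg[of M "cyl (Suc k) (h(Suc k := x))"] by auto
qed

lemma sum_prob_cyl_Suc: "(\<Sum>x\<in>torus d n. prob (cyl (Suc k) (h(Suc k := x)))) = prob (cyl k h)"
proof -
  have eq: "cyl k h = (\<Union>x\<in>torus d n. cyl (Suc k) (h(Suc k := x)))"
    using Y_in_torus[of "Suc k"] unfolding cyl_Suc by (auto simp: cyl_def)
  have "prob (cyl k h) = prob (\<Union>x\<in>torus d n. cyl (Suc k) (h(Suc k := x)))"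
    using eq by simp
  also have "\<dots> = (\<Sum>x\<in>torus d n. prob (cyl (Suc k) (h(Suc k := x))))"
  proof (intro finite_measure_finite_Union)
    show "(\<lambda>x. cyl (Suc k) (h(Suc k := x))) ` torus d n \<subseteq> sets M" using sets_cyl by blast
    show "disjoint_family_on (\<lambda>x. cyl (Suc k) (h(Suc k := x))) (torus d n)"
      unfolding disjoint_family_on_def cyl_Suc by blast
  qed simp
  finally show ?thesis ..
qed

text \<open>The only form in which the conditional law of the next step is used. Nothing is known about the step
  after the torus has been covered, hence the second, pointwise, hypothesis.\<close>

lemma expec_step:
  fixes F G :: "_ \<Rightarrow> real"
  assumes F: "adapted k F" and G: "adapted (Suc k) G"
    and step: "\<And>y. valid_upto d n k y \<Longrightarrow> unburnt d n y k \<noteq> {} \<Longrightarrow>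
      (\<Sum>x\<in>unburnt d n y k. G (y(Suc k := x))) \<le> card (unburnt d n y k) * F y"
    and covered: "\<And>y x. valid_upto d n k y \<Longrightarrow> unburnt d n y k = {} \<Longrightarrow> x \<in> torus d n \<Longrightarrow>
      G (y(Suc k := x)) \<le> F y"
  shows "expec G \<le> expec F"
proof -
  have "inj_on (\<lambda>(h, x). h(Suc k := x)) (histories k \<times> torus d n)"
  proof (rule inj_onI, clarify)
    fix h x h' x' assume *: "h(Suc k := x) = h'(Suc k := x')" "h \<in> histories k" "h' \<in> histories k"
    then have "x = x'" by (metis fun_upd_same)
    moreover have "h = h'"
      using * unfolding histories_def
    proof (intro PiE_ext[of _ "{1..k}" "\<lambda>_. torus d n"])
      fix j assume "j \<in> {1..k}"
      then show "h j = h' j" using fun_cong[OF *(1), of j] by auto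
    qed auto
    ultimately show "h = h' \<and> x = x'" by simp
  qed
  moreover have "(\<lambda>(h, x). h(Suc k := x)) ` (histories k \<times> torus d n) = histories (Suc k)"
  proof (intro set_eqI iffI)
    fix h assume h: "h \<in> histories (Suc k)"
    have "h(Suc k := undefined) \<in> histories k"
      using h unfolding histories_def by (auto simp: PiE_def extensional_def Pi_def)
    moreover have "h (Suc k) \<in> torus d n" using h by (auto simp: histories_def PiE_def Pi_def)
    moreover have "h = (\<lambda>(h, x). h(Suc k := x)) (h(Suc k := undefined), h (Suc k))" by simp
    ultimately show "h \<in> (\<lambda>(h, x). h(Suc k := x)) ` (histories k \<times> torus d n)" by blast
  qed (auto simp: histories_def PiE_def extensional_def Pi_def le_Suc_eq)
  ultimately have bij: "bij_betw (\<lambda>(h, x). h(Suc k := x)) (histories k \<times> torus d n) (histories (Suc k))"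
    by (simp add: bij_betw_def)
  have "expec G = (\<Sum>h\<in>histories (Suc k). G h * prob (cyl (Suc k) h))"
    by (rule expec_eq_sum[OF G])
  also have "\<dots> = (\<Sum>(h, x)\<in>histories k \<times> torus d n. G (h(Suc k := x)) * prob (cyl (Suc k) (h(Suc k := x))))"
    by (subst sum.reindex_bij_betw[OF bij, symmetric]) (simp add: case_prod_beta)
  also have "\<dots> = (\<Sum>h\<in>histories k. \<Sum>x\<in>torus d n. G (h(Suc k := x)) * prob (cyl (Suc k) (h(Suc k := x))))"
    by (simp add: sum.cartesian_product)
  also have "\<dots> \<le> (\<Sum>h\<in>histories k. F h * prob (cyl k h))"
  proof (rule sum_mono)
    fix h assume h: "h \<in> histories k"
    note v = valid_histories[OF h]
    show "(\<Sum>x\<in>torus d n. G (h(Suc k := x)) * prob (cyl (Suc k) (h(Suc k := x)))) \<le> F h * prob (cyl k h)"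
    proof (cases "unburnt d n h k = {}")
      case True
      have "(\<Sum>x\<in>torus d n. G (h(Suc k := x)) * prob (cyl (Suc k) (h(Suc k := x)))) \<le>
        (\<Sum>x\<in>torus d n. F h * prob (cyl (Suc k) (h(Suc k := x))))"
        by (intro sum_mono mult_right_mono covered v True) auto
      also have "\<dots> = F h * prob (cyl k h)"
        by (simp only: sum_distrib_left[symmetric] sum_prob_cyl_Suc)
      finally show ?thesis .
    next
      case False
      let ?u = "unburnt d n h k"
      have c: "real (card ?u) > 0" using False by (simp add: card_gt_0_iff)
      have "(\<Sum>x\<in>torus d n. G (h(Suc k := x)) * prob (cyl (Suc k) (h(Suc k := x)))) =
        (\<Sum>x\<in>torus d n. if x \<in> ?u then G (h(Suc k := x)) * (prob (cyl k h) / card ?u) else 0)"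
        using False by (intro sum.cong) (auto simp: prob_cyl_Suc)
      also have "\<dots> = (\<Sum>x\<in>torus d n \<inter> ?u. G (h(Suc k := x)) * (prob (cyl k h) / card ?u))"
        by (subst sum.inter_restrict) auto
      also have "torus d n \<inter> ?u = ?u" using unburnt_subset by blast
      also have "(\<Sum>x\<in>?u. G (h(Suc k := x)) * (prob (cyl k h) / card ?u)) =
         (\<Sum>x\<in>?u. G (h(Suc k := x))) * (prob (cyl k h) / card ?u)"
        by (simp only: sum_distrib_right)
      also have "\<dots> \<le> card ?u * F h * (prob (cyl k h) / card ?u)"
        by (intro mult_right_mono step v False) auto
      also have "\<dots> = F h * prob (cyl k h)" using False by simp
      finally show ?thesis .
    qed
  qed
  also have "\<dots> = expec F" by (rule expec_eq_sum[OF F, symmetric])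
  finally show ?thesis .
qed

lemma expec_mono:
  fixes F G :: "_ \<Rightarrow> real"
  assumes "adapted k F" "adapted k G" "\<And>y. valid_upto d n k y \<Longrightarrow> F y \<le> G y"
  shows "expec F \<le> expec G"
  unfolding expec_eq_sum[OF assms(1)] expec_eq_sum[OF assms(2)]
  by (intro sum_mono mult_right_mono assms(3) valid_histories) auto

lemma expec_const [simp]: "expec (\<lambda>_. c) = c"
  by (simp add: expec_def prob_space)

lemma expec_sum:
  assumes "finite A" "\<And>a. a \<in> A \<Longrightarrow> adapted k (F a)"
  shows "expec (\<lambda>y. \<Sum>a\<in>A. F a y) = (\<Sum>a\<in>A. expec (F a))"
  unfolding expec_def using integrable_adapted[OF assms(2)]
  by (intro Bochner_Integration.integral_sum)

lemma expec_scale: "expec (\<lambda>y. c * F y) = c * expec F"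
  by (simp add: expec_def)

lemma expec_add:
  assumes "adapted k F" "adapted k G"
  shows "expec (\<lambda>y. F y + G y) = expec F + expec G"
  unfolding expec_def
  by (intro Bochner_Integration.integral_add integrable_adapted[OF assms(1)] integrable_adapted[OF assms(2)])

lemma prob_eq_expec:
  assumes "adapted k P"
  shows "prob {\<omega>\<in>space M. P (path \<omega>)} = expec (\<lambda>y. of_bool (P y))"
proof -
  have "expec (\<lambda>y. of_bool (P y)) = (\<integral>\<omega>. indicator {\<omega>\<in>space M. P (path \<omega>)} \<omega> \<partial>M)"
    unfolding expec_def by (intro Bochner_Integration.integral_cong) (auto simp: indicator_def)
  also have "\<dots> = prob {\<omega>\<in>space M. P (path \<omega>)}" 
    using adapted_sets[OF assms] by simp
  finally show ?thesis ..
qed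

lemma prob_le_expec:
  assumes "adapted k P" "adapted k F" "\<And>y. valid_upto d n k y \<Longrightarrow> F y \<ge> 0"
    "\<And>y. valid_upto d n k y \<Longrightarrow> P y \<Longrightarrow> c \<le> F y" "c > 0"
  shows "prob {\<omega>\<in>space M. P (path \<omega>)} \<le> expec F / c"
proof -
  have "expec (\<lambda>y. of_bool (P y)) \<le> expec (\<lambda>y. (1 / c) * F y)"
  proof (rule expec_mono)
    show "adapted k (\<lambda>y. of_bool (P y) :: real)" by (rule adapted_comp[OF assms(1)])
    show "adapted k (\<lambda>y. 1 / c * F y)" by (rule adapted_comp[OF assms(2)])
  qed (use assms in \<open>auto simp: field_simps\<close>)
  then show ?thesis unfolding prob_eq_expec[OF assms(1)] by (simp only: expec_scale) simp
qed

end

section \<open>The survival martingale and its concentration\<close>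

lemma one_minus_ge_exp:
  fixes p :: real
  assumes "0 \<le> p" "p \<le> 1/2"
  shows "exp (- p - 2 * p\<^sup>2) \<le> 1 - p"
proof -
  have "- p - 2 * p\<^sup>2 \<le> ln (1 - p)" using ln_one_minus_pos_lower_bound assms by blast
  then show ?thesis using assms by (subst ln_ge_iff[symmetric]) auto
qed

lemma one_minus_ge_exp2:
  fixes p :: real
  assumes "0 \<le> p" "p \<le> 1/2"
  shows "exp (- 2 * p) \<le> 1 - p"
proof -
  have "2 * p\<^sup>2 \<le> p" using assms mult_left_mono[of p "1/2" p] by (simp add: power2_eq_square)
  then have "exp (- 2 * p) \<le> exp (- p - 2 * p\<^sup>2)" by simp
  with one_minus_ge_exp[OF assms] show ?thesis by linarith
qed

lemma adapted_sum: "(\<And>a. adapted k (F a)) \<Longrightarrow> adapted k (\<lambda>y. \<Sum>a\<in>A. F a y)"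
  unfolding adapted_def by (intro allI impI sum.cong refl) blast

lemma diff_eq_mult_one_minus: "(u::real) > 0 \<Longrightarrow> u - b = u * (1 - b / u)"
  by (simp add: field_simps)

lemma variance_quotient: "(V::real) > 0 \<Longrightarrow> e > 0 \<Longrightarrow> V * K / (e * V)\<^sup>2 = K / (e\<^sup>2 * V)"
  by (simp add: power2_eq_square field_simps)

text \<open>The martingale for the target time \<open>k\<close> is frozen when \<open>alive\<close> first fails. While \<open>alive\<close> holds, at
  least \<open>L\<close> vertices are not burnt, so that all hitting probabilities are at most \<open>1/2\<close>.\<close>

locale stopped_process = rejection_process d n M Y
  for d n :: nat and M :: "'a measure" and Y :: "nat \<Rightarrow> 'a \<Rightarrow> nat \<Rightarrow> nat" +
  fixes k :: nat and L :: real and alive :: "nat \<Rightarrow> (nat \<Rightarrow> nat \<Rightarrow> nat) \<Rightarrow> bool"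
  assumes alive_adapted: "adapted i (alive i)"
    and alive_Suc: "alive (Suc i) y \<Longrightarrow> alive i y"
    and alive_card: "alive i y \<Longrightarrow> L \<le> card (unburnt d n y i)"
    and L_ge: "2 * real (ball_size n d k) \<le> L"
begin

text \<open>The conditional probability that the fire lit at time \<open>i + 1\<close> reaches, by time \<open>k\<close>, a given vertex
  that has avoided the previous ones.\<close>

definition hit :: "nat \<Rightarrow> (nat \<Rightarrow> nat \<Rightarrow> nat) \<Rightarrow> real" where
  "hit i y = real (ball_size n d (k - Suc i)) / card (unburnt d n y i)"

text \<open>The factor by which the martingale of the vertex \<open>x\<close> is multiplied at time \<open>i + 1\<close>.\<close>

definition weight :: "(nat \<Rightarrow> nat) \<Rightarrow> nat \<Rightarrow> (nat \<Rightarrow> nat \<Rightarrow> nat) \<Rightarrow> real" where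
  "weight x i y = (if alive i y
     then (if y (Suc i) \<in> torus_cball d n x (k - Suc i) then 0 else 1 / (1 - hit i y)) else 1)"

text \<open>The martingale of the vertex \<open>x\<close>: the indicator that \<open>x\<close> has survived, divided by the product of
  the conditional survival probabilities, cf. \<open>Z_eq\<close>.\<close>

definition Z :: "(nat \<Rightarrow> nat) \<Rightarrow> nat \<Rightarrow> (nat \<Rightarrow> nat \<Rightarrow> nat) \<Rightarrow> real" where
  "Z x i y = (\<Prod>j<i. weight x j y)"

definition S :: "(nat \<Rightarrow> nat \<Rightarrow> nat) \<Rightarrow> real" where
  "S y = (\<Sum>x\<in>torus d n. Z x k y)"

lemma L_pos: "L > 0"
  using L_ge ball_size_pos[of n d k] by linarith

lemma alive_antimono: "alive j y \<Longrightarrow> i \<le> j \<Longrightarrow> alive i y"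
  by (induction j) (use alive_Suc in \<open>auto simp: le_Suc_eq\<close>)

lemma alive_card_pos: "alive i y \<Longrightarrow> real (card (unburnt d n y i)) > 0"
  using alive_card L_pos by fastforce

lemma hit_bounds:
  assumes "alive i y"
  shows "0 \<le> hit i y" "hit i y \<le> real (ball_size n d (k - Suc i)) / L" "hit i y \<le> 1/2"
proof -
  show "0 \<le> hit i y" by (simp add: hit_def)
  show *: "hit i y \<le> real (ball_size n d (k - Suc i)) / L"
    unfolding hit_def using alive_card[OF assms] L_pos alive_card_pos[OF assms]
    by (intro divide_left_mono) (auto intro: mult_pos_pos)
  have "ball_size n d (k - Suc i) \<le> ball_size n d k" by (intro ball_size_mono) auto
  then have "real (ball_size n d (k - Suc i)) / L \<le> 1/2" using L_ge L_pos by (simp add: field_simps)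
  with * show "hit i y \<le> 1/2" by linarith
qed

lemma adapted_hit: "adapted i (hit i)"
  unfolding hit_def by (rule adapted_comp[OF adapted_unburnt]) simp

lemma adapted_weight: "adapted (Suc i) (weight x i)"
  unfolding adapted_def
proof (intro allI impI)
  fix y y' :: "nat \<Rightarrow> nat \<Rightarrow> nat" assume "\<forall>j\<in>{1..Suc i}. y j = y' j"
  then have *: "\<And>j. j \<in> {1..i} \<Longrightarrow> y j = y' j" "y (Suc i) = y' (Suc i)" by auto
  have "alive i y = alive i y'" by (rule adaptedD[OF alive_adapted]) (use * in auto)
  moreover have "hit i y = hit i y'" by (rule adaptedD[OF adapted_hit]) (use * in auto)
  ultimately show "weight x i y = weight x i y'"
    unfolding weight_def *(2) by simp
qed

lemma adapted_Z: "adapted i (Z x i)"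
proof (induction i)
  case (Suc i)
  have "Z x (Suc i) = (\<lambda>y. Z x i y * weight x i y)" by (simp add: Z_def fun_eq_iff)
  then show ?case
    using adapted_comp2[OF adapted_mono[OF Suc le_SucI[OF order_refl]] adapted_weight] by metis
qed (simp add: adapted_def Z_def)

lemma Z_upd: "Z x i (y(Suc i := w)) = Z x i y"
  by (rule adaptedD[OF adapted_Z]) auto

lemma hit_upd: "hit i (y(Suc i := w)) = hit i y"
  by (rule adaptedD[OF adapted_hit]) auto

lemma alive_upd: "alive i (y(Suc i := w)) = alive i y"
  by (rule adaptedD[OF alive_adapted]) auto

lemma weight_nonneg: "weight x i y \<ge> 0"
  using hit_bounds(3)[of i y] by (auto simp: weight_def)

lemma Z_nonneg: "Z x i y \<ge> 0"
  unfolding Z_def by (intro prod_nonneg) (simp add: weight_nonneg)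

lemma weight_le: "weight x i y \<le> exp (2 * real (ball_size n d k) / L)"
proof (cases "alive i y")
  case True
  note h = hit_bounds[OF True]
  have "1 / (1 - hit i y) \<le> 1 / exp (- 2 * hit i y)"
    using one_minus_ge_exp2[OF h(1,3)] h by (intro divide_left_mono) auto
  also have "\<dots> = exp (2 * hit i y)" by (simp add: exp_minus field_simps)
  also have "\<dots> \<le> exp (2 * (real (ball_size n d (k - Suc i)) / L))" using h(2) by simp
  also have "\<dots> \<le> exp (2 * real (ball_size n d k) / L)"
    using ball_size_mono[of "k - Suc i" k n d] L_pos by (auto simp: divide_right_mono)
  finally show ?thesis using True by (simp add: weight_def)
next
  case False
  then show ?thesis using L_pos by (simp add: weight_def)
qed

lemma Z_le: "Z x k y \<le> exp (2 * real k * real (ball_size n d k) / L)"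
proof -
  have "Z x k y \<le> (\<Prod>j<k. exp (2 * real (ball_size n d k) / L))"
    unfolding Z_def by (intro prod_mono) (simp add: weight_nonneg weight_le)
  also have "\<dots> = exp (2 * real k * real (ball_size n d k) / L)"
    by (simp add: exp_of_nat_mult[symmetric] field_simps)
  finally show ?thesis .
qed

lemma Z_eq:
  assumes "\<forall>j<i. alive j y"
  shows "Z x i y = (if avoids d n y k i x then 1 / (\<Prod>j<i. 1 - hit j y) else 0)"
  using assms
proof (induction i)
  case 0
  then show ?case by (simp add: Z_def avoids_def)
next
  case (Suc i)
  have "Z x (Suc i) y = Z x i y * weight x i y" by (simp add: Z_def)
  with Suc show ?case by (simp add: weight_def avoids_Suc)
qed

lemma Z_stopped:
  assumes "s \<le> k" "s = k \<or> \<not> alive s y"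
  shows "Z x k y = Z x s y"
proof -
  have "Z x l y = Z x s y" if "l \<ge> s" "l \<le> k" for l
    using that
  proof (induction l rule: dec_induct)
    case (step m)
    have "\<not> alive m y" using assms step alive_antimono[of m y s] by auto
    moreover have "Z x (Suc m) y = Z x m y * weight x m y" by (simp add: Z_def)
    ultimately show ?case using step by (simp add: weight_def)
  qed simp
  from this[OF assms(1) order_refl] show ?thesis .
qed

lemma weight_upd:
  "weight x i (y(Suc i := w)) = (if alive i y
     then (if w \<in> torus_cball d n x (k - Suc i) then 0 else 1 / (1 - hit i y)) else 1)"
  by (simp add: weight_def alive_upd hit_upd)

lemma Z_nonzero_cball:
  assumes "Z x i y \<noteq> 0" "alive i y" "valid_upto d n i y" "i < k" "x \<in> torus d n"
  shows "torus_cball d n x (k - Suc i) \<subseteq> unburnt d n y i"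
proof -
  have "\<forall>j<i. alive j y" using alive_antimono assms(2) by (metis less_imp_le)
  then have "avoids d n y k i x" using Z_eq[of i y x] assms(1) by (auto split: if_splits)
  then show ?thesis using avoids_imp_cball_unburnt assms by blast
qed

lemma sum_weight:
  assumes "alive i y" "A \<subseteq> torus d n" "A \<subseteq> unburnt d n y i" 
  shows "(\<Sum>w\<in>unburnt d n y i. if w \<in> A then 0 else c) = (card (unburnt d n y i) - real (card A)) * (c::real)"
proof -
  have "(\<Sum>w\<in>unburnt d n y i. if w \<in> A then 0 else c) = (\<Sum>w\<in>unburnt d n y i - A. c)"
    by (rule sum.mono_neutral_cong_right) auto
  also have "\<dots> = real (card (unburnt d n y i - A)) * c" by simp
  also have "card (unburnt d n y i - A) = card (unburnt d n y i) - card A"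
    using assms by (intro card_Diff_subset) (auto intro: finite_subset)
  finally show ?thesis using card_mono[OF _ assms(3)] by (simp add: of_nat_diff)
qed

lemma Z_step:
  assumes "valid_upto d n i y" "i < k" "x \<in> torus d n"
  shows "(\<Sum>w\<in>unburnt d n y i. Z x (Suc i) (y(Suc i := w))) = card (unburnt d n y i) * Z x i y"
proof -
  have eq: "Z x (Suc i) (y(Suc i := w)) = Z x i y * weight x i (y(Suc i := w))" for w
    using Z_upd[of x i y w] by (simp add: Z_def)
  consider "\<not> alive i y" | "Z x i y = 0" | "alive i y" "Z x i y \<noteq> 0" by blast
  then show ?thesis
  proof cases
    case 3
    let ?B = "torus_cball d n x (k - Suc i)"
    let ?u = "real (card (unburnt d n y i))"
    note B = Z_nonzero_cball[OF 3(2,1) assms]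
    have "(\<Sum>w\<in>unburnt d n y i. weight x i (y(Suc i := w))) =
      (\<Sum>w\<in>unburnt d n y i. if w \<in> ?B then 0 else 1 / (1 - hit i y))"
      using 3 by (simp add: weight_upd)
    also have "\<dots> = (?u - real (card ?B)) * (1 / (1 - hit i y))"
      using 3 B torus_cball_subset by (intro sum_weight) auto
    also have "?u - real (card ?B) = ?u * (1 - hit i y)"
      unfolding hit_def card_torus_cball[OF assms(3)]
      by (rule diff_eq_mult_one_minus[OF alive_card_pos[OF 3(1)]])
    also have "\<dots> * (1 / (1 - hit i y)) = ?u" using hit_bounds(3)[OF 3(1)] by simp
    finally have f: "(\<Sum>w\<in>unburnt d n y i. weight x i (y(Suc i := w))) = ?u" .
    show ?thesis unfolding eq sum_distrib_left[symmetric] f by (rule mult.commute)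
  qed (simp_all add: eq weight_upd)
qed

text \<open>For distant vertices both balls are disjoint subsets of the unburnt set, so that the conditional
  probability of surviving both is \<open>1 - 2p \<le> (1 - p)^2\<close>, with \<open>p\<close> the hitting probability of one.\<close>

lemma Z_step2:
  assumes "valid_upto d n i y" "i < k" "x \<in> torus d n" "x' \<in> torus d n" "torus_dist d n x x' > 2 * k"
  shows "(\<Sum>w\<in>unburnt d n y i. Z x (Suc i) (y(Suc i := w)) * Z x' (Suc i) (y(Suc i := w)))
     \<le> card (unburnt d n y i) * (Z x i y * Z x' i y)"
proof -
  have eq: "Z x (Suc i) (y(Suc i := w)) * Z x' (Suc i) (y(Suc i := w)) =
      Z x i y * Z x' i y * (weight x i (y(Suc i := w)) * weight x' i (y(Suc i := w)))" for w
    using Z_upd[of x i y w] Z_upd[of x' i y w] by (simp add: Z_def)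
  consider "\<not> alive i y" | "Z x i y = 0 \<or> Z x' i y = 0" | "alive i y" "Z x i y \<noteq> 0" "Z x' i y \<noteq> 0" by blast
  then show ?thesis
  proof cases
    case 3
    let ?B = "torus_cball d n x (k - Suc i)" and ?B' = "torus_cball d n x' (k - Suc i)"
    let ?u = "real (card (unburnt d n y i))"
    let ?c = "(1 / (1 - hit i y)) * (1 / (1 - hit i y))"
    note B = Z_nonzero_cball[OF 3(2,1) assms(1-3)]
    note B' = Z_nonzero_cball[OF 3(3,1) assms(1,2,4)]
    have fin: "finite ?B" "finite ?B'" using B B' finite_subset finite_unburnt by metis+
    have disj: "?B \<inter> ?B' = {}" using assms by (intro cballs_disjoint) auto
    have cB: "real (card (?B \<union> ?B')) = 2 * real (ball_size n d (k - Suc i))"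
      using card_Un_disjoint[OF fin disj] assms by (simp add: card_torus_cball)
    have h: "1 - hit i y > 0" using hit_bounds(3)[OF 3(1)] by simp
    have "(\<Sum>w\<in>unburnt d n y i. weight x i (y(Suc i := w)) * weight x' i (y(Suc i := w))) =
      (\<Sum>w\<in>unburnt d n y i. if w \<in> ?B \<union> ?B' then 0 else ?c)"
      using 3 by (intro sum.cong) (auto simp: weight_upd)
    also have "\<dots> = (?u - real (card (?B \<union> ?B'))) * ?c"
      using 3 B B' torus_cball_subset by (intro sum_weight) auto
    also have "?u - real (card (?B \<union> ?B')) = ?u * (1 - 2 * hit i y)"
      unfolding cB hit_def using diff_eq_mult_one_minus[OF alive_card_pos[OF 3(1)]] by simp
    also have "\<dots> * ?c \<le> ?u * ((1 - hit i y) * (1 - hit i y)) * ?c"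
    proof (intro mult_right_mono mult_left_mono)
      show "1 - 2 * hit i y \<le> (1 - hit i y) * (1 - hit i y)" by (simp add: algebra_simps)
    qed simp_all
    also have "\<dots> = ?u" using h by simp
    finally have f: "(\<Sum>w\<in>unburnt d n y i. weight x i (y(Suc i := w)) * weight x' i (y(Suc i := w))) \<le> ?u" .
    from mult_left_mono[OF f mult_nonneg_nonneg[OF Z_nonneg Z_nonneg], of x i y x' i y]
    show ?thesis
      unfolding eq sum_distrib_left[symmetric] mult.commute[of ?u] .
  qed (auto simp: eq weight_upd)
qed

lemma covered_not_alive: "unburnt d n y i = {} \<Longrightarrow> \<not> alive i y"
  using alive_card_pos[of i y] by auto

lemma Z_covered: "unburnt d n y i = {} \<Longrightarrow> Z x (Suc i) (y(Suc i := w)) = Z x i y"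
  using covered_not_alive[of y i] Z_upd[of x i y w] by (simp add: Z_def weight_upd)

lemma expec_Z:
  assumes "x \<in> torus d n" "i \<le> k"
  shows "expec (Z x i) = 1"
  using assms(2)
proof (induction i)
  case 0
  have "Z x 0 = (\<lambda>_. 1)" by (simp add: Z_def fun_eq_iff)
  then show ?case by simp
next
  case (Suc i)
  have "expec (Z x (Suc i)) \<le> expec (Z x i)"
    by (rule expec_step[OF adapted_Z adapted_Z]) (use Suc assms in \<open>auto simp: Z_step Z_covered\<close>)
  \<comment> \<open>The converse inequality is the step inequality for - Z.\<close>
  moreover have "expec (\<lambda>y. - 1 * Z x (Suc i) y) \<le> expec (\<lambda>y. - 1 * Z x i y)"
    by (rule expec_step[OF adapted_comp[OF adapted_Z] adapted_comp[OF adapted_Z]])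
      (use Suc assms in \<open>auto simp: Z_step Z_covered sum_negf\<close>)
  ultimately show ?case using Suc unfolding expec_scale by simp
qed

lemma adapted_ZZ: "adapted i (\<lambda>y. Z x i y * Z x' i y)"
  by (rule adapted_comp2[OF adapted_Z adapted_Z])

lemma expec_Z_far:
  assumes "x \<in> torus d n" "x' \<in> torus d n" "torus_dist d n x x' > 2 * k" "i \<le> k"
  shows "expec (\<lambda>y. Z x i y * Z x' i y) \<le> 1"
  using assms(4)
proof (induction i)
  case 0
  have "(\<lambda>y. Z x 0 y * Z x' 0 y) = (\<lambda>_. 1)" by (simp add: Z_def fun_eq_iff)
  then show ?case by simp
next
  case (Suc i)
  have "expec (\<lambda>y. Z x (Suc i) y * Z x' (Suc i) y) \<le> expec (\<lambda>y. Z x i y * Z x' i y)"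
    by (rule expec_step[OF adapted_ZZ adapted_ZZ]) (use Suc assms in \<open>auto simp: Z_step2 Z_covered\<close>)
  then show ?case using Suc by simp
qed

lemma expec_Z_near:
  assumes "x \<in> torus d n" 
  shows "expec (\<lambda>y. Z x k y * Z x' k y) \<le> exp (2 * real k * real (ball_size n d k) / L)"
proof -
  let ?C = "exp (2 * real k * real (ball_size n d k) / L)"
  have "expec (\<lambda>y. Z x k y * Z x' k y) \<le> expec (\<lambda>y. ?C * Z x k y)"
  proof (rule expec_mono[OF adapted_ZZ adapted_comp[OF adapted_Z]])
    fix y show "Z x k y * Z x' k y \<le> ?C * Z x k y"
      using mult_left_mono[OF Z_le[of x' y] Z_nonneg[of x k y]] by (simp add: mult.commute)
  qed
  also have "\<dots> = ?C" using expec_Z[OF assms] by (simp add: expec_scale)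
  finally show ?thesis .
qed

lemma adapted_S: "adapted k S"
  unfolding S_def by (rule adapted_sum[OF adapted_Z])

lemma expec_S: "expec S = real n ^ d"
proof -
  have "expec S = (\<Sum>x\<in>torus d n. expec (Z x k))"
    unfolding S_def[abs_def] by (rule expec_sum[OF finite_torus]) (rule adapted_Z)
  also have "\<dots> = real n ^ d" by (simp add: expec_Z card_torus)
  finally show ?thesis .
qed

lemma expec_S_square:
  "expec (\<lambda>y. (S y)\<^sup>2) \<le> (real n ^ d)\<^sup>2 +
     real n ^ d * (real (ball_size n d (2 * k)) * exp (2 * real k * real (ball_size n d k) / L))"
proof -
  let ?C = "exp (2 * real k * real (ball_size n d k) / L)"
  have S2: "(S y)\<^sup>2 = (\<Sum>x\<in>torus d n. \<Sum>x'\<in>torus d n. Z x k y * Z x' k y)" for y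
    by (simp add: S_def power2_eq_square sum_product)
  have "expec (\<lambda>y. (S y)\<^sup>2) = (\<Sum>x\<in>torus d n. expec (\<lambda>y. \<Sum>x'\<in>torus d n. Z x k y * Z x' k y))"
    unfolding S2
    by (rule expec_sum[OF finite_torus]) (rule adapted_sum[OF adapted_ZZ])
  also have "\<dots> = (\<Sum>x\<in>torus d n. \<Sum>x'\<in>torus d n. expec (\<lambda>y. Z x k y * Z x' k y))"
    by (intro sum.cong refl expec_sum[OF finite_torus]) (rule adapted_ZZ)
  also have "\<dots> \<le> (\<Sum>x\<in>torus d n. real n ^ d + real (ball_size n d (2 * k)) * ?C)"
  proof (rule sum_mono)
    fix x assume x: "x \<in> torus d n"
    let ?B = "torus_cball d n x (2 * k)"
    have "(\<Sum>x'\<in>torus d n. expec (\<lambda>y. Z x k y * Z x' k y)) \<le>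
      (\<Sum>x'\<in>torus d n. 1 + (if x' \<in> ?B then ?C else 0))"
    proof (rule sum_mono)
      fix x' assume x': "x' \<in> torus d n"
      show "expec (\<lambda>y. Z x k y * Z x' k y) \<le> 1 + (if x' \<in> ?B then ?C else 0)"
        using expec_Z_near[OF x, of x'] expec_Z_far[OF x x' _ order_refl] x'
        by (cases "x' \<in> ?B") (auto simp: torus_cball_def)
    qed
    also have "\<dots> = real n ^ d + (\<Sum>x'\<in>torus d n \<inter> ?B. ?C)"
      by (simp only: sum.distrib sum.inter_restrict[OF finite_torus, symmetric]) (simp add: card_torus)
    also have "torus d n \<inter> ?B = ?B" using torus_cball_subset by blast
    finally show "(\<Sum>x'\<in>torus d n. expec (\<lambda>y. Z x k y * Z x' k y)) \<le>
      real n ^ d + real (ball_size n d (2 * k)) * ?C" by (simp add: card_torus_cball[OF x])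
  qed
  finally show ?thesis by (simp add: card_torus algebra_simps power2_eq_square)
qed

text \<open>Chebyshev's inequality. Only the pairs of vertices at distance at most \<open>2k\<close> contribute to the variance.\<close>

lemma S_concentrated:
  assumes "\<epsilon> > 0"
  shows "prob {\<omega>\<in>space M. \<bar>S (path \<omega>) - real n ^ d\<bar> > \<epsilon> * real n ^ d} \<le>
    real (ball_size n d (2 * k)) * exp (2 * real k * real (ball_size n d k) / L) / (\<epsilon>\<^sup>2 * real n ^ d)"
proof -
  let ?V = "real n ^ d"
  let ?K = "real (ball_size n d (2 * k)) * exp (2 * real k * real (ball_size n d k) / L)"
  have V: "?V > 0" using n_pos by simp
  have "prob {\<omega>\<in>space M. \<bar>S (path \<omega>) - ?V\<bar> > \<epsilon> * ?V} \<le> expec (\<lambda>y. (S y - ?V)\<^sup>2) / (\<epsilon> * ?V)\<^sup>2"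
  proof (rule prob_le_expec[where P = "\<lambda>y. \<bar>S y - ?V\<bar> > \<epsilon> * ?V"])
    show "adapted k (\<lambda>y. \<epsilon> * ?V < \<bar>S y - ?V\<bar>)" "adapted k (\<lambda>y. (S y - ?V)\<^sup>2)"
      by (rule adapted_comp[OF adapted_S])+
    fix y assume "\<epsilon> * ?V < \<bar>S y - ?V\<bar>"
    then have "(\<epsilon> * ?V)\<^sup>2 \<le> \<bar>S y - ?V\<bar>\<^sup>2" using assms V by (intro power_mono) auto
    then show "(\<epsilon> * ?V)\<^sup>2 \<le> (S y - ?V)\<^sup>2" by simp
  qed (use assms V in auto)
  also have "expec (\<lambda>y. (S y - ?V)\<^sup>2) = expec (\<lambda>y. (S y)\<^sup>2 + ((- 2 * ?V) * S y + ?V\<^sup>2))"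
    by (simp add: power2_diff algebra_simps)
  also have "\<dots> = expec (\<lambda>y. (S y)\<^sup>2) + expec (\<lambda>y. (- 2 * ?V) * S y + ?V\<^sup>2)"
    by (rule expec_add; rule adapted_comp[OF adapted_S])
  also have "expec (\<lambda>y. (- 2 * ?V) * S y + ?V\<^sup>2) = expec (\<lambda>y. (- 2 * ?V) * S y) + ?V\<^sup>2"
    by (subst expec_add[where k = k]) (auto intro: adapted_comp[OF adapted_S] simp: adapted_def[of _ "\<lambda>_. _"])
  also have "\<dots> = - ?V\<^sup>2" by (simp only: expec_scale expec_S) (simp add: power2_eq_square)
  also have "expec (\<lambda>y. (S y)\<^sup>2) + - ?V\<^sup>2 \<le> ?V * ?K" using expec_S_square by simp
  finally have "prob {\<omega>\<in>space M. \<bar>S (path \<omega>) - ?V\<bar> > \<epsilon> * ?V} \<le> ?V * ?K / (\<epsilon> * ?V)\<^sup>2"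
    by (simp add: divide_right_mono)
  also have "\<dots> = ?K / (\<epsilon>\<^sup>2 * ?V)" by (rule variance_quotient[OF V assms])
  finally show ?thesis .
qed

lemma S_eq:
  assumes "s \<le> k" "\<forall>j<s. alive j y" "s = k \<or> \<not> alive s y"
  shows "S y * (\<Prod>j<s. 1 - hit j y) = card {x\<in>torus d n. avoids d n y k s x}"
proof -
  have pos: "(\<Prod>j<s. 1 - hit j y) > 0"
    using assms hit_bounds(3) by (intro prod_pos) fastforce
  have "S y = (\<Sum>x\<in>torus d n. if avoids d n y k s x then 1 / (\<Prod>j<s. 1 - hit j y) else 0)"
    unfolding S_def using Z_stopped[OF assms(1,3)] Z_eq[OF assms(2)] by simp
  also have "\<dots> = (\<Sum>x\<in>{x\<in>torus d n. avoids d n y k s x}. 1 / (\<Prod>j<s. 1 - hit j y))"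
    by (rule sum.mono_neutral_cong_right) auto
  also have "\<dots> = card {x\<in>torus d n. avoids d n y k s x} / (\<Prod>j<s. 1 - hit j y)"
    by simp
  finally show ?thesis using pos by (metis less_irrefl nonzero_eq_divide_eq)
qed

text \<open>If \<open>alive\<close> fails for the first time at \<open>s < k\<close>, then the frozen martingale counts vertices that avoid all
  fires up to time \<open>s\<close> with the larger target time \<open>k\<close>. These are unburnt at time \<open>s\<close>, so that the lower
  bound still holds at the random time \<open>s\<close>; the upper bound below only holds when \<open>s = k\<close>.\<close>

lemma unburnt_lower:
  assumes "valid_upto d n s y" "\<bar>S y - real n ^ d\<bar> \<le> \<epsilon> * real n ^ d"
    "s \<le> k" "\<forall>j<s. alive j y" "s = k \<or> \<not> alive s y"
  shows "(1 - \<epsilon>) * real n ^ d * (\<Prod>j<s. 1 - hit j y) \<le> card (unburnt d n y s)"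
proof -
  have pos: "(\<Prod>j<s. 1 - hit j y) > 0"
    using assms hit_bounds(3) by (intro prod_pos) fastforce
  have "(1 - \<epsilon>) * real n ^ d * (\<Prod>j<s. 1 - hit j y) \<le> S y * (\<Prod>j<s. 1 - hit j y)"
    using assms(2) pos by (intro mult_right_mono) (auto simp: algebra_simps abs_le_iff)
  also have "\<dots> = card {x\<in>torus d n. avoids d n y k s x}" by (rule S_eq[OF assms(3-5)])
  also have "\<dots> \<le> card (unburnt d n y s)"
    using avoids_imp_unburnt[OF assms(1) _ assms(3)] by (intro of_nat_mono card_mono) auto
  finally show ?thesis .
qed

lemma unburnt_upper:
  assumes "valid_upto d n k y" "\<bar>S y - real n ^ d\<bar> \<le> \<epsilon> * real n ^ d" "\<forall>j<k. alive j y"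
  shows "card (unburnt d n y k) \<le> (1 + \<epsilon>) * real n ^ d * (\<Prod>j<k. 1 - hit j y)"
proof -
  have pos: "(\<Prod>j<k. 1 - hit j y) > 0"
    using assms hit_bounds(3) by (intro prod_pos) fastforce
  have "unburnt d n y k = {x\<in>torus d n. avoids d n y k k x}"
    using unburnt_iff_avoids[OF assms(1)] by blast
  then have "card (unburnt d n y k) = S y * (\<Prod>j<k. 1 - hit j y)"
    using S_eq[OF order_refl assms(3)] by simp
  also have "\<dots> \<le> (1 + \<epsilon>) * real n ^ d * (\<Prod>j<k. 1 - hit j y)"
    using assms(2) pos by (intro mult_right_mono) (auto simp: algebra_simps abs_le_iff)
  finally show ?thesis .
qed

end

section \<open>A Volterra equation: blow-up, uniqueness and extension\<close>

text \<open>The \<open>(d+1)\<close>-fold iterated integral of \<open>2^d w\<close> from \<open>0\<close>, written as a single integral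
  (see \<open>kern_eq_iter_primitive\<close>).\<close>

definition kern :: "nat \<Rightarrow> (real \<Rightarrow> real) \<Rightarrow> real \<Rightarrow> real" where
  "kern d w t = 2 ^ d / fact d * integral {0..t} (\<lambda>s. (t - s) ^ d * w s)"

text \<open>The integral form of the generalised Blasius equation for \<open>w = y^(d)\<close>, with a constant \<open>\<kappa>\<close>
  added to the logarithm; \<open>\<kappa> = 0\<close> corresponds to the initial value \<open>w(0) = 1\<close>.\<close>

definition volterra :: "nat \<Rightarrow> real \<Rightarrow> real \<Rightarrow> (real \<Rightarrow> real) \<Rightarrow> bool" where
  "volterra d \<kappa> b w \<longleftrightarrow> continuous_on {0..<b} w \<and> (\<forall>t\<in>{0..<b}. w t = exp (\<kappa> + kern d w t))"

lemma kern_integrable: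
  fixes w :: "real \<Rightarrow> real"
  assumes "continuous_on {a..b} w"
  shows "(\<lambda>s. (t - s) ^ d * w s) integrable_on {a..b}"
  by (intro integrable_continuous_real continuous_intros assms)

lemma integral_power_kernel:
  assumes "a \<le> (t::real)"
  shows "integral {a..t} (\<lambda>s. (t - s) ^ d) = (t - a) ^ (d + 1) / real (d + 1)"
proof -
  have "((\<lambda>s. (t - s) ^ d) has_integral - ((t - t) ^ (d + 1)) / real (d + 1) - - ((t - a) ^ (d + 1)) / real (d + 1)) {a..t}"
  proof (rule fundamental_theorem_of_calculus[OF assms])
    fix x assume "x \<in> {a..t}"
    have "((\<lambda>x. - ((t - x) ^ (d + 1)) / real (d + 1)) has_real_derivative (t - x) ^ d) (at x within {a..t})"
      by (rule derivative_eq_intros refl | simp del: power_Suc of_nat_Suc)+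
    then show "((\<lambda>x. - ((t - x) ^ (d + 1)) / real (d + 1)) has_vector_derivative (t - x) ^ d) (at x within {a..t})"
      by (simp only: has_real_derivative_iff_has_vector_derivative)
  qed
  then show ?thesis by (intro integral_unique) simp
qed

lemma kern_increment_lower:
  assumes "0 \<le> \<tau>" "\<tau> \<le> t" "continuous_on {0..t} w" "\<And>s. s \<in> {0..\<tau>} \<Longrightarrow> 0 \<le> w s"
    "\<And>s. s \<in> {\<tau>..t} \<Longrightarrow> A \<le> w s"
  shows "kern d w \<tau> + 2 ^ d / fact d * A * (t - \<tau>) ^ (d + 1) / real (d + 1) \<le> kern d w t"
proof -
  have c: "continuous_on {0..\<tau>} w" "continuous_on {\<tau>..t} w"
    by (rule continuous_on_subset[OF assms(3)]; use assms(1,2) in auto)+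
  have "integral {0..\<tau>} (\<lambda>s. (\<tau> - s) ^ d * w s) \<le> integral {0..\<tau>} (\<lambda>s. (t - s) ^ d * w s)"
    using assms c by (intro integral_le kern_integrable mult_right_mono power_mono) auto
  moreover have "integral {\<tau>..t} (\<lambda>s. (t - s) ^ d * A) \<le> integral {\<tau>..t} (\<lambda>s. (t - s) ^ d * w s)"
    using assms c by (intro integral_le kern_integrable mult_left_mono) auto
  moreover have "integral {\<tau>..t} (\<lambda>s. (t - s) ^ d * A) = A * (t - \<tau>) ^ (d + 1) / real (d + 1)"
    using integral_power_kernel[OF assms(2), of d] by simp
  moreover have "integral {0..\<tau>} (\<lambda>s. (t - s) ^ d * w s) + integral {\<tau>..t} (\<lambda>s. (t - s) ^ d * w s) =
    integral {0..t} (\<lambda>s. (t - s) ^ d * w s)"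
    using assms by (intro Henstock_Kurzweil_Integration.integral_combine kern_integrable) auto
  ultimately have "integral {0..\<tau>} (\<lambda>s. (\<tau> - s) ^ d * w s) + A * (t - \<tau>) ^ (d + 1) / real (d + 1)
    \<le> integral {0..t} (\<lambda>s. (t - s) ^ d * w s)" by linarith
  then have "2 ^ d / fact d * (integral {0..\<tau>} (\<lambda>s. (\<tau> - s) ^ d * w s) + A * (t - \<tau>) ^ (d + 1) / real (d + 1))
    \<le> 2 ^ d / fact d * integral {0..t} (\<lambda>s. (t - s) ^ d * w s)" by (intro mult_left_mono) auto
  then show ?thesis by (simp only: kern_def distrib_left mult.assoc times_divide_eq_right)
qed

lemma kern_mono_time:
  assumes "0 \<le> \<tau>" "\<tau> \<le> t" "continuous_on {0..t} w" "\<And>s. s \<in> {0..t} \<Longrightarrow> 0 \<le> w s"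
  shows "kern d w \<tau> \<le> kern d w t"
  using kern_increment_lower[of \<tau> t w 0 d] assms by simp

lemma kern_mono:
  assumes "continuous_on {0..t} v" "continuous_on {0..t} w" "\<And>s. s \<in> {0..t} \<Longrightarrow> v s \<le> w s"
  shows "kern d v t \<le> kern d w t"
  unfolding kern_def using assms
  by (intro mult_left_mono integral_le kern_integrable) (auto intro!: mult_left_mono)

lemma kern_diff:
  assumes "continuous_on {0..t} v" "continuous_on {0..t} w"
  shows "kern d (\<lambda>s. v s - w s) t = kern d v t - kern d w t"
proof -
  have "integral {0..t} (\<lambda>s. (t - s) ^ d * (v s - w s)) =
     integral {0..t} (\<lambda>s. (t - s) ^ d * v s - (t - s) ^ d * w s)"
    by (simp add: algebra_simps)
  also have "\<dots> = integral {0..t} (\<lambda>s. (t - s) ^ d * v s) - integral {0..t} (\<lambda>s. (t - s) ^ d * w s)"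
    by (intro Henstock_Kurzweil_Integration.integral_diff kern_integrable assms)
  finally show ?thesis by (simp add: kern_def right_diff_distrib)
qed

lemma kern_const:
  assumes "0 \<le> t"
  shows "kern d (\<lambda>_. B) t = 2 ^ d / fact d * B * t ^ (d + 1) / real (d + 1)"
  using integral_power_kernel[OF assms, of d] by (simp add: kern_def)

lemma kern_nonneg:
  assumes "continuous_on {0..t} w" "\<And>s. s \<in> {0..t} \<Longrightarrow> 0 \<le> w s"
  shows "0 \<le> kern d w t"
  unfolding kern_def using assms 
  by (intro mult_nonneg_nonneg Henstock_Kurzweil_Integration.integral_nonneg kern_integrable) auto

lemma kern_increment_upper:
  assumes "0 \<le> \<tau>" "\<tau> \<le> t" "continuous_on {0..t} w" "\<And>s. s \<in> {0..t} \<Longrightarrow> w s \<le> B"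
  shows "kern d w t - kern d w \<tau> \<le> 2 ^ d / fact d * B * (t ^ (d + 1) - \<tau> ^ (d + 1)) / real (d + 1)"
proof -
  have c: "continuous_on {0..\<tau>} w" by (rule continuous_on_subset[OF assms(3)]) (use assms(2) in auto)
  have "kern d (\<lambda>s. B - w s) \<tau> \<le> kern d (\<lambda>s. B - w s) t"
    using assms by (intro kern_mono_time continuous_intros) auto
  then have "kern d (\<lambda>_. B) \<tau> - kern d w \<tau> \<le> kern d (\<lambda>_. B) t - kern d w t"
    using assms c by (subst (asm) (1 2) kern_diff) auto
  then show ?thesis using assms by (simp add: kern_const right_diff_distrib diff_divide_distrib)
qed

lemma continuous_on_dominated:
  fixes f :: "'a::metric_space \<Rightarrow> real" and g :: "'a \<Rightarrow> real"
  assumes "continuous_on S g" "\<And>x y. x \<in> S \<Longrightarrow> y \<in> S \<Longrightarrow> dist (f x) (f y) \<le> dist (g x) (g y)"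
  shows "continuous_on S f"
  using assms unfolding continuous_on_iff by (meson le_less_trans)

text \<open>A modulus of continuity of \<open>kern d w\<close> that depends on \<open>w\<close> only through an upper bound. It passes to
  pointwise limits.\<close>

lemma kern_dist:
  assumes "\<tau> \<in> {0..b}" "t \<in> {0..b}" "continuous_on {0..b} w" "\<And>s. s \<in> {0..b} \<Longrightarrow> 0 \<le> w s \<and> w s \<le> B"
  shows "dist (kern d w t) (kern d w \<tau>) \<le>
    dist (2 ^ d / fact d * B * t ^ (d + 1) / real (d + 1)) (2 ^ d / fact d * B * \<tau> ^ (d + 1) / real (d + 1))"
proof -
  have *: "dist (kern d w t) (kern d w \<tau>) \<le>
    dist (2 ^ d / fact d * B * t ^ (d + 1) / real (d + 1)) (2 ^ d / fact d * B * \<tau> ^ (d + 1) / real (d + 1))"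
    if "\<tau> \<in> {0..b}" "t \<in> {0..b}" "\<tau> \<le> t" for \<tau> t
  proof -
    have c: "continuous_on {0..t} w"
      by (rule continuous_on_subset[OF assms(3)]) (use that in auto)
    have "kern d w \<tau> \<le> kern d w t" using that assms c by (intro kern_mono_time) auto
    moreover have "kern d w t - kern d w \<tau> \<le> 2 ^ d / fact d * B * (t ^ (d + 1) - \<tau> ^ (d + 1)) / real (d + 1)"
      using that assms c by (intro kern_increment_upper) auto
    moreover have "2 ^ d / fact d * B * (t ^ (d + 1) - \<tau> ^ (d + 1)) / real (d + 1) =
      2 ^ d / fact d * B * t ^ (d + 1) / real (d + 1) - 2 ^ d / fact d * B * \<tau> ^ (d + 1) / real (d + 1)"
      by (simp only: right_diff_distrib diff_divide_distrib)
    ultimately show ?thesis unfolding dist_real_def by linarith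
  qed
  show ?thesis
  proof (cases "\<tau> \<le> t")
    case True
    then show ?thesis by (intro * assms)
  next
    case False
    then have "t \<le> \<tau>" by simp
    from *[OF assms(2,1) this] show ?thesis by (simp only: dist_commute)
  qed
qed

lemma continuous_on_kern:
  assumes "continuous_on {0..b} w" "\<And>s. s \<in> {0..b} \<Longrightarrow> 0 \<le> w s \<and> w s \<le> B"
  shows "continuous_on {0..b} (kern d w)"
proof (rule continuous_on_dominated)
  show "continuous_on {0..b} (\<lambda>t. 2 ^ d / fact d * B * t ^ (d + 1) / real (d + 1))"
    by (intro continuous_intros) simp
qed (rule kern_dist[OF _ _ assms])

lemma volterra_cont: "volterra d \<kappa> b w \<Longrightarrow> t < b \<Longrightarrow> continuous_on {0..t} w"
  unfolding volterra_def by (auto elim: continuous_on_subset)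

lemma volterra_eq: "volterra d \<kappa> b w \<Longrightarrow> 0 \<le> t \<Longrightarrow> t < b \<Longrightarrow> w t = exp (\<kappa> + kern d w t)"
  unfolding volterra_def by auto

lemma volterra_pos: "volterra d \<kappa> b w \<Longrightarrow> 0 \<le> t \<Longrightarrow> t < b \<Longrightarrow> 0 < w t"
  by (simp add: volterra_eq)

lemma volterra_mono:
  assumes "volterra d \<kappa> b w" "0 \<le> s" "s \<le> t" "t < b"
  shows "w s \<le> w t"
proof -
  have "kern d w s \<le> kern d w t"
    using assms volterra_cont[OF assms(1,4)] volterra_pos[OF assms(1)]
    by (intro kern_mono_time) (auto intro: less_imp_le)
  then show ?thesis using assms by (simp add: volterra_eq)
qed

lemma volterra_ge_1:
  assumes "volterra d \<kappa> b w" "0 \<le> \<kappa>" "0 \<le> t" "t < b"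
  shows "1 \<le> w t"
proof -
  have "0 \<le> kern d w t" 
    using volterra_cont[OF assms(1,4)] volterra_pos[OF assms(1)] assms
    by (intro kern_nonneg) (auto intro: less_imp_le)
  then show ?thesis using assms by (simp add: volterra_eq)
qed

text \<open>A uniform bound on the life time. With \<open>\<beta> = 2^(d+1)\<close>, the solution is at least \<open>\<beta>^(2j)\<close>
  after time \<open>h (1 + 1/2 + \<dots> + 1/2^(j-1))\<close>, for every \<open>j\<close>.\<close>

lemma volterra_blowup: "\<exists>H>0. \<forall>b w. volterra d 0 b w \<longrightarrow> b \<le> H"
proof -
  define \<beta> :: real where "\<beta> = 2 ^ (d + 1)"
  define c :: real where "c = 2 ^ d / fact d / real (d + 1)"
  \<comment> \<open>Any h with c * h^(d+1) \<ge> 2 ln \<beta> works; h \<ge> 1 makes this a linear condition.\<close>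
  define h :: real where "h = 1 + 2 * ln \<beta> / c"
  have \<beta>: "\<beta> > 1" by (simp add: \<beta>_def one_less_power del: power_Suc)
  have c: "c > 0" by (simp add: c_def)
  have h: "h \<ge> 1" using c \<beta> by (simp add: h_def)
  have "2 * ln \<beta> \<le> c * h" using c by (simp add: h_def field_simps)
  also have "c * h \<le> c * h ^ (d + 1)"
    using h c self_le_power[of h "d + 1"] by (intro mult_left_mono) auto
  finally have ch: "2 * ln \<beta> \<le> c * h ^ (d + 1)" .
  have "b \<le> 2 * h" if v: "volterra d 0 b w" for b w
  proof (rule ccontr)
    assume "\<not> b \<le> 2 * h"
    then have b: "2 * h < b" by simp
    define \<tau> where "\<tau> j = h * (2 - 2 / 2 ^ j)" for j :: nat
    have \<tau>: "0 \<le> \<tau> j" "\<tau> j \<le> 2 * h" "\<tau> (Suc j) = \<tau> j + h / 2 ^ j" for j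
    proof -
      have "(2::real) / 2 ^ j \<le> 2" by (simp add: field_simps)
      then show "0 \<le> \<tau> j" using h by (simp add: \<tau>_def)
      show "\<tau> j \<le> 2 * h" using h by (simp add: \<tau>_def algebra_simps)
      show "\<tau> (Suc j) = \<tau> j + h / 2 ^ j" by (simp add: \<tau>_def field_simps)
    qed
    have grow: "\<beta> ^ (2 * j) \<le> w t" if "\<tau> j \<le> t" "t \<le> 2 * h" for j t
      using that
    proof (induction j arbitrary: t)
      case 0
      then show ?case using volterra_ge_1[OF v, of t] b by (simp add: \<tau>_def)
    next
      case (Suc j)
      have "0 \<le> h / 2 ^ j" using h by simp
      then have t: "\<tau> j + h / 2 ^ j \<le> t" "0 \<le> t" "\<tau> j \<le> t" using Suc.prems \<tau>[of j] by linarith+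
      have "kern d w (\<tau> j) + 2 ^ d / fact d * \<beta> ^ (2 * j) * (t - \<tau> j) ^ (d + 1) / real (d + 1) \<le> kern d w t"
      proof (rule kern_increment_lower)
        show "continuous_on {0..t} w" by (rule volterra_cont[OF v]) (use Suc.prems b in simp)
        show "0 \<le> w s" if "s \<in> {0..\<tau> j}" for s
          using volterra_pos[OF v, of s] that b \<tau>[of j] by auto
        show "\<beta> ^ (2 * j) \<le> w s" if "s \<in> {\<tau> j..t}" for s
          using Suc.IH[of s] that Suc.prems by auto
      qed (use t \<tau> in auto)
      moreover have "2 * ln \<beta> \<le> 2 ^ d / fact d * \<beta> ^ (2 * j) * (t - \<tau> j) ^ (d + 1) / real (d + 1)"
      proof -
        have "(h / 2 ^ j) ^ (d + 1) \<le> (t - \<tau> j) ^ (d + 1)"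
          using t h by (intro power_mono) auto
        moreover have "(h / 2 ^ j) ^ (d + 1) = h ^ (d + 1) / \<beta> ^ j"
          by (simp only: power_divide \<beta>_def power_mult[symmetric] mult.commute)
        ultimately have "h ^ (d + 1) / \<beta> ^ j \<le> (t - \<tau> j) ^ (d + 1)" by simp
        then have "c * \<beta> ^ (2 * j) * (h ^ (d + 1) / \<beta> ^ j) \<le> c * \<beta> ^ (2 * j) * (t - \<tau> j) ^ (d + 1)"
          using c \<beta> by (intro mult_left_mono) auto
        moreover have "c * \<beta> ^ (2 * j) * (h ^ (d + 1) / \<beta> ^ j) = \<beta> ^ j * (c * h ^ (d + 1))"
        proof -
          have "\<beta> ^ (2 * j) = \<beta> ^ j * \<beta> ^ j" by (simp only: mult_2 power_add)
          moreover have "\<beta> ^ j > 0" using \<beta> by simp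
          ultimately show ?thesis by simp
        qed
        moreover have "1 * (c * h ^ (d + 1)) \<le> \<beta> ^ j * (c * h ^ (d + 1))"
          using \<beta> c h by (intro mult_right_mono one_le_power) auto
        ultimately have "2 * ln \<beta> \<le> c * \<beta> ^ (2 * j) * (t - \<tau> j) ^ (d + 1)" using ch by linarith
        then show ?thesis by (simp only: c_def times_divide_eq_left times_divide_eq_right)
      qed
      ultimately have "kern d w (\<tau> j) + 2 * ln \<beta> \<le> kern d w t" by linarith
      then have "w (\<tau> j) * \<beta> ^ 2 \<le> w t"
      proof -
        have "\<beta> ^ 2 = exp (2 * ln \<beta>)" using exp_of_nat_mult[of 2 "ln \<beta>"] \<beta> by simp
        moreover have "w (\<tau> j) = exp (kern d w (\<tau> j))" "w t = exp (kern d w t)"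
          using volterra_eq[OF v, of t] volterra_eq[OF v, of "\<tau> j"] \<tau>[of j] t Suc.prems b by auto
        ultimately show ?thesis using \<open>kern d w (\<tau> j) + 2 * ln \<beta> \<le> kern d w t\<close>
          by (simp add: exp_add[symmetric])
      qed
      moreover have "\<beta> ^ (2 * j) * \<beta> ^ 2 \<le> w (\<tau> j) * \<beta> ^ 2"
        using Suc.IH[of "\<tau> j"] \<tau>[of j] by (intro mult_right_mono) auto
      ultimately show ?case by (simp add: power2_eq_square mult_ac)
    qed
    obtain j where "w (2 * h) < \<beta> ^ j" using real_arch_pow[OF \<beta>] by blast
    also have "\<beta> ^ j \<le> \<beta> ^ (2 * j)" using \<beta> by (intro power_increasing) auto
    also have "\<dots> \<le> w (2 * h)" by (rule grow) (use \<tau> in auto)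
    finally show False by simp
  qed
  then show ?thesis using h by (intro exI[of _ "2 * h"]) auto
qed

lemma exp_diff_le: "exp a - exp b \<le> exp a * (a - b)" for a b :: real
proof -
  have "1 + (b - a) \<le> exp (b - a)" by (rule exp_ge_add_one_self)
  then have "exp a * (1 + (b - a)) \<le> exp a * exp (b - a)" by (intro mult_left_mono) auto
  also have "exp a * exp (b - a) = exp b" by (simp add: exp_add[symmetric])
  finally show ?thesis by (simp add: algebra_simps)
qed

text \<open>Gronwall's lemma in the form needed for uniqueness, by iterating the integral inequality.\<close>

lemma gronwall_zero:
  fixes D :: "real \<Rightarrow> real"
  assumes cont: "continuous_on {0..b} D" and bd: "\<And>t. t \<in> {0..b} \<Longrightarrow> D t \<le> K"
    and C: "0 \<le> C" and step: "\<And>t. t \<in> {0..b} \<Longrightarrow> D t \<le> C * integral {0..t} D"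
    and t: "t \<in> {0..b}"
  shows "D t \<le> 0"
proof -
  have bound: "D t \<le> K * (C * t) ^ m / fact m" if "t \<in> {0..b}" for m t
    using that
  proof (induction m arbitrary: t)
    case (Suc m)
    have c: "continuous_on {0..t} D" using Suc.prems by (intro continuous_on_subset[OF cont]) auto
    have int: "((\<lambda>s. K * (C * s) ^ m / fact m) has_integral
      K * C ^ m * t ^ Suc m / fact (Suc m) - K * C ^ m * 0 ^ Suc m / fact (Suc m)) {0..t}"
    proof (rule fundamental_theorem_of_calculus)
      fix x assume "x \<in> {0..t}"
      have "((\<lambda>x. K * C ^ m * x ^ Suc m / fact (Suc m)) has_real_derivative
        K * C ^ m * (real (Suc m) * x ^ m) / fact (Suc m)) (at x within {0..t})"
        by (rule derivative_eq_intros refl | simp del: power_Suc of_nat_Suc fact_Suc)+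
      moreover have "K * C ^ m * (real (Suc m) * x ^ m) / fact (Suc m) = K * (C * x) ^ m / fact m"
        by (simp add: power_mult_distrib field_simps del: of_nat_Suc)
      ultimately show "((\<lambda>x. K * C ^ m * x ^ Suc m / fact (Suc m)) has_vector_derivative
        K * (C * x) ^ m / fact m) (at x within {0..t})"
        by (simp only: has_real_derivative_iff_has_vector_derivative)
    qed (use Suc.prems in auto)
    have "D t \<le> C * integral {0..t} D" using step Suc.prems by blast
    also have "\<dots> \<le> C * integral {0..t} (\<lambda>s. K * (C * s) ^ m / fact m)"
    proof (intro mult_left_mono integral_le C)
      show "D integrable_on {0..t}" by (rule integrable_continuous_real[OF c])
      show "(\<lambda>s. K * (C * s) ^ m / fact m) integrable_on {0..t}" using int by blast
    qed (use Suc in auto)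
    also have "integral {0..t} (\<lambda>s. K * (C * s) ^ m / fact m) = K * C ^ m * t ^ Suc m / fact (Suc m)"
      using integral_unique[OF int] by simp
    also have "C * \<dots> = K * (C * t) ^ Suc m / fact (Suc m)"
      by (simp add: power_mult_distrib del: fact_Suc)
    finally show ?case .
  qed (use bd in auto)
  have "(\<lambda>m. (C * t) ^ m / fact m) \<longlonglongrightarrow> 0"
    using summable_LIMSEQ_zero[OF summable_exp[of "C * t"]] by (simp add: field_simps)
  then have "(\<lambda>m. K * ((C * t) ^ m / fact m)) \<longlonglongrightarrow> K * 0" by (intro tendsto_intros)
  then have "(\<lambda>m. K * (C * t) ^ m / fact m) \<longlonglongrightarrow> 0" by simp
  then show ?thesis using bound[OF t] by (intro LIMSEQ_le_const[of _ 0 "D t"]) auto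
qed

text \<open>Uniqueness for comparable solutions suffices here, as Picard iteration yields the minimal solution.\<close>

lemma volterra_unique_le:
  assumes v: "volterra d \<kappa> b v" and w: "volterra d \<kappa> b w"
    and le: "\<And>t. 0 \<le> t \<Longrightarrow> t < b \<Longrightarrow> v t \<le> w t" and t: "0 \<le> t" "t < b"
  shows "v t = w t"
proof -
  define D where "D s = w s - v s" for s
  have cv: "continuous_on {0..t} v" and cw: "continuous_on {0..t} w"
    using volterra_cont v w t by blast+
  have cD: "continuous_on {0..t} D" unfolding D_def by (intro continuous_intros cv cw)
  have D0: "0 \<le> D s" if "s \<in> {0..t}" for s using le that t by (simp add: D_def)
  define K where "K = w t"
  define C where "C = K * (2 ^ d / fact d * t ^ d)"
  have K: "0 \<le> K" using volterra_pos[OF w t] by (simp add: K_def)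
  have wK: "w s \<le> K" if "s \<in> {0..t}" for s
    using volterra_mono[OF w] that t by (simp add: K_def)
  have "D t \<le> 0"
  proof (rule gronwall_zero[OF cD, where K = K and C = C])
    show "D s \<le> K" if "s \<in> {0..t}" for s
      using wK[OF that] volterra_pos[OF v, of s] that t by (simp add: D_def)
    show "0 \<le> C" using K t by (simp add: C_def)
    show "D s \<le> C * integral {0..s} D" if s: "s \<in> {0..t}" for s
    proof -
      have cs: "continuous_on {0..s} v" "continuous_on {0..s} w" "continuous_on {0..s} D"
        using continuous_on_subset[OF cv] continuous_on_subset[OF cw] continuous_on_subset[OF cD] s by auto
      have "D s = exp (\<kappa> + kern d w s) - exp (\<kappa> + kern d v s)"
        unfolding D_def using volterra_eq[OF v, of s] volterra_eq[OF w, of s] s t by auto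
      also have "\<dots> \<le> exp (\<kappa> + kern d w s) * ((\<kappa> + kern d w s) - (\<kappa> + kern d v s))"
        by (rule exp_diff_le)
      also have "\<dots> = w s * kern d D s"
        using volterra_eq[OF w, of s] s t kern_diff[OF cs(2,1)] by (simp add: D_def[abs_def])
      also have "\<dots> \<le> K * kern d D s"
        using D0 s cs by (intro mult_right_mono wK kern_nonneg) auto
      also have "\<dots> \<le> K * (2 ^ d / fact d * (t ^ d * integral {0..s} D))"
        unfolding kern_def
      proof (intro mult_left_mono K)
        have "integral {0..s} (\<lambda>r. (s - r) ^ d * D r) \<le> integral {0..s} (\<lambda>r. t ^ d * D r)"
          using cs D0 s by (intro integral_le kern_integrable mult_right_mono power_mono
            integrable_continuous_real continuous_intros) auto
        then show "integral {0..s} (\<lambda>r. (s - r) ^ d * D r) \<le> t ^ d * integral {0..s} D" by simp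
      qed auto
      finally show ?thesis by (simp add: C_def)
    qed
  qed (use t in auto)
  then show ?thesis using le[OF t] by (simp add: D_def)
qed

text \<open>Picard iteration for \<open>\<kappa> = 0\<close>, started at \<open>0\<close>. It is increasing, so it converges wherever it is bounded.\<close>

primrec picard :: "nat \<Rightarrow> nat \<Rightarrow> real \<Rightarrow> real" where
  "picard d 0 = (\<lambda>_. 0)"
| "picard d (Suc m) = (\<lambda>t. exp (kern d (picard d m) t))"

lemma picard_nonneg: "0 \<le> picard d m t"
  by (cases m) auto

lemma picard_continuous: "continuous_on {0..b} (picard d m)"
proof (induction m)
  case (Suc m)
  have "bounded (picard d m ` {0..b})"
    by (intro compact_imp_bounded compact_continuous_image Suc) simp
  then obtain B where "\<forall>t\<in>{0..b}. \<bar>picard d m t\<bar> \<le> B" by (auto simp: bounded_iff)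
  then have "continuous_on {0..b} (kern d (picard d m))"
    by (intro continuous_on_kern[where B = B] Suc) (auto simp: picard_nonneg abs_le_iff)
  then show ?case by (auto intro: continuous_intros)
qed simp

lemma picard_mono: "0 \<le> t \<Longrightarrow> picard d m t \<le> picard d (Suc m) t"
proof (induction m arbitrary: t)
  case (Suc m)
  have "kern d (picard d m) t \<le> kern d (picard d (Suc m)) t"
    using Suc by (intro kern_mono picard_continuous) auto
  then show ?case by simp
qed simp

lemma picard_bounded_solution:
  assumes bd: "\<And>m t. t \<in> {0..b} \<Longrightarrow> picard d m t \<le> B"
  shows "\<exists>v. volterra d 0 b v \<and> (\<forall>t\<in>{0..b}. (\<lambda>m. picard d m t) \<longlonglongrightarrow> v t)"
proof -
  define v where "v t = lim (\<lambda>m. picard d m t)" for t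
  have lim: "(\<lambda>m. picard d m t) \<longlonglongrightarrow> v t" if t: "t \<in> {0..b}" for t
  proof -
    have "incseq (\<lambda>m. picard d m t)" using picard_mono t by (intro incseq_SucI) auto
    then obtain l where "(\<lambda>m. picard d m t) \<longlonglongrightarrow> l" using incseq_convergent[of _ B] bd[OF t] by blast
    then show ?thesis unfolding v_def using limI by blast
  qed
  have limk: "(\<lambda>m. kern d (picard d m) t) \<longlonglongrightarrow> kern d v t" if t: "t \<in> {0..b}" for t
  proof -
    have "(\<lambda>m. integral {0..t} (\<lambda>s. (t - s) ^ d * picard d m s)) \<longlonglongrightarrow>
      integral {0..t} (\<lambda>s. (t - s) ^ d * v s)"
    proof (rule dominated_convergence(2)[where h = "\<lambda>s. (t - s) ^ d * B"])
      show "(\<lambda>s. (t - s) ^ d * picard d m s) integrable_on {0..t}" for m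
        by (rule kern_integrable[OF picard_continuous])
      show "(\<lambda>s. (t - s) ^ d * B) integrable_on {0..t}"
        by (rule kern_integrable) simp
      show "norm ((t - s) ^ d * picard d m s) \<le> (t - s) ^ d * B" if "s \<in> {0..t}" for m s
        using bd[of s m] that t picard_nonneg[of d m s] by (auto simp: abs_mult intro!: mult_left_mono)
      show "(\<lambda>m. (t - s) ^ d * picard d m s) \<longlonglongrightarrow> (t - s) ^ d * v s" if "s \<in> {0..t}" for s
        using that t by (intro tendsto_intros lim) auto
    qed
    then show ?thesis unfolding kern_def by (intro tendsto_intros)
  qed
  have v_eq: "v t = exp (kern d v t)" if t: "t \<in> {0..b}" for t
  proof -
    have "(\<lambda>m. picard d (Suc m) t) \<longlonglongrightarrow> exp (kern d v t)"
      using limk[OF t] by (auto intro: tendsto_intros)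
    then show ?thesis using lim[OF t] LIMSEQ_Suc LIMSEQ_unique by blast
  qed
  have "continuous_on {0..b} (kern d v)"
  proof (rule continuous_on_dominated)
    show "continuous_on {0..b} (\<lambda>t. 2 ^ d / fact d * B * t ^ (d + 1) / real (d + 1))"
      by (intro continuous_intros) simp
    fix t \<tau> assume t: "t \<in> {0..b}" "\<tau> \<in> {0..b}"
    have "(\<lambda>m. dist (kern d (picard d m) t) (kern d (picard d m) \<tau>)) \<longlonglongrightarrow> dist (kern d v t) (kern d v \<tau>)"
      using t by (intro tendsto_intros limk)
    moreover have "dist (kern d (picard d m) t) (kern d (picard d m) \<tau>) \<le>
      dist (2 ^ d / fact d * B * t ^ (d + 1) / real (d + 1)) (2 ^ d / fact d * B * \<tau> ^ (d + 1) / real (d + 1))" for m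
      by (rule kern_dist[OF t(2,1) picard_continuous]) (use bd picard_nonneg in auto)
    ultimately show "dist (kern d v t) (kern d v \<tau>) \<le>
      dist (2 ^ d / fact d * B * t ^ (d + 1) / real (d + 1)) (2 ^ d / fact d * B * \<tau> ^ (d + 1) / real (d + 1))"
      by (intro LIMSEQ_le_const2[of _ "dist (kern d v t) (kern d v \<tau>)"]) auto
  qed
  then have "continuous_on {0..b} (\<lambda>t. exp (kern d v t))" by (intro continuous_intros)
  then have "continuous_on {0..b} v" using v_eq by (subst continuous_on_cong[OF refl v_eq]) auto
  then have "volterra d 0 b v"
    unfolding volterra_def using v_eq by (auto elim: continuous_on_subset)
  then show ?thesis using lim by blast
qed

text \<open>On \<open>[0,b)\<close> the iterates stay below the given solution \<open>w\<close>, and on \<open>[b, b+e]\<close>, for small \<open>e\<close>,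
  below twice its bound \<open>K\<close>.\<close>

lemma volterra_extend:
  assumes w: "volterra d 0 b w" and b: "0 < b" and K: "\<And>t. 0 \<le> t \<Longrightarrow> t < b \<Longrightarrow> w t \<le> K"
  shows "\<exists>b'>b. \<exists>v. volterra d 0 b' v \<and> (\<forall>t\<in>{0..<b}. v t = w t)"
proof -
  have K1: "1 \<le> K" using K[of 0] volterra_ge_1[OF w, of 0] b by auto
  \<comment> \<open>A bound for the increment of kern d v from b - e to b + e when v \<le> 2 K.\<close>
  define g where "g e = 2 ^ d / fact d * (2 * K) * ((b + e) ^ (d + 1) - (b - e) ^ (d + 1)) / real (d + 1)" for e :: real
  have "isCont g 0" unfolding g_def by (intro continuous_intros) simp
  moreover have "g 0 < ln 2" by (simp add: g_def)
  ultimately have "eventually (\<lambda>e. g e < ln 2) (at 0)"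
    by (auto simp: isCont_def intro: order_tendstoD)
  then obtain r where r: "r > 0" "\<And>e. e \<noteq> 0 \<Longrightarrow> dist e 0 < r \<Longrightarrow> g e < ln 2"
    unfolding eventually_at by auto
  define e where "e = min (r / 2) (b / 2)"
  have e: "e > 0" "e < b" "g e < ln 2" using r b by (auto simp: e_def dist_real_def)
  have bd: "(t < b \<longrightarrow> picard d m t \<le> w t) \<and> picard d m t \<le> 2 * K" if "0 \<le> t" "t \<le> b + e" for m t
    using that
  proof (induction m arbitrary: t)
    case 0
    then show ?case using volterra_pos[OF w, of t] K1 by auto
  next
    case (Suc m)
    have below: "picard d (Suc m) s \<le> w s" if "0 \<le> s" "s < b" for s
    proof -
      have "kern d (picard d m) s \<le> kern d w s"
        using Suc.IH that e by (intro kern_mono picard_continuous volterra_cont[OF w]) auto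
      then show ?thesis using volterra_eq[OF w that] by simp
    qed
    show ?case
    proof (cases "t < b")
      case True
      then show ?thesis using below[OF Suc.prems(1)] K[OF Suc.prems(1)] K1 by auto
    next
      case False
      have "kern d (picard d m) t - kern d (picard d m) (b - e) \<le>
        2 ^ d / fact d * (2 * K) * (t ^ (d + 1) - (b - e) ^ (d + 1)) / real (d + 1)"
        using Suc.prems Suc.IH e False by (intro kern_increment_upper picard_continuous) auto
      also have "\<dots> \<le> g e"
        unfolding g_def using Suc.prems K1
        by (intro divide_right_mono mult_left_mono diff_right_mono power_mono) auto
      finally have "kern d (picard d m) t \<le> kern d (picard d m) (b - e) + ln 2" using e by linarith
      then have "picard d (Suc m) t \<le> exp (kern d (picard d m) (b - e) + ln 2)" by simp
      also have "\<dots> = picard d (Suc m) (b - e) * 2" by (simp add: exp_add)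
      also have "\<dots> \<le> 2 * K" using below[of "b - e"] K[of "b - e"] e by auto
      finally show ?thesis using False by simp
    qed
  qed
  then obtain v where v: "volterra d 0 (b + e) v"
    "\<forall>t\<in>{0..b + e}. (\<lambda>m. picard d m t) \<longlonglongrightarrow> v t"
    using picard_bounded_solution[of "b + e" d "2 * K"] by auto
  have v': "volterra d 0 b v"
    using v(1) e unfolding volterra_def by (auto elim: continuous_on_subset)
  have "v t = w t" if "t \<in> {0..<b}" for t
  proof (rule volterra_unique_le[OF v' w])
    show "v s \<le> w s" if "0 \<le> s" "s < b" for s
      using v(2) bd that e by (intro LIMSEQ_le_const2[of "\<lambda>m. picard d m s"]) auto
  qed (use that in auto)
  then show ?thesis using v(1) e by (intro exI[of _ "b + e"]) auto
qed

section \<open>The Cauchy problem and its maximal solution\<close>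

text \<open>The primitive vanishing at \<open>0\<close>, on \<open>[0,\<infinity>)\<close>.\<close>

definition primitive :: "(real \<Rightarrow> real) \<Rightarrow> real \<Rightarrow> real" where
  "primitive f = (\<lambda>t. integral {0..t} f)"

lemma primitive_apply: "primitive f t = integral {0..t} f"
  by (simp add: primitive_def)

lemma time_interval_ereal: "time_interval (ereal b) = {0..<b}"
  by (auto simp: time_interval_def)

lemma primitive_has_vector_derivative:
  assumes "continuous_on {0..<b} f" "t \<in> {0..<b}"
  shows "(primitive f has_vector_derivative f t) (at t within {0..<b})"
proof -
  define b' where "b' = (t + b) / 2"
  have b': "t < b'" "b' < b" using assms by (auto simp: b'_def)
  have "(primitive f has_vector_derivative f t) (at t within {0..b'})"
    unfolding primitive_def using assms b'
    by (intro integral_has_vector_derivative) (auto elim: continuous_on_subset)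
  moreover have "at t within {0..b'} = at t within {0..<b}"
    by (rule at_within_nhd[of _ "{..<b'}"]) (use b' in auto)
  ultimately show ?thesis by simp
qed

lemma continuous_on_primitive: "continuous_on {0..<b} f \<Longrightarrow> continuous_on {0..<b} (primitive f)"
  using primitive_has_vector_derivative has_vector_derivative_continuous
  by (metis continuous_on_eq_continuous_within)

lemma continuous_on_iter_primitive: "continuous_on {0..<b} f \<Longrightarrow> continuous_on {0..<b} ((primitive ^^ k) f)"
  by (induction k) (auto intro: continuous_on_primitive)

lemma iter_primitive_0: "k > 0 \<Longrightarrow> (primitive ^^ k) f 0 = 0"
  by (cases k) (auto simp: primitive_apply)

lemma iter_primitive_cong:
  assumes "\<And>s. s \<in> {0..<b} \<Longrightarrow> f s = g s" "t \<in> {0..<b}"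
  shows "(primitive ^^ k) f t = (primitive ^^ k) g t"
  using assms(2)
proof (induction k arbitrary: t)
  case (Suc k)
  have "integral {0..t} ((primitive ^^ k) f) = integral {0..t} ((primitive ^^ k) g)"
    using Suc by (intro Henstock_Kurzweil_Integration.integral_cong) auto
  then show ?case
    by (simp add: primitive_apply[of "(primitive ^^ k) f"] primitive_apply[of "(primitive ^^ k) g"])
qed (use assms in auto)

text \<open>Cauchy's formula for repeated integration, read off from Taylor's formula with integral remainder.\<close>

lemma kern_eq_iter_primitive:
  assumes "continuous_on {0..<b} f" "t \<in> {0..<b}"
  shows "kern d f t = 2 ^ d * (primitive ^^ Suc d) f t"
proof -
  define Df where "Df i = (primitive ^^ (Suc d - i)) f" for i
  have der: "(Df m has_vector_derivative Df (Suc m) s) (at s within {0..t})"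
    if "m < Suc d" "0 \<le> s" "s \<le> t" for m s
  proof -
    have "Suc d - m = Suc (Suc d - Suc m)" using that by simp
    then have eq: "Df m = primitive (Df (Suc m))" unfolding Df_def by simp
    have "(primitive (Df (Suc m)) has_vector_derivative Df (Suc m) s) (at s within {0..<b})"
      using that assms(2)
      by (intro primitive_has_vector_derivative) (auto simp: Df_def intro!: continuous_on_iter_primitive assms(1))
    then show ?thesis unfolding eq
      using assms(2) by (elim has_vector_derivative_within_subset) auto
  qed
  have "((\<lambda>x. ((t - x) ^ (Suc d - 1) / fact (Suc d - 1)) *\<^sub>R Df (Suc d) x) has_integral
    Df 0 t - (\<Sum>i<Suc d. ((t - 0) ^ i / fact i) *\<^sub>R Df i 0)) {0..t}"
    using assms(2) by (intro Taylor_has_integral der) auto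
  moreover have "(\<Sum>i<Suc d. ((t - 0) ^ i / fact i) *\<^sub>R Df i 0) = 0"
    by (intro sum.neutral) (auto simp: Df_def intro!: iter_primitive_0)
  ultimately have "((\<lambda>x. (t - x) ^ d / fact d * f x) has_integral (primitive ^^ Suc d) f t) {0..t}"
    by (simp add: Df_def)
  then have "((\<lambda>x. fact d * ((t - x) ^ d / fact d * f x)) has_integral fact d * (primitive ^^ Suc d) f t) {0..t}"
    by (rule has_integral_mult_right)
  then have "((\<lambda>x. (t - x) ^ d * f x) has_integral fact d * (primitive ^^ Suc d) f t) {0..t}"
    by simp
  then have "integral {0..t} (\<lambda>x. (t - x) ^ d * f x) = fact d * (primitive ^^ Suc d) f t"
    by (rule integral_unique)
  then show ?thesis by (simp add: kern_def)
qed

lemma nth_deriv_on_Suc: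
  "nth_deriv_on S (Suc k) f t = vector_derivative (nth_deriv_on S k f) (at t within S)"
  by (simp add: nth_deriv_on_def)

lemma nth_deriv_on_0: "nth_deriv_on S 0 f = f"
  by (simp add: nth_deriv_on_def)

lemma at_within_Ico_neq_bot: "t \<in> {0..<b::real} \<Longrightarrow> at t within {0..<b} \<noteq> bot"
proof -
  assume t: "t \<in> {0..<b}"
  then have "t islimpt {t<..<b}" by (intro islimpt_greaterThanLessThan1) auto
  then have "t islimpt {0..<b}" by (rule islimpt_subset) (use t in auto)
  then show ?thesis by (simp add: trivial_limit_within)
qed

lemma nth_deriv_on_chain:
  assumes "\<And>k t. k < m \<Longrightarrow> t \<in> {0..<b} \<Longrightarrow> (g k has_vector_derivative g (Suc k) t) (at t within {0..<b})"
    "k \<le> m" "t \<in> {0..<b}"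
  shows "nth_deriv_on {0..<b} k (g 0) t = g k t"
  using assms(2,3)
proof (induction k arbitrary: t)
  case (Suc k)
  have "(g k has_vector_derivative g (Suc k) t) (at t within {0..<b})" using Suc by (intro assms(1)) auto
  then have "(nth_deriv_on {0..<b} k (g 0) has_vector_derivative g (Suc k) t) (at t within {0..<b})"
    by (rule has_vector_derivative_transform[rotated -1]) (use Suc in auto)
  then show ?case unfolding nth_deriv_on_Suc
    using Suc.prems by (intro vector_derivative_within at_within_Ico_neq_bot)
qed (simp add: nth_deriv_on_0)

lemma blasius_of_volterra:
  assumes v: "volterra d 0 b v" and b: "0 < b"
  shows "blasius_solution d (ereal b) ((primitive ^^ d) v)"
proof -
  have cv: "continuous_on {0..<b} v" using v by (simp add: volterra_def)
  define g where "g k = (if k \<le> d then (primitive ^^ (d - k)) v else (\<lambda>t. 2 ^ d * (primitive ^^ d) v t * v t))" for k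
  have g0: "g 0 = (primitive ^^ d) v" by (simp add: g_def)
  have der: "(g k has_vector_derivative g (Suc k) t) (at t within {0..<b})"
    if "k < Suc d" "t \<in> {0..<b}" for k t
  proof (cases "k = d")
    case False
    then have k: "k < d" "d - k = Suc (d - Suc k)" using that by auto
    then have "g k = primitive (g (Suc k))" by (simp add: g_def)
    moreover have "continuous_on {0..<b} (g (Suc k))" using k by (auto simp: g_def intro!: continuous_on_iter_primitive cv)
    ultimately show ?thesis using that primitive_has_vector_derivative by metis
  next
    case True
    have "(primitive ((primitive ^^ d) v) has_real_derivative (primitive ^^ d) v t) (at t within {0..<b})"
      unfolding has_real_derivative_iff_has_vector_derivative
      by (intro primitive_has_vector_derivative continuous_on_iter_primitive cv that)
    then have "((\<lambda>t. exp (2 ^ d * primitive ((primitive ^^ d) v) t)) has_real_derivative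
      exp (2 ^ d * primitive ((primitive ^^ d) v) t) * (2 ^ d * (primitive ^^ d) v t)) (at t within {0..<b})"
      by (auto intro!: derivative_eq_intros)
    then have *: "((\<lambda>t. exp (2 ^ d * primitive ((primitive ^^ d) v) t)) has_vector_derivative
      exp (2 ^ d * primitive ((primitive ^^ d) v) t) * (2 ^ d * (primitive ^^ d) v t)) (at t within {0..<b})"
      by (simp only: has_real_derivative_iff_has_vector_derivative)
    have ve: "v s = exp (2 ^ d * primitive ((primitive ^^ d) v) s)" if "s \<in> {0..<b}" for s
      using volterra_eq[OF v, of s] that kern_eq_iter_primitive[OF cv that] by simp
    have "(v has_vector_derivative v t * (2 ^ d * (primitive ^^ d) v t)) (at t within {0..<b})"
      using * ve that by (intro has_vector_derivative_transform[OF _ _ *[folded ve[OF that(2)]]]) auto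
    then show ?thesis using True by (simp add: g_def mult_ac)
  qed
  have nth: "nth_deriv_on {0..<b} k ((primitive ^^ d) v) t = g k t" if "k \<le> Suc d" "t \<in> {0..<b}" for k t
    using nth_deriv_on_chain[of "Suc d" b g k t] der that by (simp add: g0)
  have diff: "nth_deriv_on {0..<b} k ((primitive ^^ d) v) differentiable_on {0..<b}" if "k \<le> d" for k
    unfolding differentiable_on_def
  proof
    fix t assume t: "t \<in> {0..<b}"
    have "(g k has_vector_derivative g (Suc k) t) (at t within {0..<b})" using der t that by auto
    then have "(nth_deriv_on {0..<b} k ((primitive ^^ d) v) has_vector_derivative g (Suc k) t) (at t within {0..<b})"
      by (rule has_vector_derivative_transform[rotated -1]) (use t nth that in auto)
    then show "nth_deriv_on {0..<b} k ((primitive ^^ d) v) differentiable at t within {0..<b}"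
      by (rule differentiableI_vector)
  qed
  show ?thesis
    unfolding blasius_solution_def time_interval_ereal
  proof (intro conjI allI impI ballI)
    fix t assume t: "t \<in> {0..<b}"
    show "nth_deriv_on {0..<b} (d + 1) ((primitive ^^ d) v) t =
      2 ^ d * (primitive ^^ d) v t * nth_deriv_on {0..<b} d ((primitive ^^ d) v) t"
      using nth[of "Suc d" t] nth[of d t] t by (simp add: g_def)
  next
    fix k assume "k < d"
    then show "nth_deriv_on {0..<b} k ((primitive ^^ d) v) 0 = 0"
      using nth[of k 0] b by (auto simp: g_def intro: iter_primitive_0)
  next
    show "nth_deriv_on {0..<b} d ((primitive ^^ d) v) 0 = 1"
      using nth[of d 0] b volterra_eq[OF v, of 0] by (simp add: g_def kern_def)
  qed (use b diff in auto)
qed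

text \<open>The equation \<open>w' = 2^d y w\<close> with \<open>w(0) = 1\<close> integrates to \<open>w = exp (2^d * (primitive of y))\<close>, and \<open>y\<close> is the
  \<open>d\<close>-fold primitive of \<open>w\<close>. The real \<open>b\<close> is needed because the life time \<open>T\<close> is not known to be finite
  at this point.\<close>

lemma volterra_of_blasius:
  assumes y: "blasius_solution d T y" and b: "0 < b" "ereal b \<le> T"
  defines "w \<equiv> nth_deriv_on (time_interval T) d y"
  shows "volterra d 0 b w" "t \<in> {0..<b} \<Longrightarrow> y t = (primitive ^^ d) w t"
proof -
  define S where "S = time_interval T"
  define g where "g k = nth_deriv_on S k y" for k
  have sub: "{0..<b} \<subseteq> S"
    using b unfolding S_def time_interval_def by (auto intro: less_le_trans[of _ "ereal b"])
  have der: "(g k has_vector_derivative g (Suc k) t) (at t within {0..<b})"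
    if "k \<le> d" "t \<in> {0..<b}" for k t
  proof -
    have "g k differentiable at t within S"
      using y that sub unfolding blasius_solution_def g_def S_def differentiable_on_def by blast
    then have "(g k has_vector_derivative g (Suc k) t) (at t within S)"
      unfolding g_def nth_deriv_on_Suc by (rule vector_derivative_works[THEN iffD1])
    then show ?thesis by (rule has_vector_derivative_within_subset[OF _ sub])
  qed
  have cont: "continuous_on {0..<b} (g k)" if "k \<le> d" for k
    using der that has_vector_derivative_continuous by (metis continuous_on_eq_continuous_within)
  have init: "g k 0 = 0" if "k < d" for k
    using y that unfolding blasius_solution_def g_def S_def by blast
  have init1: "g d 0 = 1"
    using y unfolding blasius_solution_def g_def S_def by blast
  have ode: "g (Suc d) t = 2 ^ d * y t * g d t" if "t \<in> {0..<b}" for t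
    using y that sub unfolding blasius_solution_def g_def S_def by (auto simp: subset_iff)
  have w: "w = g d" by (simp add: w_def g_def S_def)
  have iter: "g (d - i) t = (primitive ^^ i) w t" if "i \<le> d" "t \<in> {0..<b}" for i t
    using that
  proof (induction i arbitrary: t)
    case (Suc i)
    have i: "Suc (d - Suc i) = d - i" using Suc.prems by simp
    have "(g (d - i) has_integral g (d - Suc i) t - g (d - Suc i) 0) {0..t}"
    proof (rule fundamental_theorem_of_calculus)
      fix s assume s: "s \<in> {0..t}"
      then have "(g (d - Suc i) has_vector_derivative g (d - i) s) (at s within {0..<b})"
        using der[of "d - Suc i" s] Suc.prems i by auto
      then show "(g (d - Suc i) has_vector_derivative g (d - i) s) (at s within {0..t})"
        using Suc.prems by (elim has_vector_derivative_within_subset) auto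
    qed (use Suc.prems in auto)
    then have "g (d - Suc i) t = integral {0..t} (g (d - i))"
      using init[of "d - Suc i"] Suc.prems by (simp add: integral_unique)
    also have "\<dots> = integral {0..t} ((primitive ^^ i) w)"
      using Suc by (intro Henstock_Kurzweil_Integration.integral_cong) auto
    finally show ?case by (simp add: primitive_apply[of "(primitive ^^ i) w"])
  qed (simp add: w)
  have y_eq: "y t = (primitive ^^ d) w t" if "t \<in> {0..<b}" for t
    using iter[of d t] that by (simp add: g_def nth_deriv_on_0)
  then show "t \<in> {0..<b} \<Longrightarrow> y t = (primitive ^^ d) w t" .
  have cw: "continuous_on {0..<b} w" using cont[of d] by (simp add: w)
  define E where "E t = exp (- (2 ^ d * primitive ((primitive ^^ d) w) t))" for t
  have "((\<lambda>t. w t * E t) has_vector_derivative 0) (at t within {0..<b})" if t: "t \<in> {0..<b}" for t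
  proof -
    have "(w has_real_derivative 2 ^ d * y t * w t) (at t within {0..<b})"
      using der[of d t] t ode[OF t] by (simp add: w has_real_derivative_iff_has_vector_derivative)
    moreover have "(primitive ((primitive ^^ d) w) has_real_derivative (primitive ^^ d) w t) (at t within {0..<b})"
      unfolding has_real_derivative_iff_has_vector_derivative
      by (intro primitive_has_vector_derivative continuous_on_iter_primitive cw t)
    ultimately have "((\<lambda>t. w t * E t) has_real_derivative
      2 ^ d * y t * w t * E t + w t * (E t * (- (2 ^ d * (primitive ^^ d) w t)))) (at t within {0..<b})"
      unfolding E_def by (auto intro!: derivative_eq_intros)
    then show ?thesis using y_eq[OF t]
      by (simp add: has_real_derivative_iff_has_vector_derivative)
  qed
  then obtain c where c: "\<And>t. t \<in> {0..<b} \<Longrightarrow> w t * E t = c"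
    using has_vector_derivative_zero_constant[of "{0..<b}" "\<lambda>t. w t * E t"] by auto
  have "c = 1" using c[of 0] b init1 by (simp add: w E_def primitive_apply)
  then have "w t = exp (2 ^ d * primitive ((primitive ^^ d) w) t)" if "t \<in> {0..<b}" for t
    using c[OF that] by (simp add: E_def exp_minus field_simps)
  then show "volterra d 0 b w"
    unfolding volterra_def using cw kern_eq_iter_primitive[OF cw] by auto
qed

text \<open>The maximal solution has a finite life time, and its \<open>d\<close>-th derivative is unbounded.\<close>

lemma maximal_blasius_profile:
  assumes "maximal_blasius_solution d T y"
  obtains b where "0 < b" "T = ereal b" "volterra d 0 b (nth_deriv_on {0..<b} d y)"
    "\<And>K. \<exists>t\<in>{0..<b}. K < nth_deriv_on {0..<b} d y t"
proof -
  have y: "blasius_solution d T y" and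
    max: "\<And>T' z. T < T' \<Longrightarrow> blasius_solution d T' z \<Longrightarrow> (\<forall>t\<in>time_interval T. z t = y t) \<Longrightarrow> False"
    using assms unfolding maximal_blasius_solution_def by blast+
  have T: "0 < T" using y by (simp add: blasius_solution_def)
  obtain H where H: "H > 0" "\<And>b w. volterra d 0 b w \<Longrightarrow> b \<le> H" using volterra_blowup by blast
  have "\<not> ereal (H + 1) \<le> T"
  proof
    assume "ereal (H + 1) \<le> T"
    from H(2)[OF volterra_of_blasius(1)[OF y _ this]] H(1) show False by simp
  qed
  then obtain b where b: "T = ereal b" "0 < b" using T by (cases T) auto
  define w where "w = nth_deriv_on {0..<b} d y"
  have w: "volterra d 0 b w" and yw: "\<And>t. t \<in> {0..<b} \<Longrightarrow> y t = (primitive ^^ d) w t"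
    using volterra_of_blasius[OF y, of b] b by (auto simp: w_def time_interval_ereal)
  have "\<exists>t\<in>{0..<b}. K < w t" for K
  proof (rule ccontr)
    assume "\<not> ?thesis"
    then have "\<And>t. 0 \<le> t \<Longrightarrow> t < b \<Longrightarrow> w t \<le> K" by force
    then obtain b' v where v: "b < b'" "volterra d 0 b' v" "\<forall>t\<in>{0..<b}. v t = w t"
      using volterra_extend[OF w b(2)] by blast
    have "blasius_solution d (ereal b') ((primitive ^^ d) v)"
      using v b by (intro blasius_of_volterra) auto
    moreover have "\<forall>t\<in>time_interval T. (primitive ^^ d) v t = y t"
      using yw v iter_primitive_cong[of b v w] by (auto simp: b time_interval_ereal)
    ultimately show False using max[of "ereal b'"] v b by auto
  qed
  then show ?thesis using that[OF b(2,1)] w by (simp add: w_def)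
qed

section \<open>Riemann sums of ball sizes\<close>

lemma pow_le_fact_binomial: "(r - d) ^ d \<le> (r choose d) * fact d"
proof (induction d)
  case (Suc d)
  have "(r - Suc d) ^ Suc d \<le> (r - d) ^ d * (r - d)"
    using power_mono[of "r - Suc d" "r - d" d] by (simp add: mult.commute mult_le_mono)
  also have "\<dots> \<le> (r choose d) * fact d * (r - d)" by (intro mult_right_mono Suc) simp
  also have "\<dots> = (r choose Suc d) * fact (Suc d)"
  proof -
    have "Suc d * (r choose Suc d) = (r - d) * (r choose d)"
      using binomial_absorption[of d r] binomial_absorb_comp[of r d] by simp
    moreover have "(r choose Suc d) * fact (Suc d) = Suc d * (r choose Suc d) * fact d"
      by (simp only: fact_Suc of_nat_id ac_simps)
    ultimately show ?thesis by (simp only: ac_simps)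
  qed
  finally show ?case .
qed simp

lemma ball_size_le_pow: "real (ball_size n d r) \<le> 2 ^ d / fact d * (real r + real d) ^ d"
proof -
  have "real (((r + d) choose d) * fact d) \<le> real ((r + d) ^ d)"
    by (rule of_nat_mono[OF binomial_fact_pow])
  then have "real ((r + d) choose d) \<le> (real r + real d) ^ d / fact d"
    by (simp add: field_simps)
  then have "2 ^ d * real ((r + d) choose d) \<le> 2 ^ d * ((real r + real d) ^ d / fact d)"
    by (intro mult_left_mono) auto
  moreover have "real (ball_size n d r) \<le> real (2 ^ d * ((r + d) choose d))"
    by (rule of_nat_mono[OF ball_size_upper])
  ultimately show ?thesis by simp
qed

lemma ball_size_ge_pow:
  assumes "2 * r < n"
  shows "2 ^ d / fact d * real (r - d) ^ d \<le> real (ball_size n d r)"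
proof -
  have "real ((r - d) ^ d) \<le> real ((r choose d) * fact d)"
    by (rule of_nat_mono[OF pow_le_fact_binomial])
  then have "real (r - d) ^ d / fact d \<le> real (r choose d)"
    by (simp add: field_simps)
  then have "2 ^ d * (real (r - d) ^ d / fact d) \<le> 2 ^ d * real (r choose d)"
    by (intro mult_left_mono) auto
  moreover have "real (2 ^ d * (r choose d)) \<le> real (ball_size n d r)"
    by (rule of_nat_mono[OF ball_size_lower[OF assms]])
  ultimately show ?thesis by simp
qed

lemma sum_le_integral:
  fixes \<phi> :: "real \<Rightarrow> real"
  assumes "0 \<le> q" "continuous_on {a..a + real s * q} \<phi>"
    "\<And>j x. j < s \<Longrightarrow> x \<in> {a + real j * q..a + real (Suc j) * q} \<Longrightarrow> m j \<le> \<phi> x"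
  shows "(\<Sum>j<s. q * m j) \<le> integral {a..a + real s * q} \<phi>"
  using assms(2,3)
proof (induction s)
  case (Suc s)
  let ?p = "a + real s * q" and ?p' = "a + real (Suc s) * q"
  have le: "a \<le> ?p" "?p \<le> ?p'" using assms(1) by (auto simp: algebra_simps)
  have c: "continuous_on {a..?p} \<phi>" "continuous_on {?p..?p'} \<phi>"
    by (rule continuous_on_subset[OF Suc.prems(1)]; use le in auto)+
  have "(\<Sum>j<s. q * m j) \<le> integral {a..?p} \<phi>"
    by (rule Suc.IH[OF c(1)]) (rule Suc.prems(2); simp)
  moreover have "integral {?p..?p'} (\<lambda>_. m s) \<le> integral {?p..?p'} \<phi>"
    using Suc.prems(2) by (intro integral_le integrable_continuous_real c) auto
  moreover have "integral {?p..?p'} (\<lambda>_. m s) = q * m s"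
    using le by (simp add: algebra_simps)
  moreover have "integral {a..?p} \<phi> + integral {?p..?p'} \<phi> = integral {a..?p'} \<phi>"
    using le by (intro Henstock_Kurzweil_Integration.integral_combine integrable_continuous_real Suc.prems) auto
  ultimately have "(\<Sum>j<s. q * m j) + q * m s \<le> integral {a..?p'} \<phi>" by linarith
  then show ?case by (simp only: sum.lessThan_Suc)
qed simp

lemma integral_le_sum:
  fixes \<phi> :: "real \<Rightarrow> real"
  assumes "0 \<le> q" "continuous_on {a..a + real s * q} \<phi>"
    "\<And>j x. j < s \<Longrightarrow> x \<in> {a + real j * q..a + real (Suc j) * q} \<Longrightarrow> \<phi> x \<le> m j"
  shows "integral {a..a + real s * q} \<phi> \<le> (\<Sum>j<s. q * m j)"
proof -
  have "(\<Sum>j<s. q * - m j) \<le> integral {a..a + real s * q} (\<lambda>x. - \<phi> x)"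
    using assms by (intro sum_le_integral continuous_intros) auto
  then show ?thesis by (simp add: sum_negf)
qed

text \<open>The two comparisons between the discrete exponent, a sum of ball sizes, and \<open>kern\<close>. All errors
  (the displacement \<open>h\<close> of the argument, the discretisation, and the lower order terms of the ball sizes)
  are absorbed in a small shift \<open>e\<close> of the time.\<close>

lemma ball_sum_upper:
  assumes N: "0 < N" and h: "0 \<le> h" and e: "h + real d / N \<le> e" and sg: "s \<le> g"
    and cont: "continuous_on {0..real g / N + e} W"
    and nonneg: "\<And>x. x \<in> {0..real g / N + e} \<Longrightarrow> 0 \<le> W x"
    and mono: "\<And>x z. 0 \<le> x \<Longrightarrow> x \<le> z \<Longrightarrow> z \<le> real g / N + e \<Longrightarrow> W x \<le> W z"
  shows "(\<Sum>j<s. real (ball_size n d (g - Suc j)) * W (real j / N + h) / N ^ (d + 1)) \<le> kern d W (real g / N + e)"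
proof -
  define G where "G = real g / N + e"
  define m where "m j = (G - (real (Suc j) / N + h)) ^ d * W (real j / N + h)" for j
  have dN: "0 \<le> real d / N" using N by simp
  then have e0: "0 \<le> e" "h \<le> e" using h e by linarith+
  have "real s / N \<le> real g / N" using sg N by (intro divide_right_mono) auto
  moreover have "real s * (1 / N) = real s / N" by simp
  ultimately have G: "real s * (1 / N) + h \<le> G" using e0 unfolding G_def by linarith
  have "(\<Sum>j<s. (1 / N) * m j) \<le> integral {h..h + real s * (1 / N)} (\<lambda>x. (G - x) ^ d * W x)"
  proof (rule sum_le_integral)
    show "continuous_on {h..h + real s * (1 / N)} (\<lambda>x. (G - x) ^ d * W x)"
      using G h by (intro continuous_intros continuous_on_subset[OF cont[folded G_def]]) auto
    fix j x assume j: "j < s" and x: "x \<in> {h + real j * (1 / N)..h + real (Suc j) * (1 / N)}"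
    have "real (Suc j) * (1 / N) \<le> real s * (1 / N)" using j N by (intro mult_right_mono) auto
    moreover have "real (Suc j) * (1 / N) = real (Suc j) / N" "real j * (1 / N) = real j / N" by simp_all
    ultimately have le: "real (Suc j) / N + h \<le> G" "x \<le> real (Suc j) / N + h" "x \<le> G" "real j / N + h \<le> x"
      using G x by auto
    have j0: "0 \<le> real j / N" using N by simp
    show "m j \<le> (G - x) ^ d * W x"
      unfolding m_def
    proof (intro mult_mono power_mono zero_le_power)
      show "W (real j / N + h) \<le> W x"
        by (rule mono) (use le j0 h in \<open>unfold G_def, linarith+\<close>)
      show "0 \<le> W (real j / N + h)"
        by (rule nonneg) (use le j0 h in \<open>unfold G_def, simp\<close>)
    qed (use le in linarith)+
  qed (use N in simp)
  also have "\<dots> \<le> integral {0..G} (\<lambda>x. (G - x) ^ d * W x)"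
  proof (rule integral_subset_le)
    show "(\<lambda>x. (G - x) ^ d * W x) integrable_on {0..G}"
      using cont unfolding G_def by (rule kern_integrable)
    show "(\<lambda>x. (G - x) ^ d * W x) integrable_on {h..h + real s * (1 / N)}"
      using G h by (intro kern_integrable continuous_on_subset[OF cont[folded G_def]]) auto
  qed (use G h nonneg[folded G_def] in auto)
  finally have int: "(\<Sum>j<s. (1 / N) * m j) \<le> integral {0..G} (\<lambda>x. (G - x) ^ d * W x)" .
  have "(\<Sum>j<s. real (ball_size n d (g - Suc j)) * W (real j / N + h) / N ^ (d + 1)) \<le>
    (\<Sum>j<s. 2 ^ d / fact d * ((1 / N) * m j))"
  proof (rule sum_mono)
    fix j assume j: "j \<in> {..<s}"
    have jg: "real (Suc j) / N \<le> real g / N" using j sg N by (intro divide_right_mono) auto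
    have Wj: "0 \<le> W (real j / N + h)"
    proof (rule nonneg)
      have "0 \<le> real j / N" "real j / N \<le> real (Suc j) / N"
        using N by (auto intro: divide_right_mono)
      then show "real j / N + h \<in> {0..real g / N + e}" using jg h e0 by auto
    qed
    have "(real (g - Suc j) + real d) / N = real g / N - real (Suc j) / N + real d / N"
      using j sg by (simp add: of_nat_diff add_divide_distrib diff_divide_distrib)
    then have "(real (g - Suc j) + real d) / N \<le> G - (real (Suc j) / N + h)"
      using e by (simp add: G_def)
    then have p: "((real (g - Suc j) + real d) / N) ^ d \<le> (G - (real (Suc j) / N + h)) ^ d"
      using N by (intro power_mono) auto
    have "real (ball_size n d (g - Suc j)) * W (real j / N + h) / N ^ (d + 1)
      \<le> (2 ^ d / fact d * (real (g - Suc j) + real d) ^ d) * W (real j / N + h) / N ^ (d + 1)"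
      using N Wj by (intro divide_right_mono mult_right_mono ball_size_le_pow) auto
    also have "\<dots> = 2 ^ d / fact d * ((1 / N) * (((real (g - Suc j) + real d) / N) ^ d * W (real j / N + h)))"
      by (simp add: power_divide)
    also have "\<dots> \<le> 2 ^ d / fact d * ((1 / N) * m j)"
      unfolding m_def using N Wj p by (intro mult_left_mono mult_right_mono) auto
    finally show "real (ball_size n d (g - Suc j)) * W (real j / N + h) / N ^ (d + 1) \<le> 2 ^ d / fact d * ((1 / N) * m j)" .
  qed
  also have "\<dots> = 2 ^ d / fact d * (\<Sum>j<s. (1 / N) * m j)" by (simp only: sum_distrib_left)
  also have "\<dots> \<le> 2 ^ d / fact d * integral {0..G} (\<lambda>x. (G - x) ^ d * W x)"
    by (intro mult_left_mono int) auto
  finally show ?thesis by (simp add: kern_def G_def)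
qed

lemma ball_sum_lower:
  assumes d: "1 \<le> d" and N: "0 < N" and h: "0 \<le> h" and e: "h + real (d + 2) / N \<le> e" and gn: "2 * g < n"
    and cont: "continuous_on {0..real g / N} V"
    and nonneg: "\<And>x. x \<in> {0..real g / N} \<Longrightarrow> 0 \<le> V x"
    and mono: "\<And>x z. 0 \<le> x \<Longrightarrow> x \<le> z \<Longrightarrow> z \<le> real g / N \<Longrightarrow> V x \<le> V z"
    and A: "\<And>j. j < g \<Longrightarrow> V (max 0 (real j / N - h)) \<le> A j"
  shows "kern d V (max 0 (real g / N - e)) \<le> (\<Sum>j<g. real (ball_size n d (g - Suc j)) * A j / N ^ (d + 1))"
proof -
  have A0: "0 \<le> A j" if "j < g" for j
  proof -
    have "real j / N \<le> real g / N" using that N by (intro divide_right_mono) auto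
    then have "0 \<le> V (max 0 (real j / N - h))" using h N by (intro nonneg) auto
    then show ?thesis using A[OF that] by linarith
  qed
  show ?thesis
  proof (cases "real g / N \<le> e")
    case True
    then have "kern d V (max 0 (real g / N - e)) = 0" by (simp add: kern_def)
    moreover have "0 \<le> (\<Sum>j<g. real (ball_size n d (g - Suc j)) * A j / N ^ (d + 1))"
      using A0 N by (intro sum_nonneg divide_nonneg_nonneg mult_nonneg_nonneg) auto
    ultimately show ?thesis by simp
  next
    case False
    define G where "G = real g / N - e"
    have dN: "0 \<le> real (d + 2) / N" using N by simp
    have G: "0 < G" "G \<le> real g / N" using False dN e h unfolding G_def by linarith+
    define \<phi> where "\<phi> x = (max 0 (G - x)) ^ d * V (max 0 (min x G))" for x
    define m where "m j = (real (g - Suc j - d) / N) ^ d * A j" for j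
    let ?a = "- h - 1 / N"
    have cV: "continuous_on UNIV (\<lambda>x. V (max 0 (min x G)))"
      by (rule continuous_on_compose2[OF cont]) (use G in \<open>auto intro!: continuous_intros\<close>)
    have c\<phi>: "continuous_on S \<phi>" for S
      unfolding \<phi>_def by (intro continuous_intros continuous_on_subset[OF cV]) auto
    have \<phi>0: "0 \<le> \<phi> x" for x unfolding \<phi>_def using G by (intro mult_nonneg_nonneg nonneg) auto
    have "integral {0..G} (\<lambda>x. (G - x) ^ d * V x) = integral {0..G} \<phi>"
      by (intro Henstock_Kurzweil_Integration.integral_cong) (auto simp: \<phi>_def)
    also have "\<dots> \<le> integral {?a..?a + real g * (1 / N)} \<phi>"
    proof (rule integral_subset_le)
      have "1 / N \<le> real (d + 2) / N" using N by (intro divide_right_mono) auto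
      moreover have "0 \<le> 1 / N" using N by simp
      moreover have "real g * (1 / N) = real g / N" by simp
      ultimately have "?a \<le> 0" "G \<le> ?a + real g * (1 / N)"
        using e h unfolding G_def by linarith+
      then show "{0..G} \<subseteq> {?a..?a + real g * (1 / N)}" by auto
    qed (auto intro!: integrable_continuous_real c\<phi> \<phi>0)
    also have "\<dots> \<le> (\<Sum>j<g. (1 / N) * m j)"
    proof (rule integral_le_sum)
      fix j x assume j: "j < g" and x: "x \<in> {?a + real j * (1 / N)..?a + real (Suc j) * (1 / N)}"
      have "G - x \<le> (real g - real (Suc j) - real d) / N"
        using x e unfolding G_def by (auto simp: add_divide_distrib diff_divide_distrib)
      also have "\<dots> \<le> real (g - Suc j - d) / N" using N by (intro divide_right_mono) auto
      finally have "max 0 (G - x) \<le> real (g - Suc j - d) / N" using N by simp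
      then have 1: "(max 0 (G - x)) ^ d \<le> (real (g - Suc j - d) / N) ^ d" by (intro power_mono) auto
      have jg: "real j / N \<le> real g / N" using j N by (intro divide_right_mono) auto
      have "V (max 0 (min x G)) \<le> V (max 0 (real j / N - h))"
        using x jg h N by (intro mono) (auto simp: add_divide_distrib)
      then have 2: "V (max 0 (min x G)) \<le> A j" using A[OF j] by linarith
      show "\<phi> x \<le> m j" unfolding \<phi>_def m_def
        using N G by (intro mult_mono 1 2 nonneg) auto
    qed (use N c\<phi> in auto)
    finally have int: "integral {0..G} (\<lambda>x. (G - x) ^ d * V x) \<le> (\<Sum>j<g. (1 / N) * m j)" .
    have "kern d V G \<le> 2 ^ d / fact d * (\<Sum>j<g. (1 / N) * m j)"
      unfolding kern_def by (intro mult_left_mono int) auto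
    also have "\<dots> = (\<Sum>j<g. 2 ^ d / fact d * ((1 / N) * m j))" by (simp only: sum_distrib_left)
    also have "\<dots> \<le> (\<Sum>j<g. real (ball_size n d (g - Suc j)) * A j / N ^ (d + 1))"
    proof (rule sum_mono)
      fix j assume j: "j \<in> {..<g}"
      have "2 ^ d / fact d * ((1 / N) * m j) = (2 ^ d / fact d * real (g - Suc j - d) ^ d) * A j / N ^ (d + 1)"
        by (simp add: m_def power_divide)
      also have "\<dots> \<le> real (ball_size n d (g - Suc j)) * A j / N ^ (d + 1)"
        using j gn A0 N by (intro divide_right_mono mult_right_mono ball_size_ge_pow) auto
      finally show "2 ^ d / fact d * ((1 / N) * m j) \<le> real (ball_size n d (g - Suc j)) * A j / N ^ (d + 1)" .
    qed
    finally show ?thesis using G by (simp add: G_def max_def)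
  qed
qed

section \<open>Barriers\<close>

text \<open>The upper barrier \<open>W\<close> solves the Volterra equation with constant \<open>\<eta>\<close>, the lower barrier \<open>V\<close> with constant
  \<open>- \<eta>\<close>. The \<open>g r\<close> with \<open>r \<le> R\<close> are the target times at which concentration is used; they have mesh at most
  \<open>h N\<close>. The last two hypotheses say that \<open>\<eta>\<close> outweighs all approximation errors.\<close>

locale barrier = rejection_process d n M Y
  for d n :: nat and M :: "'a measure" and Y :: "nat \<Rightarrow> 'a \<Rightarrow> nat \<Rightarrow> nat" +
  fixes N h e \<eta> \<epsilon> \<kappa> t1 Wm b1 b2 :: real and W V :: "real \<Rightarrow> real"
    and K R :: nat and g :: "nat \<Rightarrow> nat"
  assumes d_pos: "1 \<le> d" and N_pos: "0 < N" and N_pow: "N ^ (d + 1) = real n ^ d"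
    and h: "0 \<le> h" and e: "h + real (d + 2) / N \<le> e"
    and W: "volterra d \<eta> b1 W" and V: "volterra d (- \<eta>) b2 V"
    and t1: "t1 < b1" "t1 < b2" and \<eta>: "0 \<le> \<eta>"
    and g_le: "\<And>r. r \<le> R \<Longrightarrow> g r \<le> K"
    and g_above: "\<And>i. i \<le> K \<Longrightarrow> \<exists>r\<le>R. i \<le> g r \<and> real (g r) / N \<le> real i / N + h"
    and g_below: "\<And>i. i \<le> K \<Longrightarrow> \<exists>r\<le>R. g r \<le> i \<and> real i / N \<le> real (g r) / N + h"
    and K_t1: "real K / N + e \<le> t1" and Wm: "W t1 \<le> Wm" and K_n: "2 * K < n"
    and \<kappa>: "real (ball_size n d K) * Wm \<le> \<kappa> * real n ^ d" "\<kappa> \<le> 1 / 2"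
    and \<epsilon>: "0 < \<epsilon>" "\<epsilon> < 1"
    and gapW: "\<And>s. 0 \<le> s \<Longrightarrow> s + e \<le> t1 \<Longrightarrow>
      (1 + 2 * \<kappa>) * kern d W (s + e) - ln (1 - \<epsilon>) \<le> \<eta> + kern d W s"
    and gapV: "\<And>s. 0 \<le> s \<Longrightarrow> s \<le> t1 \<Longrightarrow>
      - \<eta> + kern d V s + ln (1 + \<epsilon>) \<le> kern d V (max 0 (s - e))"
begin

text \<open>Up to time \<open>i\<close>, the reciprocal of the unburnt fraction is at most the upper barrier, looked up
  at a time later by \<open>h\<close>. The process is frozen after the last time \<open>K\<close> of interest, where \<open>W\<close> may
  no longer be defined.\<close>

definition alive :: "nat \<Rightarrow> (nat \<Rightarrow> nat \<Rightarrow> nat) \<Rightarrow> bool" where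
  "alive i y \<longleftrightarrow> i \<le> K \<and> (\<forall>j\<le>i. real n ^ d \<le> real (card (unburnt d n y j)) * W (real j / N + h))"

text \<open>The event that all the sums of survival martingales are close to their mean.\<close>

definition good :: "(nat \<Rightarrow> nat \<Rightarrow> nat) \<Rightarrow> bool" where
  "good y \<longleftrightarrow> (\<forall>r\<le>R. \<bar>stopped_process.S d n (g r) alive y - real n ^ d\<bar> \<le> \<epsilon> * real n ^ d)"

lemma nd_pos: "0 < real n ^ d"
  using n_pos by simp

lemma e_ge: "h \<le> e" "0 \<le> e"
proof -
  have "0 \<le> real (d + 2) / N" using N_pos by simp
  then show "h \<le> e" "0 \<le> e" using e h by linarith+
qed

lemma t1_nonneg: "0 \<le> t1"
proof -
  have "0 \<le> real K / N" using N_pos by simp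
  then show ?thesis using K_t1 e_ge by linarith
qed

lemma div_mono: "i \<le> j \<Longrightarrow> real i / N \<le> real j / N"
  using N_pos by (intro divide_right_mono) auto

lemma div_nonneg: "0 \<le> real i / N"
  using N_pos by simp

lemma time_le:
  assumes "j \<le> K"
  shows "0 \<le> real j / N + h" "real j / N + h \<le> t1" "real j / N + e \<le> t1" "real j / N \<le> t1"
  using div_mono[OF assms] div_nonneg[of j] K_t1 e_ge h by linarith+

lemma W_pos: "0 \<le> x \<Longrightarrow> x \<le> t1 \<Longrightarrow> 0 < W x"
  using volterra_pos[OF W] t1 by simp

lemma V_pos: "0 \<le> x \<Longrightarrow> x \<le> t1 \<Longrightarrow> 0 < V x"
  using volterra_pos[OF V] t1 by simp

lemma W_mono: "0 \<le> x \<Longrightarrow> x \<le> z \<Longrightarrow> z \<le> t1 \<Longrightarrow> W x \<le> W z"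
  using volterra_mono[OF W] t1 by simp

lemma V_mono: "0 \<le> x \<Longrightarrow> x \<le> z \<Longrightarrow> z \<le> t1 \<Longrightarrow> V x \<le> V z"
  using volterra_mono[OF V] t1 by simp

lemma Wm_pos: "0 < Wm"
  using W_pos[OF t1_nonneg] Wm by simp

lemma adapted_alive: "adapted i (alive i)"
  unfolding adapted_def
proof (intro allI impI)
  fix y y' :: "nat \<Rightarrow> nat \<Rightarrow> nat" assume *: "\<forall>j\<in>{1..i}. y j = y' j"
  have "unburnt d n y j = unburnt d n y' j" if "j \<le> i" for j
    using * that by (intro unburnt_cong) auto
  then show "alive i y = alive i y'" unfolding alive_def by auto
qed

lemma stopped: 
  assumes "r \<le> R"
  shows "stopped_process d n M Y (g r) (real n ^ d / Wm) alive"
proof unfold_locales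
  show "adapted i (alive i)" for i by (rule adapted_alive)
  show "alive (Suc i) y \<Longrightarrow> alive i y" for i y by (simp add: alive_def)
  show "real n ^ d / Wm \<le> real (card (unburnt d n y i))" if "alive i y" for i y
  proof -
    have i: "i \<le> K" "real n ^ d \<le> real (card (unburnt d n y i)) * W (real i / N + h)"
      using that by (auto simp: alive_def)
    note i(2)
    also have "real (card (unburnt d n y i)) * W (real i / N + h) \<le> real (card (unburnt d n y i)) * Wm"
      using W_mono[OF time_le(1,2)[OF i(1)] order_refl] Wm by (intro mult_left_mono) auto
    finally show ?thesis using Wm_pos by (simp add: field_simps)
  qed
  have "ball_size n d (g r) \<le> ball_size n d K" by (intro ball_size_mono g_le assms)
  then have "real (ball_size n d (g r)) * Wm \<le> real (ball_size n d K) * Wm"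
    using Wm_pos by (intro mult_right_mono) auto
  also have "\<dots> \<le> 1 / 2 * real n ^ d"
    using \<kappa> nd_pos mult_right_mono[of \<kappa> "1/2" "real n ^ d"] by linarith
  finally show "2 * real (ball_size n d (g r)) \<le> real n ^ d / Wm"
    using Wm_pos by (simp add: field_simps)
qed

text \<open>The upper barrier is never crossed. At a first crossing time \<open>s\<close>, the martingale with
  the next target time \<open>g r \<ge> s\<close> bounds the unburnt fraction from below by an expression that only involves
  earlier times, and this contradicts the choice of \<open>s\<close>.\<close>

lemma good_alive:
  assumes y: "valid_upto d n K y" and "good y" and "i \<le> K"
  shows "alive i y"
proof (rule ccontr)
  assume "\<not> alive i y"
  define s where "s = (LEAST s. \<not> alive s y)"
  have s: "\<not> alive s y" "s \<le> i"
    unfolding s_def using LeastI[of "\<lambda>s. \<not> alive s y"] Least_le[of "\<lambda>s. \<not> alive s y"] \<open>\<not> alive i y\<close>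
    by blast+
  have before: "\<forall>j<s. alive j y" unfolding s_def using not_less_Least by blast
  have sK: "s \<le> K" using s assms by simp
  obtain r where r: "r \<le> R" "s \<le> g r" "real (g r) / N \<le> real s / N + h" using g_above[OF sK] by blast
  interpret sp: stopped_process d n M Y "g r" "real n ^ d / Wm" alive by (rule stopped[OF r(1)])
  note gK = g_le[OF r(1)]
  have hit: "0 \<le> sp.hit j y" "sp.hit j y \<le> \<kappa>"
    "sp.hit j y \<le> real (ball_size n d (g r - Suc j)) * W (real j / N + h) / N ^ (d + 1)" if "j < s" for j
  proof -
    have a: "alive j y" using before that by blast
    show "0 \<le> sp.hit j y" by (rule sp.hit_bounds(1)[OF a])
    have "real (ball_size n d (g r - Suc j)) \<le> real (ball_size n d K)"
      using gK by (intro of_nat_mono ball_size_mono) auto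
    then have "real (ball_size n d (g r - Suc j)) * Wm \<le> \<kappa> * real n ^ d"
      using \<kappa>(1) Wm_pos mult_right_mono[of _ _ Wm] by (smt (verit))
    then have "real (ball_size n d (g r - Suc j)) / (real n ^ d / Wm) \<le> \<kappa>"
      using nd_pos by (simp add: field_simps)
    with sp.hit_bounds(2)[OF a] show "sp.hit j y \<le> \<kappa>" by linarith
    have "0 < real (card (unburnt d n y j))" using sp.alive_card_pos[OF a] .
    moreover have "real n ^ d \<le> real (card (unburnt d n y j)) * W (real j / N + h)"
      using a by (simp add: alive_def)
    ultimately have "1 / real (card (unburnt d n y j)) \<le> W (real j / N + h) / real n ^ d"
      using nd_pos by (simp add: field_simps)
    then have "real (ball_size n d (g r - Suc j)) * (1 / real (card (unburnt d n y j)))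
      \<le> real (ball_size n d (g r - Suc j)) * (W (real j / N + h) / real n ^ d)"
      by (intro mult_left_mono) auto
    then show "sp.hit j y \<le> real (ball_size n d (g r - Suc j)) * W (real j / N + h) / N ^ (d + 1)"
      unfolding sp.hit_def N_pow by simp
  qed
  define G where "G = real (g r) / N"
  have G: "0 \<le> G" "G + e \<le> t1" using div_nonneg time_le(3)[OF gK] by (auto simp: G_def)
  have \<kappa>0: "0 \<le> 1 + 2 * \<kappa>"
  proof -
    have "0 \<le> real (ball_size n d K) * Wm" using Wm_pos by simp
    then have "0 \<le> \<kappa> * real n ^ d" using \<kappa>(1) by linarith
    then show ?thesis using nd_pos by (simp add: zero_le_mult_iff)
  qed
  have "(\<Sum>j<s. sp.hit j y) \<le> (\<Sum>j<s. real (ball_size n d (g r - Suc j)) * W (real j / N + h) / N ^ (d + 1))"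
    using hit(3) by (intro sum_mono) auto
  also have "\<dots> \<le> kern d W (G + e)"
    unfolding G_def
  proof (rule ball_sum_upper[OF N_pos h _ r(2)])
    have "real d / N \<le> real (d + 2) / N" using N_pos by (intro divide_right_mono) auto
    then show "h + real d / N \<le> e" using e by linarith
    show "continuous_on {0..real (g r) / N + e} W"
      using G t1 by (intro volterra_cont[OF W]) (simp add: G_def)
    show "0 \<le> W x" if "x \<in> {0..real (g r) / N + e}" for x
      using W_pos[of x] that G by (simp add: G_def)
    show "W x \<le> W z" if "0 \<le> x" "x \<le> z" "z \<le> real (g r) / N + e" for x z
      using W_mono[of x z] that G by (simp add: G_def)
  qed
  finally have sum_le: "(\<Sum>j<s. sp.hit j y) \<le> kern d W (G + e)" .
  have "exp (- (1 + 2 * \<kappa>) * (\<Sum>j<s. sp.hit j y)) = (\<Prod>j<s. exp (- (1 + 2 * \<kappa>) * sp.hit j y))"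
    by (simp only: sum_distrib_left exp_sum[OF finite_lessThan])
  also have "\<dots> \<le> (\<Prod>j<s. 1 - sp.hit j y)"
  proof (rule prod_mono, intro conjI)
    fix j assume j: "j \<in> {..<s}"
    have "sp.hit j y * sp.hit j y \<le> \<kappa> * sp.hit j y" using hit(1,2)[of j] j by (intro mult_right_mono) auto
    then have "- (1 + 2 * \<kappa>) * sp.hit j y \<le> - sp.hit j y - 2 * (sp.hit j y)\<^sup>2"
      by (simp add: algebra_simps power2_eq_square)
    then have "exp (- (1 + 2 * \<kappa>) * sp.hit j y) \<le> exp (- sp.hit j y - 2 * (sp.hit j y)\<^sup>2)" by simp
    also have "\<dots> \<le> 1 - sp.hit j y"
      using hit(1,2)[of j] j \<kappa>(2) by (intro one_minus_ge_exp) auto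
    finally show "exp (- (1 + 2 * \<kappa>) * sp.hit j y) \<le> 1 - sp.hit j y" .
  qed simp
  finally have prod_ge: "exp (- (1 + 2 * \<kappa>) * (\<Sum>j<s. sp.hit j y)) \<le> (\<Prod>j<s. 1 - sp.hit j y)" .
  have "1 / W G = exp (- (\<eta> + kern d W G))"
  proof -
    have "W G = exp (\<eta> + kern d W G)" using volterra_eq[OF W, of G] G t1 e_ge by simp
    then show ?thesis by (simp only: exp_minus inverse_eq_divide)
  qed
  also have "\<dots> \<le> exp (ln (1 - \<epsilon>) + - (1 + 2 * \<kappa>) * (\<Sum>j<s. sp.hit j y))"
  proof -
    have "(1 + 2 * \<kappa>) * (\<Sum>j<s. sp.hit j y) \<le> (1 + 2 * \<kappa>) * kern d W (G + e)"
      by (rule mult_left_mono[OF sum_le \<kappa>0])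
    then have "- (\<eta> + kern d W G) \<le> ln (1 - \<epsilon>) - (1 + 2 * \<kappa>) * (\<Sum>j<s. sp.hit j y)"
      using gapW[OF G] by linarith
    then show ?thesis by (simp only: exp_le_cancel_iff mult_minus_left diff_conv_add_uminus)
  qed
  also have "\<dots> = (1 - \<epsilon>) * exp (- (1 + 2 * \<kappa>) * (\<Sum>j<s. sp.hit j y))"
    using \<epsilon> by (simp only: exp_add exp_ln diff_gt_0_iff_gt)
  also have "\<dots> \<le> (1 - \<epsilon>) * (\<Prod>j<s. 1 - sp.hit j y)"
    using \<epsilon> prod_ge by (intro mult_left_mono) auto
  finally have "real n ^ d * (1 / W G) \<le> real n ^ d * ((1 - \<epsilon>) * (\<Prod>j<s. 1 - sp.hit j y))"
    using nd_pos by (intro mult_left_mono) auto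
  also have "\<dots> \<le> card (unburnt d n y s)"
    using sp.unburnt_lower[of s y \<epsilon>] valid_upto_mono[OF y sK] assms(2) r before s(1)
    by (simp add: good_def mult_ac)
  finally have c: "real n ^ d \<le> card (unburnt d n y s) * W G"
    using W_pos[of G] G e_ge by (simp add: field_simps)
  also have "\<dots> \<le> card (unburnt d n y s) * W (real s / N + h)"
    using W_mono[of G "real s / N + h"] G r(3) time_le[OF sK] by (intro mult_left_mono) (auto simp: G_def)
  finally have "alive s y"
    unfolding alive_def using sK before by (auto simp: le_less alive_def)
  with s show False by simp
qed

text \<open>The lower barrier is not crossed either; here the previous target time \<open>g r \<le> i\<close> is used.\<close>

lemma good_upper:
  assumes y: "valid_upto d n K y" and good: "good y" and "i \<le> K"
  shows "real (card (unburnt d n y i)) * V (max 0 (real i / N - h)) \<le> real n ^ d"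
  using assms(3)
proof (induction i rule: less_induct)
  case (less i)
  obtain r where r: "r \<le> R" "g r \<le> i" "real i / N \<le> real (g r) / N + h" using g_below[OF less.prems] by blast
  interpret sp: stopped_process d n M Y "g r" "real n ^ d / Wm" alive by (rule stopped[OF r(1)])
  note gK = g_le[OF r(1)]
  define G where "G = real (g r) / N"
  have G: "0 \<le> G" "G \<le> t1" using div_nonneg time_le(4)[OF gK] by (auto simp: G_def)
  have al: "\<forall>j<g r. alive j y" using good_alive[OF y good] gK by auto
  have hit: "sp.hit j y = real (ball_size n d (g r - Suc j)) * (real n ^ d / card (unburnt d n y j)) / N ^ (d + 1)" for j
    unfolding sp.hit_def N_pow using nd_pos by simp
  have "kern d V (max 0 (real (g r) / N - e)) \<le>
    (\<Sum>j<g r. real (ball_size n d (g r - Suc j)) * (real n ^ d / card (unburnt d n y j)) / N ^ (d + 1))"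
  proof (rule ball_sum_lower[OF d_pos N_pos h e])
    show "2 * g r < n" using gK K_n by simp
    show "continuous_on {0..real (g r) / N} V"
      using G t1 by (intro volterra_cont[OF V]) (simp add: G_def)
    show "0 \<le> V x" if "x \<in> {0..real (g r) / N}" for x
      using V_pos[of x] that G by (simp add: G_def)
    show "V x \<le> V z" if "0 \<le> x" "x \<le> z" "z \<le> real (g r) / N" for x z
      using V_mono[of x z] that G by (simp add: G_def)
    fix j assume j: "j < g r"
    have "real (card (unburnt d n y j)) * V (max 0 (real j / N - h)) \<le> real n ^ d"
      by (rule less.IH) (use j r less.prems in auto)
    moreover have "0 < real (card (unburnt d n y j))" using sp.alive_card_pos al j by blast
    ultimately show "V (max 0 (real j / N - h)) \<le> real n ^ d / card (unburnt d n y j)"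
      by (simp add: field_simps)
  qed
  then have sum_ge: "kern d V (max 0 (G - e)) \<le> (\<Sum>j<g r. sp.hit j y)" by (simp add: hit G_def)
  have "(\<Prod>j<g r. 1 - sp.hit j y) \<le> (\<Prod>j<g r. exp (- sp.hit j y))"
  proof (rule prod_mono, intro conjI)
    fix j assume "j \<in> {..<g r}"
    then show "0 \<le> 1 - sp.hit j y" using sp.hit_bounds(3)[of j y] al by auto
    show "1 - sp.hit j y \<le> exp (- sp.hit j y)" using exp_ge_add_one_self[of "- sp.hit j y"] by simp
  qed
  also have "\<dots> = exp (- (\<Sum>j<g r. sp.hit j y))"
    by (simp only: sum_negf[symmetric] exp_sum[OF finite_lessThan])
  also have "\<dots> \<le> exp (- kern d V (max 0 (G - e)))" using sum_ge by simp
  finally have prod_le: "(\<Prod>j<g r. 1 - sp.hit j y) \<le> exp (- kern d V (max 0 (G - e)))" .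
  have "real (card (unburnt d n y i)) \<le> real (card (unburnt d n y (g r)))"
    using card_unburnt_antimono[OF r(2)] by (intro of_nat_mono)
  also have "\<dots> \<le> (1 + \<epsilon>) * real n ^ d * (\<Prod>j<g r. 1 - sp.hit j y)"
    using good r(1) al by (intro sp.unburnt_upper valid_upto_mono[OF y gK]) (auto simp: good_def)
  also have "\<dots> \<le> (1 + \<epsilon>) * real n ^ d * exp (- kern d V (max 0 (G - e)))"
    using \<epsilon> nd_pos by (intro mult_left_mono prod_le) auto
  finally have c: "real (card (unburnt d n y i)) \<le> (1 + \<epsilon>) * real n ^ d * exp (- kern d V (max 0 (G - e)))" .
  have "max 0 (real i / N - h) \<le> G" using r(3) G by (simp add: G_def)
  then have "V (max 0 (real i / N - h)) \<le> V G" using G by (intro V_mono) auto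
  also have "\<dots> = exp (- \<eta> + kern d V G)" using volterra_eq[OF V, of G] G t1 by simp
  also have "\<dots> \<le> exp (kern d V (max 0 (G - e)) - ln (1 + \<epsilon>))" using gapV[OF G] by simp
  also have "\<dots> = exp (kern d V (max 0 (G - e))) / (1 + \<epsilon>)" using \<epsilon> by (simp add: exp_diff)
  finally have v: "V (max 0 (real i / N - h)) \<le> exp (kern d V (max 0 (G - e))) / (1 + \<epsilon>)" .
  have "0 \<le> V (max 0 (real i / N - h))"
    using \<open>max 0 (real i / N - h) \<le> G\<close> G by (intro less_imp_le[OF V_pos]) auto
  then have "real (card (unburnt d n y i)) * V (max 0 (real i / N - h)) \<le>
    ((1 + \<epsilon>) * real n ^ d * exp (- kern d V (max 0 (G - e)))) * (exp (kern d V (max 0 (G - e))) / (1 + \<epsilon>))"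
    using c v \<epsilon> by (intro mult_mono) auto
  also have "\<dots> = real n ^ d" using \<epsilon> by (simp add: exp_minus)
  finally show ?case .
qed

lemma adapted_S_K: 
  assumes "r \<le> R"
  shows "adapted K (stopped_process.S d n (g r) alive)"
proof -
  interpret sp: stopped_process d n M Y "g r" "real n ^ d / Wm" alive by (rule stopped[OF assms])
  show ?thesis by (rule adapted_mono[OF sp.adapted_S g_le[OF assms]])
qed

lemma adapted_good: "adapted K good"
  unfolding adapted_def
proof (intro allI impI)
  fix y y' :: "nat \<Rightarrow> nat \<Rightarrow> nat" assume *: "\<forall>j\<in>{1..K}. y j = y' j"
  have "stopped_process.S d n (g r) alive y = stopped_process.S d n (g r) alive y'" if "r \<le> R" for r
    by (rule adaptedD[OF adapted_S_K[OF that]]) (use * in blast)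
  then show "good y = good y'" unfolding good_def by simp
qed

lemma prob_not_good:
  "prob {\<omega>\<in>space M. \<not> good (path \<omega>)} \<le> real (R + 1) *
    (real (ball_size n d (2 * K)) * exp (2 * real K * real (ball_size n d K) * Wm / real n ^ d) / (\<epsilon>\<^sup>2 * real n ^ d))"
proof -
  let ?A = "\<lambda>r. {\<omega>\<in>space M. \<bar>stopped_process.S d n (g r) alive (path \<omega>) - real n ^ d\<bar> > \<epsilon> * real n ^ d}"
  let ?C = "real (ball_size n d (2 * K)) * exp (2 * real K * real (ball_size n d K) * Wm / real n ^ d) / (\<epsilon>\<^sup>2 * real n ^ d)"
  have eq: "{\<omega>\<in>space M. \<not> good (path \<omega>)} = (\<Union>r\<in>{..R}. ?A r)"
    by (auto simp: good_def not_le)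
  have "prob (\<Union>r\<in>{..R}. ?A r) \<le> (\<Sum>r\<in>{..R}. prob (?A r))"
  proof (rule finite_measure_subadditive_finite)
    show "?A ` {..R} \<subseteq> sets M"
    proof (rule image_subsetI)
      fix r assume "r \<in> {..R}"
      then have "r \<le> R" by simp
      then show "?A r \<in> sets M" by (rule adapted_sets[OF adapted_comp[OF adapted_S_K]])
    qed
  qed simp
  also have "\<dots> \<le> (\<Sum>r\<in>{..R}. ?C)"
  proof (rule sum_mono)
    fix r assume "r \<in> {..R}"
    then have r: "r \<le> R" by simp
    interpret sp: stopped_process d n M Y "g r" "real n ^ d / Wm" alive by (rule stopped[OF r])
    have b: "real (ball_size n d (2 * g r)) \<le> real (ball_size n d (2 * K))"
      "real (ball_size n d (g r)) \<le> real (ball_size n d K)"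
      using g_le[OF r] by (auto intro!: of_nat_mono ball_size_mono)
    have "prob (?A r) \<le> real (ball_size n d (2 * g r)) *
      exp (2 * real (g r) * real (ball_size n d (g r)) / (real n ^ d / Wm)) / (\<epsilon>\<^sup>2 * real n ^ d)"
      by (rule sp.S_concentrated[OF \<epsilon>(1)])
    also have "\<dots> \<le> real (ball_size n d (2 * K)) *
      exp (2 * real K * real (ball_size n d K) / (real n ^ d / Wm)) / (\<epsilon>\<^sup>2 * real n ^ d)"
    proof (intro divide_right_mono mult_mono b)
      have "2 * real (g r) * real (ball_size n d (g r)) \<le> 2 * real K * real (ball_size n d K)"
        using g_le[OF r] b by (intro mult_mono) auto
      then show "exp (2 * real (g r) * real (ball_size n d (g r)) / (real n ^ d / Wm)) \<le>
        exp (2 * real K * real (ball_size n d K) / (real n ^ d / Wm))"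
        using nd_pos Wm_pos unfolding exp_le_cancel_iff by (intro divide_right_mono) auto
    qed (use nd_pos in auto)
    finally show "prob (?A r) \<le> ?C" by simp
  qed
  finally show ?thesis unfolding eq by simp
qed

end

section \<open>Survival when few vertices are left\<close>

context rejection_process
begin

text \<open>As in the martingale argument, the hitting probability of a surviving vertex is exactly the ball size
  divided by the number of unburnt vertices, and the latter is at most \<open>D\<close> from time \<open>k0\<close> on.\<close>

lemma expec_late:
  assumes x: "x \<in> torus d n" and D: "0 < D" and l: "l \<le> m"
  shows "expec (\<lambda>y. of_bool (real (card (unburnt d n y k0)) \<le> D \<and> avoids d n y (k0 + m) (k0 + l) x)) \<le>
    exp (- (\<Sum>i<l. real (ball_size n d (m - Suc i))) / D)"
  using l
proof (induction l)
  case 0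
  have "expec (\<lambda>y. of_bool (real (card (unburnt d n y k0)) \<le> D \<and> avoids d n y (k0 + m) (k0 + 0) x)) \<le> expec (\<lambda>_. 1)"
    by (rule expec_mono[where k = "k0"])
      (auto simp: adapted_def[of _ "\<lambda>_. _"] intro!: adapted_comp2[OF adapted_unburnt adapted_avoids])
  then show ?case by simp
next
  case (Suc l)
  let ?Q = "\<lambda>l y. of_bool (real (card (unburnt d n y k0)) \<le> D \<and> avoids d n y (k0 + m) (k0 + l) x) :: real"
  let ?b = "real (ball_size n d (m - Suc l))"
  have ad: "adapted (k0 + l) (?Q l)" for l
    by (rule adapted_comp2[OF adapted_unburnt adapted_avoids]) auto
  have "expec (?Q (Suc l)) \<le> expec (\<lambda>y. exp (- ?b / D) * ?Q l y)"
  proof (rule expec_step)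
    show "adapted (k0 + l) (\<lambda>y. exp (- ?b / D) * ?Q l y)" by (rule adapted_comp[OF ad])
    show "adapted (Suc (k0 + l)) (?Q (Suc l))" using ad[of "Suc l"] by simp
    fix y assume y: "valid_upto d n (k0 + l) y"
    have upd: "?Q (Suc l) (y(Suc (k0 + l) := w)) =
      (if w \<in> torus_cball d n x (m - Suc l) then 0 else ?Q l y)" for w
    proof -
      have "unburnt d n (y(Suc (k0 + l) := w)) k0 = unburnt d n y k0"
        by (rule unburnt_cong) auto
      moreover have "avoids d n (y(Suc (k0 + l) := w)) (k0 + m) (k0 + l) x = avoids d n y (k0 + m) (k0 + l) x"
        by (rule adaptedD[OF adapted_avoids[OF order_refl]]) auto
      moreover have "k0 + m - Suc (k0 + l) = m - Suc l" by simp
      ultimately show ?thesis by (simp add: avoids_Suc)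
    qed
    show "(\<Sum>w\<in>unburnt d n y (k0 + l). ?Q (Suc l) (y(Suc (k0 + l) := w))) \<le>
      real (card (unburnt d n y (k0 + l))) * (exp (- ?b / D) * ?Q l y)"
    proof (cases "?Q l y = 0")
      case True
      then show ?thesis unfolding upd True by simp
    next
      case False
      then have Q1: "?Q l y = 1" and c: "real (card (unburnt d n y k0)) \<le> D"
        and av: "avoids d n y (k0 + m) (k0 + l) x" by (auto simp: of_bool_def split: if_splits)
      let ?B = "torus_cball d n x (m - Suc l)" and ?U = "unburnt d n y (k0 + l)"
      have "k0 + m - Suc (k0 + l) = m - Suc l" by simp
      then have B: "?B \<subseteq> ?U" using avoids_imp_cball_unburnt[OF y av _ x] Suc.prems by simp
      have u: "real (card ?U) \<le> D" using card_unburnt_antimono[of k0 "k0 + l" d n y] c by simp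
      have "(\<Sum>w\<in>?U. if w \<in> ?B then 0 else 1) = (\<Sum>w\<in>?U - ?B. 1::real)"
        by (rule sum.mono_neutral_cong_right) auto
      also have "\<dots> = real (card ?U) - ?b"
        using B card_mono[OF _ B] card_torus_cball[OF x, of "m - Suc l"] finite_subset[OF B]
        by (simp add: card_Diff_subset of_nat_diff)
      also have "\<dots> \<le> real (card ?U) * (1 - ?b / D)"
        using u D mult_right_mono[OF u, of ?b] by (simp add: field_simps)
      also have "\<dots> \<le> real (card ?U) * exp (- ?b / D)"
        using exp_ge_add_one_self[of "- ?b / D"] by (intro mult_left_mono) auto
      finally show ?thesis unfolding upd Q1 by simp
    qed
    show "?Q (Suc l) (y(Suc (k0 + l) := w)) \<le> exp (- ?b / D) * ?Q l y"
      if "unburnt d n y (k0 + l) = {}" "w \<in> torus d n" for w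
    proof -
      have "\<not> avoids d n y (k0 + m) (k0 + l) x"
        using avoids_imp_unburnt[OF y _ _ x, of "k0 + m"] that Suc.prems by auto
      then show ?thesis unfolding upd by simp
    qed
  qed
  also have "\<dots> \<le> exp (- ?b / D) * exp (- (\<Sum>i<l. real (ball_size n d (m - Suc i))) / D)"
    using Suc by (simp only: expec_scale) (intro mult_left_mono; simp)
  also have "\<dots> = exp (- (\<Sum>i<Suc l. real (ball_size n d (m - Suc i))) / D)"
    by (simp add: exp_add[symmetric] add_divide_distrib diff_divide_distrib)
  finally show ?case .
qed

lemma prob_late:
  assumes D: "0 < D" "0 < D'"
  shows "prob {\<omega>\<in>space M. real (card (unburnt d n (path \<omega>) k0)) \<le> D \<and> D' < real (card (unburnt d n (path \<omega>) (k0 + m)))}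
    \<le> real n ^ d / D' * exp (- (\<Sum>i<m. real (ball_size n d i)) / D)"
proof -
  let ?Q = "\<lambda>x y. of_bool (real (card (unburnt d n y k0)) \<le> D \<and> avoids d n y (k0 + m) (k0 + m) x) :: real"
  have ad: "adapted (k0 + m) (?Q x)" for x
    by (rule adapted_comp2[OF adapted_unburnt adapted_avoids]) auto
  have "prob {\<omega>\<in>space M. real (card (unburnt d n (path \<omega>) k0)) \<le> D \<and> D' < real (card (unburnt d n (path \<omega>) (k0 + m)))}
    \<le> expec (\<lambda>y. \<Sum>x\<in>torus d n. ?Q x y) / D'"
  proof (rule prob_le_expec[where P = "\<lambda>y. real (card (unburnt d n y k0)) \<le> D \<and> D' < real (card (unburnt d n y (k0 + m)))"])
    show "adapted (k0 + m) (\<lambda>y. real (card (unburnt d n y k0)) \<le> D \<and> D' < real (card (unburnt d n y (k0 + m))))"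
      by (rule adapted_comp2[OF adapted_unburnt adapted_unburnt]) auto
    show "adapted (k0 + m) (\<lambda>y. \<Sum>x\<in>torus d n. ?Q x y)" by (rule adapted_sum[OF ad])
    fix y assume y: "valid_upto d n (k0 + m) y"
    show "0 \<le> (\<Sum>x\<in>torus d n. ?Q x y)" by (intro sum_nonneg) auto
    assume *: "real (card (unburnt d n y k0)) \<le> D \<and> D' < real (card (unburnt d n y (k0 + m)))"
    have "unburnt d n y (k0 + m) = {x\<in>torus d n. avoids d n y (k0 + m) (k0 + m) x}"
      using unburnt_iff_avoids[OF y] by blast
    then have "real (card (unburnt d n y (k0 + m))) = (\<Sum>x\<in>{x\<in>torus d n. avoids d n y (k0 + m) (k0 + m) x}. 1)" by simp
    also have "\<dots> = (\<Sum>x\<in>torus d n. ?Q x y)"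
      using * by (intro sum.mono_neutral_cong_left) auto
    finally show "D' \<le> (\<Sum>x\<in>torus d n. ?Q x y)" using * by simp
  qed (use D in auto)
  also have "expec (\<lambda>y. \<Sum>x\<in>torus d n. ?Q x y) = (\<Sum>x\<in>torus d n. expec (?Q x))"
    by (rule expec_sum[OF finite_torus ad])
  also have "\<dots> \<le> (\<Sum>x\<in>torus d n. exp (- (\<Sum>i<m. real (ball_size n d (m - Suc i))) / D))"
    by (intro sum_mono expec_late D) auto
  also have "(\<Sum>i<m. real (ball_size n d (m - Suc i))) = (\<Sum>i<m. real (ball_size n d i))"
    by (rule sum.nat_diff_reindex)
  finally show ?thesis using D by (simp add: card_torus divide_right_mono)
qed

end

section \<open>Perturbed solutions by scaling, and the time scale\<close>

lemma kern_scale: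
  assumes l: "0 < l" and t: "0 \<le> t" and cont: "continuous_on {0..l * t} w"
  shows "kern d (\<lambda>s. l ^ (d + 1) * w (l * s)) t = kern d w (l * t)"
proof -
  define f where "f s = (l * t - s) ^ d * w s" for s
  have "(f has_integral integral {0..l * t} f) (cbox 0 (l * t))"
    using integrable_integral[OF kern_integrable[OF cont, of "l * t" d]] by (simp add: f_def[abs_def])
  then have "((\<lambda>x. f (l *\<^sub>R x + 0)) has_integral (1 / (\<bar>l\<bar> ^ DIM(real))) *\<^sub>R integral {0..l * t} f)
    ((\<lambda>x. (1 / l) *\<^sub>R x + - ((1 / l) *\<^sub>R 0)) ` cbox 0 (l * t))"
    using l by (intro has_integral_affinity) auto
  moreover have "(\<lambda>x. (1 / l) *\<^sub>R x + - ((1 / l) *\<^sub>R 0)) ` cbox 0 (l * t) = {0..t}"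
  proof (intro set_eqI iffI)
    fix x assume "x \<in> {0..t}"
    then have "l * x \<in> cbox 0 (l * t)" "x = (1 / l) *\<^sub>R (l * x) + - ((1 / l) *\<^sub>R 0)" using l by auto
    then show "x \<in> (\<lambda>x. (1 / l) *\<^sub>R x + - ((1 / l) *\<^sub>R 0)) ` cbox 0 (l * t)" by blast
  qed (use l in \<open>auto simp: field_simps\<close>)
  ultimately have "((\<lambda>x. f (l * x)) has_integral integral {0..l * t} f / l) {0..t}"
    using l by simp
  then have "((\<lambda>x. l * f (l * x)) has_integral l * (integral {0..l * t} f / l)) {0..t}"
    by (rule has_integral_mult_right)
  then have "((\<lambda>x. l * f (l * x)) has_integral integral {0..l * t} f) {0..t}"
    using l by simp
  moreover have "(\<lambda>x. l * f (l * x)) = (\<lambda>s. (t - s) ^ d * (l ^ (d + 1) * w (l * s)))"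
  proof (rule ext)
    fix x
    have "(l * t - l * x) ^ d = l ^ d * (t - x) ^ d"
      by (simp only: right_diff_distrib[symmetric] power_mult_distrib)
    then show "l * f (l * x) = (t - x) ^ d * (l ^ (d + 1) * w (l * x))"
      by (simp only: f_def power_add power_one_right) simp
  qed
  ultimately have "integral {0..t} (\<lambda>s. (t - s) ^ d * (l ^ (d + 1) * w (l * s))) = integral {0..l * t} f"
    by (simp add: integral_unique)
  then show ?thesis by (simp add: kern_def f_def[abs_def])
qed

text \<open>The scaling symmetry of the equation, which turns the solution into barriers.\<close>

lemma volterra_scale:
  assumes w: "volterra d 0 b w" and l: "0 < l"
  shows "volterra d (real (d + 1) * ln l) (b / l) (\<lambda>t. l ^ (d + 1) * w (l * t))"
  unfolding volterra_def
proof (intro conjI ballI)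
  have cw: "continuous_on {0..<b} w" using w by (simp add: volterra_def)
  show "continuous_on {0..<b / l} (\<lambda>t. l ^ (d + 1) * w (l * t))"
    by (intro continuous_intros continuous_on_compose2[OF cw]) (use l in \<open>auto simp: field_simps\<close>)
  fix t assume t: "t \<in> {0..<b / l}"
  then have lt: "0 \<le> l * t" "l * t < b" using l by (auto simp: field_simps)
  have "exp (real (d + 1) * ln l) = l ^ (d + 1)"
    using l by (simp only: exp_of_nat_mult exp_ln)
  then show "l ^ (d + 1) * w (l * t) =
    exp (real (d + 1) * ln l + kern d (\<lambda>t. l ^ (d + 1) * w (l * t)) t)"
    using t l lt volterra_eq[OF w lt] kern_scale[OF l _ volterra_cont[OF w lt(2)]]
    by (simp only: exp_add) simp
qed

lemma volterra_inverse_near: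
  assumes w: "volterra d \<kappa> b w" and t: "0 \<le> t" "t < b" and "0 < \<epsilon>"
  shows "\<exists>r>0. \<forall>x\<in>{0..<b}. \<bar>x - t\<bar> < r \<longrightarrow> \<bar>1 / w x - 1 / w t\<bar> < \<epsilon>"
proof -
  have "continuous_on {0..<b} (\<lambda>x. 1 / w x)"
    using w volterra_pos[OF w] by (intro continuous_intros) (auto simp: volterra_def intro: less_imp_neq[symmetric])
  then show ?thesis using t \<open>0 < \<epsilon>\<close> unfolding continuous_on_iff by (force simp: dist_real_def)
qed

lemma kern_uniformly_continuous:
  assumes w: "volterra d \<kappa> b w" and t: "0 \<le> t" "t < b" and "0 < \<epsilon>"
  shows "\<exists>r>0. \<forall>x\<in>{0..t}. \<forall>z\<in>{0..t}. \<bar>x - z\<bar> < r \<longrightarrow> \<bar>kern d w x - kern d w z\<bar> < \<epsilon>"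
proof -
  have "continuous_on {0..t} (kern d w)"
  proof (rule continuous_on_kern[where B = "w t"])
    show "0 \<le> w s \<and> w s \<le> w t" if "s \<in> {0..t}" for s
      using volterra_pos[OF w, of s] volterra_mono[OF w, of s t] that t by auto
  qed (rule volterra_cont[OF w t(2)])
  then have "uniformly_continuous_on {0..t} (kern d w)"
    by (intro compact_uniformly_continuous) auto
  then show ?thesis using \<open>0 < \<epsilon>\<close> unfolding uniformly_continuous_on_def dist_real_def
    by (metis abs_minus_commute)
qed

text \<open>Barriers that, at time \<open>t\<close>, are as close to the solution as required.\<close>

lemma barrier_functions:
  assumes w: "volterra d 0 b w" and t: "0 \<le> t" "t < b" and \<epsilon>: "0 < \<epsilon>"
  obtains \<eta> b1 :: real and W :: "real \<Rightarrow> real" and b2 :: real and V :: "real \<Rightarrow> real" and t1 e0 :: real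
  where "0 < \<eta>" "volterra d \<eta> b1 W" "volterra d (- \<eta>) b2 V" "t1 < b1" "t1 < b2" "0 < e0" "t + e0 \<le> t1"
    "\<And>x. t \<le> x \<Longrightarrow> x \<le> t + e0 \<Longrightarrow> 1 / w t - \<epsilon> \<le> 1 / W x"
    "\<And>x. 0 \<le> x \<Longrightarrow> t - e0 \<le> x \<Longrightarrow> x \<le> t \<Longrightarrow> 1 / V x \<le> 1 / w t + \<epsilon>"
    "\<And>s x. 0 \<le> s \<Longrightarrow> s \<le> x \<Longrightarrow> x \<le> t1 \<Longrightarrow> x \<le> s + e0 \<Longrightarrow> kern d W x \<le> kern d W s + \<eta> / 4"
    "\<And>s x. 0 \<le> x \<Longrightarrow> x \<le> s \<Longrightarrow> s \<le> t1 \<Longrightarrow> s \<le> x + e0 \<Longrightarrow> kern d V s \<le> kern d V x + \<eta> / 4"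
proof -
  define t1 where "t1 = (t + b) / 2"
  have t1: "t < t1" "t1 < b" "0 < t1" using t by (auto simp: t1_def)
  define F where "F \<mu> = 1 / (\<mu> ^ (d + 1) * w (\<mu> * t))" for \<mu> :: real
  have "continuous_on {1 / 2..b / t1} F"
  proof -
    have c0: "continuous_on {0..<b} w" using w by (simp add: volterra_def)
    have sub: "\<mu> * t \<in> {0..<b}" if "\<mu> \<in> {1 / 2..b / t1}" for \<mu>
    proof -
      have "\<mu> * t \<le> b / t1 * t" using that t by (intro mult_right_mono) auto
      also have "\<dots> < b" using t1 t by (simp add: field_simps)
      finally show ?thesis using that t by auto
    qed
    have "continuous_on {1 / 2..b / t1} (\<lambda>\<mu>. w (\<mu> * t))"
    proof (rule continuous_on_compose2[OF c0])
      show "continuous_on {1 / 2..b / t1} (\<lambda>\<mu>. \<mu> * t)" by (intro continuous_intros)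
      show "(\<lambda>\<mu>. \<mu> * t) ` {1 / 2..b / t1} \<subseteq> {0..<b}" using sub by blast
    qed
    moreover have "\<mu> ^ (d + 1) * w (\<mu> * t) \<noteq> 0" if "\<mu> \<in> {1 / 2..b / t1}" for \<mu>
      using volterra_pos[OF w, of "\<mu> * t"] sub[OF that] that by auto
    ultimately show ?thesis unfolding F_def by (intro continuous_intros) auto
  qed
  moreover have "1 \<in> {1 / 2..b / t1}" using t1 by (auto simp: field_simps)
  ultimately obtain r where r: "r > 0" "\<And>\<mu>. \<mu> \<in> {1 / 2..b / t1} \<Longrightarrow> \<bar>\<mu> - 1\<bar> < r \<Longrightarrow> \<bar>F \<mu> - F 1\<bar> < \<epsilon> / 2"
    using \<epsilon> unfolding continuous_on_iff dist_real_def by (metis half_gt_zero)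
  have bt: "b / t1 > 1" using t1 by (simp add: field_simps)
  \<comment> \<open>The upper barrier is the solution scaled by l, the lower one by 1 / l;
    l < b / t1 keeps the explosion time of the upper barrier beyond t1.\<close>
  then have "1 < min (b / t1) (min (1 + r) 2)" using r(1) by simp
  then obtain l where "1 < l" "l < min (b / t1) (min (1 + r) 2)" using dense by blast
  then have l: "l > 1" "l < b / t1" "l - 1 < r" "l \<le> 2" by auto
  have il: "1 / 2 \<le> 1 / l" "1 / l < 1" "1 - 1 / l < r"
  proof -
    show "1 / 2 \<le> 1 / l" "1 / l < 1" using l by (auto simp: field_simps)
    have "1 - 1 / l = (l - 1) / l" using l by (simp add: field_simps)
    also have "\<dots> \<le> (l - 1) / 1" using l by (intro divide_left_mono) auto
    finally show "1 - 1 / l < r" using l by simp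
  qed
  define W where "W x = l ^ (d + 1) * w (l * x)" for x
  define V where "V x = (1 / l) ^ (d + 1) * w ((1 / l) * x)" for x
  define \<eta> where "\<eta> = real (d + 1) * ln l"
  have \<eta>: "0 < \<eta>" using l by (simp add: \<eta>_def)
  have W: "volterra d \<eta> (b / l) W"
    unfolding \<eta>_def W_def using volterra_scale[OF w, of l] l by simp
  have "real (d + 1) * ln (1 / l) = - \<eta>" using l by (simp add: \<eta>_def ln_div)
  then have V: "volterra d (- \<eta>) (b * l) V"
    unfolding V_def using volterra_scale[OF w, of "1 / l"] l by simp
  have tb: "t1 < b / l" "t1 < b * l"
  proof -
    show "t1 < b / l" using l t1 by (simp add: field_simps)
    have "t1 * 1 < b * l" using l t1 by (intro mult_strict_mono) auto
    then show "t1 < b * l" by simp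
  qed
  have Wt: "\<bar>1 / W t - 1 / w t\<bar> < \<epsilon> / 2"
    using r(2)[of l] l bt by (simp add: F_def W_def)
  have Vt: "\<bar>1 / V t - 1 / w t\<bar> < \<epsilon> / 2"
    using r(2)[of "1 / l"] il bt by (simp add: F_def V_def)
  have \<epsilon>2: "0 < \<epsilon> / 2" "0 < \<eta> / 4" using \<epsilon> \<eta> by auto
  obtain r1 where r1: "r1 > 0" "\<forall>x\<in>{0..<b / l}. \<bar>x - t\<bar> < r1 \<longrightarrow> \<bar>1 / W x - 1 / W t\<bar> < \<epsilon> / 2"
    using volterra_inverse_near[OF W t(1) _ \<epsilon>2(1)] t1 tb by force
  obtain r2 where r2: "r2 > 0" "\<forall>x\<in>{0..<b * l}. \<bar>x - t\<bar> < r2 \<longrightarrow> \<bar>1 / V x - 1 / V t\<bar> < \<epsilon> / 2"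
    using volterra_inverse_near[OF V t(1) _ \<epsilon>2(1)] t1 tb by force
  obtain r3 where r3: "r3 > 0" "\<forall>x\<in>{0..t1}. \<forall>z\<in>{0..t1}. \<bar>x - z\<bar> < r3 \<longrightarrow> \<bar>kern d W x - kern d W z\<bar> < \<eta> / 4"
    using kern_uniformly_continuous[OF W _ tb(1) \<epsilon>2(2)] t1 by auto
  obtain r4 where r4: "r4 > 0" "\<forall>x\<in>{0..t1}. \<forall>z\<in>{0..t1}. \<bar>x - z\<bar> < r4 \<longrightarrow> \<bar>kern d V x - kern d V z\<bar> < \<eta> / 4"
    using kern_uniformly_continuous[OF V _ tb(2) \<epsilon>2(2)] t1 by auto
  have "0 < min r1 (min r2 (min r3 (min r4 (t1 - t))))" using r1(1) r2(1) r3(1) r4(1) t1(1) by simp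
  then obtain e0 where "0 < e0" "e0 < min r1 (min r2 (min r3 (min r4 (t1 - t))))" using dense by blast
  then have e0: "0 < e0" "e0 < r1" "e0 < r2" "e0 < r3" "e0 < r4" "e0 < t1 - t" by auto
  show ?thesis
  proof (rule that[OF \<eta> W V tb e0(1)])
    show "t + e0 \<le> t1" using e0 by simp
    show "1 / w t - \<epsilon> \<le> 1 / W x" if "t \<le> x" "x \<le> t + e0" for x
    proof -
      have "x \<in> {0..<b / l}" "\<bar>x - t\<bar> < r1" using that t e0 tb by auto
      then have "\<bar>1 / W x - 1 / W t\<bar> < \<epsilon> / 2" using r1(2) by blast
      with Wt show ?thesis by linarith
    qed
    show "1 / V x \<le> 1 / w t + \<epsilon>" if "0 \<le> x" "t - e0 \<le> x" "x \<le> t" for x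
    proof -
      have "x \<in> {0..<b * l}" "\<bar>x - t\<bar> < r2" using that t1 e0 tb by auto
      then have "\<bar>1 / V x - 1 / V t\<bar> < \<epsilon> / 2" using r2(2) by blast
      with Vt show ?thesis by linarith
    qed
    show "kern d W x \<le> kern d W s + \<eta> / 4" if "0 \<le> s" "s \<le> x" "x \<le> t1" "x \<le> s + e0" for s x
    proof -
      have "x \<in> {0..t1}" "s \<in> {0..t1}" "\<bar>x - s\<bar> < r3" using that e0 by auto
      then have "\<bar>kern d W x - kern d W s\<bar> < \<eta> / 4" using r3(2) by blast
      then show ?thesis by linarith
    qed
    show "kern d V s \<le> kern d V x + \<eta> / 4" if "0 \<le> x" "x \<le> s" "s \<le> t1" "s \<le> x + e0" for s x
    proof -
      have "x \<in> {0..t1}" "s \<in> {0..t1}" "\<bar>s - x\<bar> < r4" using that e0 by auto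
      then have "\<bar>kern d V s - kern d V x\<bar> < \<eta> / 4" using r4(2) by blast
      then show ?thesis by linarith
    qed
  qed
qed

text \<open>The unit of time \<open>N = n^(d/(d+1))\<close>.\<close>

definition time_scale :: "nat \<Rightarrow> nat \<Rightarrow> real" where
  "time_scale d n = real n powr (real d / real (d + 1))"

lemma time_scale_pos: "n \<ge> 1 \<Longrightarrow> 0 < time_scale d n"
  by (simp add: time_scale_def)

lemma time_scale_power: "n \<ge> 1 \<Longrightarrow> time_scale d n ^ (d + 1) = real n ^ d"
proof -
  assume n: "n \<ge> 1"
  then have "time_scale d n ^ (d + 1) = time_scale d n powr real (d + 1)"
    using time_scale_pos[OF n, of d] by (simp only: powr_realpow)
  also have "\<dots> = real n powr (real d / real (d + 1) * real (d + 1))"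
    by (simp only: time_scale_def powr_powr)
  also have "real d / real (d + 1) * real (d + 1) = real d" by simp
  finally show ?thesis using n by (simp add: powr_realpow)
qed

lemma eventually_powr_ge:
  assumes "0 < a"
  shows "eventually (\<lambda>n. C \<le> real n powr a) sequentially"
proof -
  define C' where "C' = max C 1"
  have "eventually (\<lambda>n. C' powr (1 / a) \<le> real n) sequentially"
    by (rule eventually_sequentiallyI[of "nat \<lceil>C' powr (1 / a)\<rceil>"]) linarith
  then show ?thesis
  proof eventually_elim
    case (elim n)
    have "C' = (C' powr (1 / a)) powr a" using assms by (simp add: powr_powr C'_def)
    also have "\<dots> \<le> real n powr a" using elim assms by (intro powr_mono2) auto
    finally show ?case by (simp add: C'_def)
  qed
qed

lemma eventually_time_scale_ge: "1 \<le> d \<Longrightarrow> eventually (\<lambda>n. C \<le> time_scale d n) sequentially"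
  unfolding time_scale_def by (rule eventually_powr_ge) simp

lemma eventually_time_scale_less: "eventually (\<lambda>n. C * time_scale d n < real n) sequentially"
proof -
  have "0 < 1 / real (d + 1)" by simp
  from eventually_powr_ge[OF this, of "C + 1"] eventually_ge_at_top[of 1]
  show ?thesis
  proof eventually_elim
    case (elim n)
    have "real d / real (d + 1) + 1 / real (d + 1) = (real d + 1) / real (d + 1)"
      by (simp only: add_divide_distrib)
    also have "\<dots> = 1" by simp
    finally have e: "real d / real (d + 1) + 1 / real (d + 1) = 1" .
    have "time_scale d n * real n powr (1 / real (d + 1)) = real n"
      unfolding time_scale_def using elim by (simp only: powr_add[symmetric] e) simp
    moreover have "C * time_scale d n < real n powr (1 / real (d + 1)) * time_scale d n"
      using elim time_scale_pos[of n d] by (intro mult_strict_right_mono) auto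
    ultimately show ?case by (simp add: mult.commute)
  qed
qed

text \<open>A sequence of times that starts at \<open>0\<close> and never increases by more than \<open>c\<close> has, up to its index \<open>R\<close>, elements
  within \<open>c\<close> above and within \<open>c\<close> below every time \<open>i \<le> g R\<close>.\<close>

lemma grid_cover:
  fixes g :: "nat \<Rightarrow> nat" and c :: real
  assumes "g 0 = 0" "\<And>r. real (g (Suc r)) \<le> real (g r) + c" "0 \<le> c" "i \<le> g R"
  shows "\<exists>r\<le>R. i \<le> g r \<and> real (g r) \<le> real i + c" "\<exists>r\<le>R. g r \<le> i \<and> real i \<le> real (g r) + c"
proof -
  have "(\<exists>r\<le>R. i \<le> g r \<and> real (g r) \<le> real i + c) \<and> (\<exists>r\<le>R. g r \<le> i \<and> real i \<le> real (g r) + c)"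
    using assms(4)
  proof (induction R)
    case 0
    then show ?case using assms by auto
  next
    case (Suc R)
    show ?case
    proof (cases "i \<le> g R")
      case True
      then show ?thesis using Suc.IH le_SucI by blast
    next
      case False
      then have "i \<le> g (Suc R)" "real (g (Suc R)) \<le> real i + c" "g R \<le> i" "real i \<le> real (g R) + c"
        using Suc.prems assms(2)[of R] by linarith+
      then show ?thesis using le_SucI[OF order_refl] by blast
    qed
  qed
  then show "\<exists>r\<le>R. i \<le> g r \<and> real (g r) \<le> real i + c" "\<exists>r\<le>R. g r \<le> i \<and> real i \<le> real (g r) + c"
    by blast+
qed

section \<open>Convergence at a fixed time before the explosion\<close>

text \<open>The failure probability is of order \<open>1 / N\<close>: the number of target times is bounded, and the fraction of
  pairs of vertices at distance \<open>O(N)\<close> is \<open>O(N^d / n^d) = O(1 / N)\<close>.\<close>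

lemma (in rejection_process) prob_unburnt_deviation:
  fixes N h0 t t1 e0 \<eta> \<epsilon> Q :: real and W V w :: "real \<Rightarrow> real"
  defines "N \<equiv> time_scale d n"
  assumes d: "1 \<le> d" and t: "0 \<le> t"
    and W: "volterra d \<eta> b1 W" and V: "volterra d (- \<eta>) b2 V" and \<eta>: "0 < \<eta>"
    and t1: "t1 < b1" "t1 < b2" and e0: "0 < e0" "t + e0 \<le> t1"
    and Wt: "\<And>x. t \<le> x \<Longrightarrow> x \<le> t + e0 \<Longrightarrow> f - \<epsilon> \<le> 1 / W x"
    and Vt: "\<And>x. 0 \<le> x \<Longrightarrow> t - e0 \<le> x \<Longrightarrow> x \<le> t \<Longrightarrow> 1 / V x \<le> f + \<epsilon>"
    and kW: "\<And>s x. 0 \<le> s \<Longrightarrow> s \<le> x \<Longrightarrow> x \<le> t1 \<Longrightarrow> x \<le> s + e0 \<Longrightarrow> kern d W x \<le> kern d W s + \<eta> / 4"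
    and kV: "\<And>s x. 0 \<le> x \<Longrightarrow> x \<le> s \<Longrightarrow> s \<le> t1 \<Longrightarrow> s \<le> x + e0 \<Longrightarrow> kern d V s \<le> kern d V x + \<eta> / 4"
    and h0: "h0 = e0 / 6" and Q: "Q = 2 ^ d / fact d * (2 * t1) ^ d" and R: "R = nat \<lceil>t / h0\<rceil>"
    and N_large: "real (d + 2) \<le> h0 * N" "2 * Q * W t1 \<le> N" "8 * Q * W t1 * kern d W t1 \<le> \<eta> * N" "2 * t1 * N < real n"
  shows "prob {\<omega>\<in>space M. \<bar>real (card (unburnt d n (path \<omega>) (nat \<lfloor>t * N\<rfloor>))) / real n ^ d - f\<bar> > \<epsilon>}
    \<le> real (R + 1) * Q * exp (2 * t1 * Q * W t1) / (1 - exp (- \<eta> / 4))\<^sup>2 / N"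
proof -
  define g where "g r = nat \<lceil>real r * h0 * N\<rceil>" for r
  define K where "K = g R"
  \<comment> \<open>A bound for all hitting probabilities before the barrier W is crossed.\<close>
  define \<kappa> where "\<kappa> = Q * W t1 / N"
  \<comment> \<open>The relative accuracy required of the martingales: - ln (1 - \<delta>) = \<eta> / 4.\<close>
  define \<delta> where "\<delta> = 1 - exp (- \<eta> / 4)"
  have N: "0 < N" using time_scale_pos[OF n_pos] by (simp add: N_def)
  have Npow: "N ^ (d + 1) = real n ^ d" using time_scale_power[OF n_pos] by (simp add: N_def)
  have h0_pos: "0 < h0" using h0 e0 by simp
  have t1_pos: "0 < t1" using t e0 by simp
  have W1: "0 < W t1" using volterra_pos[OF W] t1 t1_pos by simp
  have Q0: "0 < Q" using t1_pos by (simp add: Q)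
  have h0N: "1 \<le> h0 * N" "real d \<le> h0 * N" using N_large(1) by auto
  have g_bounds: "real r * h0 * N \<le> real (g r)" "real (g r) \<le> real r * h0 * N + 1" for r
  proof -
    have "0 \<le> real r * h0 * N" using h0_pos N by simp
    then show "real r * h0 * N \<le> real (g r)" "real (g r) \<le> real r * h0 * N + 1"
      unfolding g_def by linarith+
  qed
  have g0: "g 0 = 0" by (simp add: g_def)
  have g_step: "real (g (Suc r)) \<le> real (g r) + 2 * h0 * N" for r
  proof -
    have "real (g (Suc r)) \<le> real (Suc r) * h0 * N + 1" by (rule g_bounds)
    also have "\<dots> = real r * h0 * N + h0 * N + 1" by (simp add: algebra_simps)
    also have "\<dots> \<le> real (g r) + 2 * h0 * N" using g_bounds(1)[of r] h0N by linarith
    finally show ?thesis .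
  qed
  have g_le: "g r \<le> K" if "r \<le> R" for r
  proof -
    have "real r * h0 * N \<le> real R * h0 * N" using that h0_pos N by (intro mult_right_mono) auto
    then show ?thesis unfolding K_def g_def by (intro nat_mono ceiling_mono)
  qed
  have R_bounds: "t \<le> real R * h0" "real R * h0 \<le> t + h0"
  proof -
    have "0 \<le> t / h0" using t h0_pos by simp
    then have "t / h0 \<le> real R" "real R \<le> t / h0 + 1" unfolding R by linarith+
    then show "t \<le> real R * h0" "real R * h0 \<le> t + h0" using h0_pos by (auto simp: field_simps)
  qed
  have K_bounds: "t * N \<le> real K" "real K \<le> (t + 2 * h0) * N"
  proof -
    have "t * N \<le> real R * h0 * N" using R_bounds N by (intro mult_right_mono) auto
    then show "t * N \<le> real K" using g_bounds(1)[of R] by (simp add: K_def)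
    have "real R * h0 * N \<le> (t + h0) * N" using R_bounds N by (intro mult_right_mono) auto
    then show "real K \<le> (t + 2 * h0) * N"
      using g_bounds(2)[of R] h0N by (simp add: K_def algebra_simps)
  qed
  have t1h: "t + 6 * h0 \<le> t1" using e0 h0 by simp
  have KN: "real K + real d \<le> t1 * N" "real K \<le> t1 * N"
  proof -
    have "(t + 3 * h0) * N \<le> t1 * N" using t1h h0_pos N by (intro mult_right_mono) auto
    then show "real K + real d \<le> t1 * N" "real K \<le> t1 * N"
      using K_bounds(2) h0N by (auto simp: algebra_simps)
  qed
  have ball: "real (ball_size n d k) \<le> Q * N ^ d" if "real k + real d \<le> 2 * t1 * N" for k
  proof -
    have "real (ball_size n d k) \<le> 2 ^ d / fact d * (real k + real d) ^ d" by (rule ball_size_le_pow)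
    also have "\<dots> \<le> 2 ^ d / fact d * (2 * t1 * N) ^ d" using that by (intro mult_left_mono power_mono) auto
    also have "\<dots> = Q * N ^ d" by (simp add: Q power_mult_distrib)
    finally show ?thesis .
  qed
  have "0 \<le> t1 * N" using t1_pos N by simp
  then have bK: "real (ball_size n d K) \<le> Q * N ^ d" "real (ball_size n d (2 * K)) \<le> Q * N ^ d"
    using KN by (auto intro!: ball)
  have nd: "real n ^ d = N * N ^ d" using Npow by simp
  have \<delta>: "0 < \<delta>" "\<delta> < 1" "ln (1 - \<delta>) = - \<eta> / 4" "ln (1 + \<delta>) \<le> \<eta> / 4"
  proof -
    show "0 < \<delta>" "\<delta> < 1" "ln (1 - \<delta>) = - \<eta> / 4" using \<eta> by (auto simp: \<delta>_def)
    have "ln (1 + \<delta>) \<le> \<delta>" using \<open>0 < \<delta>\<close> by (intro ln_add_one_self_le_self) simp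
    also have "\<delta> \<le> \<eta> / 4" using exp_ge_add_one_self[of "- \<eta> / 4"] by (simp add: \<delta>_def)
    finally show "ln (1 + \<delta>) \<le> \<eta> / 4" .
  qed
  have \<kappa>0: "0 \<le> \<kappa>" using Q0 W1 N by (simp add: \<kappa>_def)
  have kWm: "kern d W x \<le> kern d W t1" if "0 \<le> x" "x \<le> t1" for x
  proof (rule kern_mono_time)
    show "continuous_on {0..t1} W" using t1 by (intro volterra_cont[OF W])
    show "0 \<le> W s" if "s \<in> {0..t1}" for s
      using volterra_pos[OF W, of s] that t1 by simp
  qed (use that in auto)
  have \<kappa>W: "2 * \<kappa> * kern d W x \<le> \<eta> / 4" if "0 \<le> x" "x \<le> t1" for x
  proof -
    have "2 * \<kappa> * kern d W x \<le> 2 * \<kappa> * kern d W t1" using \<kappa>0 by (intro mult_left_mono kWm that) auto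
    also have "\<dots> \<le> \<eta> / 4" using N_large(3) N by (simp add: \<kappa>_def field_simps)
    finally show ?thesis .
  qed
  have frac: "real k / N \<le> x \<longleftrightarrow> real k \<le> x * N" "x \<le> real k / N \<longleftrightarrow> x * N \<le> real k" for k x
    using N by (auto simp: field_simps)
  interpret barrier d n M Y N "2 * h0" "3 * h0" \<eta> \<delta> \<kappa> t1 "W t1" b1 b2 W V K R g
  proof unfold_locales
    show "1 \<le> d" "0 < N" "N ^ (d + 1) = real n ^ d" by fact+
    show "0 \<le> 2 * h0" using h0_pos by simp
    show "2 * h0 + real (d + 2) / N \<le> 3 * h0" using N_large(1) N by (simp add: field_simps)
    show "volterra d \<eta> b1 W" "volterra d (- \<eta>) b2 V" "t1 < b1" "t1 < b2" by fact+
    show "0 \<le> \<eta>" using \<eta> by simp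
    show "g r \<le> K" if "r \<le> R" for r using g_le that .
    have hN: "0 \<le> 2 * h0 * N" using h0_pos N by simp
    show "\<exists>r\<le>R. i \<le> g r \<and> real (g r) / N \<le> real i / N + 2 * h0" if "i \<le> K" for i
      using grid_cover(1)[of g, OF g0 g_step hN that[unfolded K_def]] N by (auto simp: field_simps)
    show "\<exists>r\<le>R. g r \<le> i \<and> real i / N \<le> real (g r) / N + 2 * h0" if "i \<le> K" for i
      using grid_cover(2)[of g, OF g0 g_step hN that[unfolded K_def]] N by (auto simp: field_simps)
    have "real K / N \<le> t + 2 * h0" using K_bounds N by (simp add: frac)
    then show "real K / N + 3 * h0 \<le> t1" using t1h h0_pos by linarith
    show "W t1 \<le> W t1" by simp
    show "2 * K < n"
    proof -
      have "real (2 * K) < real n" using KN N_large(4) by simp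
      then show ?thesis by (simp only: of_nat_less_iff)
    qed
    show "real (ball_size n d K) * W t1 \<le> \<kappa> * real n ^ d"
      using mult_right_mono[OF bK(1), of "W t1"] W1 N by (simp add: \<kappa>_def nd mult_ac)
    show "\<kappa> \<le> 1 / 2" using N_large(2) N by (simp add: \<kappa>_def field_simps)
    show "0 < \<delta>" "\<delta> < 1" by fact+
    show "(1 + 2 * \<kappa>) * kern d W (s + 3 * h0) - ln (1 - \<delta>) \<le> \<eta> + kern d W s"
      if "0 \<le> s" "s + 3 * h0 \<le> t1" for s
    proof -
      have "kern d W (s + 3 * h0) \<le> kern d W s + \<eta> / 4"
        by (rule kW) (use that h0_pos h0 in auto)
      moreover have "2 * \<kappa> * kern d W (s + 3 * h0) \<le> \<eta> / 4"
        by (rule \<kappa>W) (use that h0_pos in auto)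
      moreover have "(1 + 2 * \<kappa>) * kern d W (s + 3 * h0) = kern d W (s + 3 * h0) + 2 * \<kappa> * kern d W (s + 3 * h0)"
        by (simp add: distrib_right)
      ultimately show ?thesis using \<delta>(3) \<eta> by linarith
    qed
    show "- \<eta> + kern d V s + ln (1 + \<delta>) \<le> kern d V (max 0 (s - 3 * h0))" if "0 \<le> s" "s \<le> t1" for s
    proof -
      have "kern d V s \<le> kern d V (max 0 (s - 3 * h0)) + \<eta> / 4"
        by (rule kV) (use that h0_pos h0 in auto)
      then show ?thesis using \<delta>(4) \<eta> by linarith
    qed
  qed
  define i where "i = nat \<lfloor>t * N\<rfloor>"
  have tN: "0 \<le> t * N" using t N by simp
  then have i: "real i \<le> t * N" "t * N \<le> real i + 1" unfolding i_def by linarith+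
  then have iK: "i \<le> K" using K_bounds(1) by linarith
  have iN: "real i / N \<le> t" "t \<le> real i / N + h0"
    using i h0N N by (auto simp: field_simps)
  have dev: "\<bar>real (card (unburnt d n y i)) / real n ^ d - f\<bar> \<le> \<epsilon>" if y: "valid_upto d n K y" and good: "good y" for y
  proof -
    let ?u = "real (card (unburnt d n y i))"
    have "0 \<le> real i / N" using N by simp
    have x: "t \<le> t + 2 * h0" "t + 2 * h0 \<le> t + e0" "t + 2 * h0 \<le> t1"
      "real i / N + 2 * h0 \<le> t + 2 * h0" "0 \<le> real i / N + 2 * h0"
      using h0_pos h0 t1h iN \<open>0 \<le> real i / N\<close> by auto
    have "real n ^ d \<le> ?u * W (real i / N + 2 * h0)"
      using good_alive[OF y good iK] by (simp add: alive_def)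
    also have "\<dots> \<le> ?u * W (t + 2 * h0)" using x by (intro mult_left_mono W_mono) auto
    finally have "1 / W (t + 2 * h0) \<le> ?u / real n ^ d"
      using W_pos[of "t + 2 * h0"] x t nd_pos by (simp add: field_simps)
    then have lower: "f - \<epsilon> \<le> ?u / real n ^ d" using Wt[OF x(1,2)] by linarith
    define z where "z = max 0 (real i / N - 2 * h0)"
    have z: "0 \<le> z" "t - e0 \<le> z" "z \<le> t" "z \<le> t1"
      using iN h0 h0_pos t t1h by (auto simp: z_def)
    have "?u * V z \<le> real n ^ d" using good_upper[OF y good iK] by (simp add: z_def)
    then have "?u / real n ^ d \<le> 1 / V z" using V_pos[OF z(1,4)] nd_pos by (simp add: field_simps)
    then have "?u / real n ^ d \<le> f + \<epsilon>" using Vt[OF z(1-3)] by linarith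
    with lower show ?thesis by linarith
  qed
  have "prob {\<omega>\<in>space M. \<bar>real (card (unburnt d n (path \<omega>) i)) / real n ^ d - f\<bar> > \<epsilon>}
    \<le> prob {\<omega>\<in>space M. \<not> good (path \<omega>)}"
  proof (rule finite_measure_mono)
    show "{\<omega>\<in>space M. \<not> good (path \<omega>)} \<in> sets M"
      by (rule adapted_sets[OF adapted_comp[OF adapted_good]])
    show "{\<omega>\<in>space M. \<bar>real (card (unburnt d n (path \<omega>) i)) / real n ^ d - f\<bar> > \<epsilon>} \<subseteq> {\<omega>\<in>space M. \<not> good (path \<omega>)}"
      using dev[OF valid_path] by (auto simp: not_le[symmetric])
  qed
  also have "\<dots> \<le> real (R + 1) * (real (ball_size n d (2 * K)) *
     exp (2 * real K * real (ball_size n d K) * W t1 / real n ^ d) / (\<delta>\<^sup>2 * real n ^ d))"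
    by (rule prob_not_good)
  also have "\<dots> \<le> real (R + 1) * (Q * N ^ d * exp (2 * t1 * Q * W t1) / (\<delta>\<^sup>2 * real n ^ d))"
  proof (intro mult_left_mono divide_right_mono mult_mono bK)
    have "2 * real K * real (ball_size n d K) * W t1 \<le> 2 * (t1 * N) * (Q * N ^ d) * W t1"
      using KN bK W1 Q0 t1_pos N by (intro mult_right_mono mult_mono) auto
    then have "2 * real K * real (ball_size n d K) * W t1 / real n ^ d \<le> 2 * (t1 * N) * (Q * N ^ d) * W t1 / real n ^ d"
      using nd_pos by (intro divide_right_mono) auto
    also have "\<dots> = 2 * t1 * Q * W t1" using N by (simp add: nd)
    finally show "exp (2 * real K * real (ball_size n d K) * W t1 / real n ^ d) \<le> exp (2 * t1 * Q * W t1)" by simp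
  qed (use nd_pos Q0 N in auto)
  also have "\<dots> = real (R + 1) * Q * exp (2 * t1 * Q * W t1) / \<delta>\<^sup>2 / N"
    using N by (simp add: nd)
  finally show ?thesis by (simp add: i_def \<delta>_def)
qed

lemma unburnt_fraction_converges:
  assumes d: "1 \<le> d" and rs: "\<And>n. n \<ge> 1 \<Longrightarrow> rejection_sampling d n (M n) (Y n)"
    and w: "volterra d 0 b w" and t: "0 \<le> t" "t < b" and \<epsilon>: "0 < \<epsilon>"
  shows "(\<lambda>n. measure (M n) {\<omega>\<in>space (M n).
    \<bar>real (card (unburnt d n (\<lambda>i. Y n i \<omega>) (nat \<lfloor>t * time_scale d n\<rfloor>))) / real n ^ d - 1 / w t\<bar> > \<epsilon>}) \<longlonglongrightarrow> 0"
proof -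
  obtain \<eta> b1 b2 t1 e0 :: real and W V :: "real \<Rightarrow> real"
    where bf: "0 < \<eta>" "volterra d \<eta> b1 W" "volterra d (- \<eta>) b2 V" "t1 < b1" "t1 < b2" "0 < e0" "t + e0 \<le> t1"
    "\<And>x. t \<le> x \<Longrightarrow> x \<le> t + e0 \<Longrightarrow> 1 / w t - \<epsilon> \<le> 1 / W x"
    "\<And>x. 0 \<le> x \<Longrightarrow> t - e0 \<le> x \<Longrightarrow> x \<le> t \<Longrightarrow> 1 / V x \<le> 1 / w t + \<epsilon>"
    "\<And>s x. 0 \<le> s \<Longrightarrow> s \<le> x \<Longrightarrow> x \<le> t1 \<Longrightarrow> x \<le> s + e0 \<Longrightarrow> kern d W x \<le> kern d W s + \<eta> / 4"
    "\<And>s x. 0 \<le> x \<Longrightarrow> x \<le> s \<Longrightarrow> s \<le> t1 \<Longrightarrow> s \<le> x + e0 \<Longrightarrow> kern d V s \<le> kern d V x + \<eta> / 4"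
    by (rule barrier_functions[OF w t \<epsilon>]) blast
  define h0 where "h0 = e0 / 6"
  define Q where "Q = 2 ^ d / fact d * (2 * t1) ^ d"
  define R where "R = nat \<lceil>t / h0\<rceil>"
  define C where "C = real (R + 1) * Q * exp (2 * t1 * Q * W t1) / (1 - exp (- \<eta> / 4))\<^sup>2"
  have h0: "0 < h0" using bf(6) by (simp add: h0_def)
  have time_scale_top: "filterlim (time_scale d) at_top sequentially"
    using eventually_time_scale_ge[OF d] by (simp add: filterlim_at_top)
  have "(\<lambda>n. C / time_scale d n) \<longlonglongrightarrow> 0"
    by (rule real_tendsto_divide_at_top[OF tendsto_const time_scale_top])
  then show ?thesis
  proof (rule tendsto_sandwich[OF _ _ tendsto_const, rotated 2])
    show "\<forall>\<^sub>F n in sequentially. 0 \<le> measure (M n) {\<omega>\<in>space (M n).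
    \<bar>real (card (unburnt d n (\<lambda>i. Y n i \<omega>) (nat \<lfloor>t * time_scale d n\<rfloor>))) / real n ^ d - 1 / w t\<bar> > \<epsilon>}"
      by simp
    show "\<forall>\<^sub>F n in sequentially. measure (M n) {\<omega>\<in>space (M n).
    \<bar>real (card (unburnt d n (\<lambda>i. Y n i \<omega>) (nat \<lfloor>t * time_scale d n\<rfloor>))) / real n ^ d - 1 / w t\<bar> > \<epsilon>} \<le> C / time_scale d n"
      using eventually_ge_at_top[of 1] eventually_time_scale_ge[OF d, of "real (d + 2) / h0"]
        eventually_time_scale_ge[OF d, of "2 * Q * W t1"]
        eventually_time_scale_ge[OF d, of "8 * Q * W t1 * kern d W t1 / \<eta>"] eventually_time_scale_less[of "2 * t1" d]
    proof eventually_elim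
      case (elim n)
      interpret rejection_process d n "M n" "Y n" using elim rs by unfold_locales auto
      show ?case unfolding C_def
        by (rule prob_unburnt_deviation[OF d t(1) bf(2,3,1,4-11) h0_def Q_def R_def])
          (use elim h0 bf(1) in \<open>auto simp: field_simps\<close>)
    qed
  qed
qed

section \<open>Covering soon after the unburnt fraction is small\<close>

lemma exp_minus_le: 
  fixes X :: real
  assumes "0 < X"
  shows "exp (- X) \<le> 64 / X ^ 4"
proof -
  have "(X / 2)\<^sup>2 / 2 \<le> exp (X / 2)"
    using exp_lower_Taylor_quadratic[of "X / 2"] assms by simp
  then have "((X / 2)\<^sup>2 / 2)\<^sup>2 \<le> (exp (X / 2))\<^sup>2" by (intro power_mono) auto
  moreover have "(exp (X / 2))\<^sup>2 = exp X" by (simp add: power2_eq_square exp_add[symmetric])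
  moreover have "((X / 2)\<^sup>2 / 2)\<^sup>2 = X ^ 4 / 64" by (simp add: power_divide power_mult[symmetric])
  ultimately have "X ^ 4 / 64 \<le> exp X" by simp
  then show ?thesis using assms by (simp add: exp_minus field_simps)
qed

lemma sum_ball_size_lower:
  assumes "2 * m < n" "d + 1 \<le> m"
  shows "2 ^ d * (real m / real (d + 1)) ^ (d + 1) \<le> (\<Sum>i<m. real (ball_size n d i))"
proof -
  obtain q where q: "m = Suc q" using assms by (cases m) auto
  have "(real m / real (d + 1)) ^ (d + 1) \<le> real (m choose (d + 1))"
    by (rule binomial_ge_n_over_k_pow_k[OF assms(2)])
  also have "m choose (d + 1) = (\<Sum>i<m. i choose d)"
    using sum_choose_upper[of d q] by (simp add: q lessThan_Suc_atMost)
  finally have "2 ^ d * (real m / real (d + 1)) ^ (d + 1) \<le> 2 ^ d * real (\<Sum>i<m. i choose d)"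
    by (intro mult_left_mono) auto
  also have "\<dots> = (\<Sum>i<m. real (2 ^ d * (i choose d)))" by (simp add: sum_distrib_left)
  also have "\<dots> \<le> (\<Sum>i<m. real (ball_size n d i))"
    using assms by (intro sum_mono of_nat_mono ball_size_lower) auto
  finally show ?thesis .
qed

text \<open>Starting from at most \<open>\<delta> n^d\<close> unburnt vertices at time \<open>k0\<close>, stage \<open>j = 0, 1, \<dots>\<close> lasts about \<open>h N / 2^j\<close>
  steps and brings their number below \<open>\<delta> n^d / 4^((d+1)(j+1))\<close>, except with a probability that is summable in
  \<open>j\<close> and small with \<open>\<delta>\<close>.\<close>

lemma (in rejection_process) prob_covering_late:
  fixes N h \<delta> a :: real
  defines "N \<equiv> time_scale d n"
  assumes h: "0 < h" and \<delta>: "0 < \<delta>" "\<delta> \<le> 1" and N1: "1 \<le> N"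
    and hN: "real (d + 1) \<le> h * sqrt N" and hn: "2 * h * N + 2 < real n"
    and a: "a = 2 ^ d * (h / real (d + 1)) ^ (d + 1)"
  shows "prob {\<omega>\<in>space M. real k0 + 3 * h * N < real (covering_time d n (path \<omega>))}
    \<le> prob {\<omega>\<in>space M. \<delta> * real n ^ d < real (card (unburnt d n (path \<omega>) k0))}
       + 128 * 4 ^ (d + 1) / a ^ 4 * \<delta> ^ 3"
proof -
  define \<beta> :: real where "\<beta> = 2 ^ (d + 1)"
  define D where "D j = \<delta> * real n ^ d / \<beta> ^ (2 * j)" for j
  define m where "m j = nat \<lceil>h * N / 2 ^ j\<rceil>" for j
  define ks where "ks j = k0 + (\<Sum>i<j. m i)" for j
  define C where "C = 64 * 4 ^ (d + 1) / a ^ 4 * \<delta> ^ 3"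
  \<comment> \<open>After J stages less than one vertex is left, as n^d = N^(d+1) < 4^(J(d+1)).
    The last stages still last at least of order sqrt N steps.\<close>
  define J where "J = (LEAST J. N < 4 ^ J)"
  have \<beta>: "2 \<le> \<beta>" "0 < \<beta>" using self_le_power[of "2::real" "d + 1"] by (auto simp: \<beta>_def)
  have \<beta>2: "\<beta>\<^sup>2 = 4 ^ (d + 1)" by (simp add: \<beta>_def power_mult[symmetric] power_even_eq power2_eq_square flip: power_mult_distrib)
  have a0: "0 < a" using h by (simp add: a)
  have nd: "N ^ (d + 1) = real n ^ d" using time_scale_power[OF n_pos] by (simp add: N_def)
  have nd0: "0 < real n ^ d" using n_pos by simp
  have D0: "0 < D j" for j using \<delta> nd0 \<beta> by (simp add: D_def)
  have C0: "0 \<le> C" using a0 \<delta> by (simp add: C_def)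
  obtain J0 where "N < (4::real) ^ J0" using real_arch_pow[of 4 N] by auto
  then have J: "N < 4 ^ J" unfolding J_def by (rule LeastI)
  have "J \<noteq> 0" using J N1 by (auto intro: ccontr)
  then obtain J' where J': "J = Suc J'" using not0_implies_Suc by blast
  have "\<not> N < 4 ^ J'" using not_less_Least[of J' "\<lambda>J. N < 4 ^ J"] J' unfolding J_def by simp
  then have "4 ^ J' \<le> N" by simp
  then have "(2 ^ J')\<^sup>2 \<le> N" by (simp add: power2_eq_square flip: power_mult_distrib)
  then have sqrtN: "2 ^ J' \<le> sqrt N" by (rule real_le_rsqrt)
  have N_sqrt: "N = sqrt N * sqrt N" "0 < sqrt N" using N1 by auto
  have hN1: "1 \<le> h * sqrt N" using hN by simp
  have Jle: "real J \<le> h * N"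
  proof -
    have "real J \<le> 2 ^ J'"
    proof -
      have "J \<le> 2 ^ J'" unfolding J' by (rule Suc_leI[OF less_exp])
      then have "real J \<le> real (2 ^ J')" by (rule of_nat_mono)
      then show ?thesis by simp
    qed
    also have "\<dots> \<le> 1 * sqrt N" using sqrtN by simp
    also have "\<dots> \<le> (h * sqrt N) * sqrt N" using hN1 N_sqrt by (intro mult_right_mono) auto
    finally show ?thesis using N_sqrt by (simp add: mult.assoc)
  qed
  have m: "h * N / 2 ^ j \<le> real (m j)" "real (m j) \<le> h * N / 2 ^ j + 1" for j
  proof -
    have "0 \<le> h * N / 2 ^ j" using h N1 by simp
    then show "h * N / 2 ^ j \<le> real (m j)" "real (m j) \<le> h * N / 2 ^ j + 1" unfolding m_def by linarith+
  qed
  have m_large: "d + 1 \<le> m j" if "j < J" for j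
  proof -
    have "(2::real) ^ j \<le> 2 ^ J'" using that J' by (intro power_increasing) auto
    from this sqrtN have "2 ^ j \<le> sqrt N" by (rule order_trans)
    then have "h * N / sqrt N \<le> h * N / 2 ^ j" using h N1 by (intro divide_left_mono) auto
    moreover have "h * N / sqrt N = h * sqrt N" using N_sqrt by (metis nonzero_mult_div_cancel_right less_irrefl mult.assoc)
    ultimately have "real (d + 1) \<le> real (m j)" using hN m(1)[of j] by linarith
    then show ?thesis by simp
  qed
  have m_n: "2 * m j < n" for j
  proof -
    have "h * N / 2 ^ j \<le> h * N / 1" using h N1 by (intro divide_left_mono) auto
    then have "real (2 * m j) < real n" using m(2)[of j] hn by simp
    then show ?thesis by (simp only: of_nat_less_iff)
  qed
  have fail: "real n ^ d / D (Suc j) * exp (- (\<Sum>i<m j. real (ball_size n d i)) / D j) \<le> C * (1 / 2) ^ j"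
    if "j < J" for j
  proof -
    have "a * (N ^ (d + 1) / \<beta> ^ j) = 2 ^ d * (h * N / 2 ^ j / real (d + 1)) ^ (d + 1)"
    proof -
      have "\<beta> ^ j = (2 ^ j) ^ (d + 1)" unfolding \<beta>_def by (simp only: power_mult[symmetric] mult.commute)
      then show ?thesis unfolding a by (simp only: power_divide power_mult_distrib) (simp add: field_simps)
    qed
    also have "\<dots> \<le> 2 ^ d * (real (m j) / real (d + 1)) ^ (d + 1)"
      using m(1)[of j] h N1 by (intro mult_left_mono power_mono divide_right_mono) auto
    also have "\<dots> \<le> (\<Sum>i<m j. real (ball_size n d i))"
      by (rule sum_ball_size_lower[OF m_n m_large[OF that]])
    finally have "a * (N ^ (d + 1) / \<beta> ^ j) / D j \<le> (\<Sum>i<m j. real (ball_size n d i)) / D j"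
      using D0[of j] by (intro divide_right_mono) auto
    moreover have "a * (N ^ (d + 1) / \<beta> ^ j) / D j = a * \<beta> ^ j / \<delta>"
    proof -
      have sq: "\<beta> ^ (2 * j) = \<beta> ^ j * \<beta> ^ j" by (simp only: mult_2 power_add)
      have r: "a * (V / q) / (\<delta> * V / (q * q)) = a * q / \<delta>" if "0 < V" "0 < q" for V q :: real
        using that \<delta> by (simp add: field_simps)
      show ?thesis unfolding D_def nd sq by (rule r[OF nd0]) (use \<beta> in simp)
    qed
    ultimately have "exp (- (\<Sum>i<m j. real (ball_size n d i)) / D j) \<le> exp (- (a * \<beta> ^ j / \<delta>))" by simp
    also have "\<dots> \<le> 64 / (a * \<beta> ^ j / \<delta>) ^ 4"
      using a0 \<beta> \<delta> by (intro exp_minus_le) auto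
    finally have e: "exp (- (\<Sum>i<m j. real (ball_size n d i)) / D j) \<le> 64 / (a * \<beta> ^ j / \<delta>) ^ 4" .
    have nD: "real n ^ d / D (Suc j) = 4 ^ (d + 1) * (\<beta> ^ j)\<^sup>2 / \<delta>"
    proof -
      have sq: "\<beta> ^ (2 * Suc j) = \<beta>\<^sup>2 * (\<beta> ^ j)\<^sup>2" by (simp add: power2_eq_square power_mult mult_ac power_add mult_2)
      have r: "V / (\<delta> * V / (B * q)) = B * q / \<delta>" if "0 < V" "0 < q" "0 < B" for V q B :: real
        using that \<delta> by (simp add: field_simps)
      show ?thesis unfolding D_def \<beta>2[symmetric] sq by (rule r[OF nd0]) (use \<beta> in simp_all)
    qed
    have "real n ^ d / D (Suc j) * exp (- (\<Sum>i<m j. real (ball_size n d i)) / D j)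
      \<le> (4 ^ (d + 1) * (\<beta> ^ j)\<^sup>2 / \<delta>) * (64 / (a * \<beta> ^ j / \<delta>) ^ 4)"
      unfolding nD using \<delta> by (intro mult_left_mono e) auto
    also have "\<dots> = C * (1 / \<beta> ^ j)\<^sup>2"
    proof -
      have "(4 ^ (d + 1) * q\<^sup>2 / \<delta>) * (64 / (a * q / \<delta>) ^ 4) = C * (1 / q)\<^sup>2" if "0 < q" for q
        using that \<delta> a0 unfolding C_def by (simp add: field_simps power2_eq_square eval_nat_numeral)
      then show ?thesis using \<beta> by simp
    qed
    also have "\<dots> \<le> C * (1 / 2) ^ j"
    proof (rule mult_left_mono[OF _ C0])
      have "(1 / \<beta>) ^ j \<le> (1 / 2) ^ j" using \<beta> by (intro power_mono) (auto simp: field_simps)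
      then have 1: "1 / \<beta> ^ j \<le> (1 / 2) ^ j" by (simp add: power_one_over)
      have 2: "1 / \<beta> ^ j \<le> 1" using \<beta> by (simp add: one_le_power)
      show "(1 / \<beta> ^ j)\<^sup>2 \<le> (1 / 2) ^ j"
        using mult_mono[OF 1 2] \<beta> by (simp add: power2_eq_square)
    qed
    finally show ?thesis .
  qed
  let ?A = "\<lambda>j. {\<omega>\<in>space M. D j < real (card (unburnt d n (path \<omega>) (ks j)))}"
  have Am: "?A j \<in> sets M" for j
    by (rule adapted_sets[of "ks j"]) (rule adapted_comp[OF adapted_unburnt[OF order_refl]])
  have iter: "prob (?A j) \<le> prob (?A 0) + (\<Sum>i<j. C * (1 / 2) ^ i)" if "j \<le> J" for j
    using that
  proof (induction j)
    case (Suc j)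
    let ?B = "{\<omega>\<in>space M. real (card (unburnt d n (path \<omega>) (ks j))) \<le> D j \<and>
      D (Suc j) < real (card (unburnt d n (path \<omega>) (ks j + m j)))}"
    have Bm: "?B \<in> sets M"
      by (rule adapted_sets[of "ks j + m j"]) (rule adapted_comp2[OF adapted_unburnt adapted_unburnt]; simp)
    have ks: "ks (Suc j) = ks j + m j" by (simp add: ks_def)
    have "prob (?A (Suc j)) \<le> prob (?A j \<union> ?B)"
      using Am Bm by (intro finite_measure_mono) (auto simp: ks not_less)
    also have "\<dots> \<le> prob (?A j) + prob ?B" by (rule measure_Un_le[OF Am Bm])
    also have "prob ?B \<le> real n ^ d / D (Suc j) * exp (- (\<Sum>i<m j. real (ball_size n d i)) / D j)"
      by (rule prob_late[OF D0 D0])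
    also have "\<dots> \<le> C * (1 / 2) ^ j" using Suc.prems by (intro fail) simp
    finally show ?case using Suc by simp
  qed simp
  have geo: "(\<Sum>i<j. (1 / 2) ^ i) \<le> (2::real)" for j
  proof -
    have "(\<Sum>i<j. (1 / 2) ^ i) = 2 - 2 * (1 / 2 :: real) ^ j" by (induction j) auto
    then show ?thesis by simp
  qed
  have DJ: "D J < 1"
  proof -
    have "\<beta> ^ (2 * J) = (4 ^ J) ^ (d + 1)"
      unfolding power_mult \<beta>2 by (simp only: power_mult[symmetric] mult.commute)
    moreover have "N ^ (d + 1) < (4 ^ J) ^ (d + 1)" using J N1 by (intro power_strict_mono) auto
    ultimately have "real n ^ d < \<beta> ^ (2 * J)" by (simp only: nd)
    moreover have "\<delta> * real n ^ d \<le> 1 * real n ^ d" using \<delta> nd0 by (intro mult_right_mono) auto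
    ultimately show ?thesis using \<beta> by (simp add: D_def)
  qed
  have ksJ: "real (ks J) \<le> real k0 + 3 * h * N"
  proof -
    have "(\<Sum>i<J. real (m i)) \<le> (\<Sum>i<J. h * N * (1 / 2) ^ i + 1)"
      using m(2) by (intro sum_mono) (simp add: power_one_over)
    also have "\<dots> = h * N * (\<Sum>i<J. (1 / 2) ^ i) + real J"
      by (simp add: sum.distrib sum_distrib_left)
    also have "\<dots> \<le> h * N * 2 + h * N"
      using geo[of J] Jle h N1 by (intro add_mono mult_left_mono) auto
    finally have "(\<Sum>i<J. real (m i)) \<le> 3 * h * N" by linarith
    then show ?thesis by (simp only: ks_def of_nat_add of_nat_sum)
  qed
  have "prob {\<omega>\<in>space M. real k0 + 3 * h * N < real (covering_time d n (path \<omega>))} \<le> prob (?A J)"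
  proof (rule finite_measure_mono[OF _ Am], rule subsetI)
    fix \<omega> assume *: "\<omega> \<in> {\<omega>\<in>space M. real k0 + 3 * h * N < real (covering_time d n (path \<omega>))}"
    then have "\<not> covering_time d n (path \<omega>) \<le> ks J" using ksJ by auto
    then have "unburnt d n (path \<omega>) (ks J) \<noteq> {}"
      unfolding covering_time_le_iff unburnt_empty_iff .
    then have "1 \<le> card (unburnt d n (path \<omega>) (ks J))" by (simp add: Suc_le_eq card_gt_0_iff)
    then have "1 \<le> real (card (unburnt d n (path \<omega>) (ks J)))" by simp
    then have "D J < real (card (unburnt d n (path \<omega>) (ks J)))" using DJ by linarith
    with * show "\<omega> \<in> ?A J" by simp
  qed
  also have "\<dots> \<le> prob (?A 0) + (\<Sum>i<J. C * (1 / 2) ^ i)" by (rule iter) simp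
  also have "(\<Sum>i<J. C * (1 / 2) ^ i) \<le> C * 2"
    unfolding sum_distrib_left[symmetric] by (intro mult_left_mono geo C0)
  also have "?A 0 = {\<omega>\<in>space M. \<delta> * real n ^ d < real (card (unburnt d n (path \<omega>) k0))}"
    by (simp add: D_def ks_def)
  finally show ?thesis by (simp add: C_def)
qed

section \<open>Convergence in probability\<close>

text \<open>The unburnt fraction at the rescaled time \<open>t\<close>.\<close>

definition unburnt_fraction :: "nat \<Rightarrow> nat \<Rightarrow> (nat \<Rightarrow> nat \<Rightarrow> nat) \<Rightarrow> real \<Rightarrow> real" where
  "unburnt_fraction d n y t = real (card (unburnt d n y (nat \<lfloor>t * time_scale d n\<rfloor>))) / real n ^ d"

lemma unburnt_fraction_antimono: "s \<le> t \<Longrightarrow> unburnt_fraction d n y t \<le> unburnt_fraction d n y s"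
  unfolding unburnt_fraction_def
  by (intro divide_right_mono of_nat_mono card_unburnt_antimono nat_mono floor_mono mult_right_mono)
    (auto simp: time_scale_def)

lemma unburnt_fraction_nonneg: "0 \<le> unburnt_fraction d n y t"
  by (simp add: unburnt_fraction_def)

context rejection_process
begin

lemma adapted_unburnt_fraction:
  "nat \<lfloor>t * time_scale d n\<rfloor> \<le> k \<Longrightarrow> adapted k (\<lambda>y. unburnt_fraction d n y t)"
  unfolding unburnt_fraction_def by (rule adapted_comp[OF adapted_unburnt])

text \<open>The covering time is at most \<open>d n + 1\<close>, so it is a function of finitely many steps: it is the number of times at which
  some vertex is not burnt.\<close>

lemma covering_time_measurable: "(\<lambda>\<omega>. real (covering_time d n (path \<omega>)) / c) \<in> borel_measurable M"
proof -
  define F where "F y = real (card {j. j < Suc (d * n) \<and> unburnt d n y j \<noteq> {}}) / c" for y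
  have "adapted (Suc (d * n)) F"
    unfolding adapted_def F_def
  proof (intro allI impI)
    fix y y' :: "nat \<Rightarrow> nat \<Rightarrow> nat" assume *: "\<forall>j\<in>{1..Suc (d * n)}. y j = y' j"
    have "unburnt d n y j = unburnt d n y' j" if "j < Suc (d * n)" for j
      using * that by (intro unburnt_cong) auto
    then have "{j. j < Suc (d * n) \<and> unburnt d n y j \<noteq> {}} = {j. j < Suc (d * n) \<and> unburnt d n y' j \<noteq> {}}"
      by auto
    then show "real (card {j. j < Suc (d * n) \<and> unburnt d n y j \<noteq> {}}) / c =
      real (card {j. j < Suc (d * n) \<and> unburnt d n y' j \<noteq> {}}) / c" by simp
  qed
  then have "(\<lambda>\<omega>. F (path \<omega>)) \<in> borel_measurable M" by (rule adapted_measurable)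
  moreover have "real (covering_time d n (path \<omega>)) / c = F (path \<omega>)" if "\<omega> \<in> space M" for \<omega>
  proof -
    have "covering_time d n (path \<omega>) \<le> Suc (d * n)"
      unfolding covering_time_le_iff using that by (intro burnt_all Y_in_torus) auto
    then have "{j. j < Suc (d * n) \<and> unburnt d n (path \<omega>) j \<noteq> {}} = {..<covering_time d n (path \<omega>)}"
      unfolding unburnt_empty_iff covering_time_le_iff[symmetric] by auto
    then show ?thesis by (simp add: F_def)
  qed
  ultimately show ?thesis by (subst measurable_cong) auto
qed

lemma sup_deviation_measurable:
  "(\<lambda>\<omega>. SUP t\<in>{0..<b}. \<bar>unburnt_fraction d n (path \<omega>) t - f t\<bar>) \<in> borel_measurable M"
proof (rule adapted_measurable)
  show "adapted (nat \<lfloor>b * time_scale d n\<rfloor>) (\<lambda>y. SUP t\<in>{0..<b}. \<bar>unburnt_fraction d n y t - f t\<bar>)"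
    unfolding adapted_def
  proof (intro allI impI SUP_cong refl)
    fix y y' :: "nat \<Rightarrow> nat \<Rightarrow> nat" and t
    assume *: "\<forall>j\<in>{1..nat \<lfloor>b * time_scale d n\<rfloor>}. y j = y' j" and t: "t \<in> {0..<b}"
    have "nat \<lfloor>t * time_scale d n\<rfloor> \<le> nat \<lfloor>b * time_scale d n\<rfloor>"
      using t by (intro nat_mono floor_mono mult_right_mono) (auto simp: time_scale_def)
    then have "unburnt_fraction d n y t = unburnt_fraction d n y' t"
      by (rule adaptedD[OF adapted_unburnt_fraction]) (use * in blast)
    then show "\<bar>unburnt_fraction d n y t - f t\<bar> = \<bar>unburnt_fraction d n y' t - f t\<bar>" by simp
  qed
qed

lemma deviation_sets: "{\<omega>\<in>space M. \<epsilon> < \<bar>unburnt_fraction d n (path \<omega>) t - c\<bar>} \<in> sets M"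
  by (rule adapted_sets[OF adapted_comp[OF adapted_unburnt_fraction[OF order_refl]]])

end

text \<open>Rejection sampling on all tori, with the limit profile \<open>w = y^(d)\<close> on \<open>[0,b)\<close>.\<close>

locale rejection_profile =
  fixes d :: nat and M :: "nat \<Rightarrow> 'a measure" and Y :: "nat \<Rightarrow> nat \<Rightarrow> 'a \<Rightarrow> (nat \<Rightarrow> nat)"
    and b :: real and w :: "real \<Rightarrow> real"
  assumes d: "1 \<le> d" and rs: "\<And>n. n \<ge> 1 \<Longrightarrow> rejection_sampling d n (M n) (Y n)"
    and b: "0 < b" and w: "volterra d 0 b w" and unbounded: "\<And>K. \<exists>t\<in>{0..<b}. K < w t"
begin

abbreviation u :: "nat \<Rightarrow> 'a \<Rightarrow> real \<Rightarrow> real" where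
  "u n \<omega> t \<equiv> unburnt_fraction d n (\<lambda>i. Y n i \<omega>) t"

lemma process: "n \<ge> 1 \<Longrightarrow> rejection_process d n (M n) (Y n)"
  using rs by unfold_locales auto

lemma w_ge_1: "0 \<le> t \<Longrightarrow> t < b \<Longrightarrow> 1 \<le> w t"
  using volterra_ge_1[OF w] by simp

lemma inverse_w_small:
  assumes "0 < \<epsilon>"
  obtains t where "0 \<le> t" "t < b" "1 / w t < \<epsilon>"
proof -
  obtain t where t: "t \<in> {0..<b}" "1 / \<epsilon> < w t" using unbounded by blast
  then have "1 / w t < \<epsilon>" using assms w_ge_1[of t] by (auto simp: field_simps)
  with t that show ?thesis by auto
qed

lemma inverse_w_antimono: "0 \<le> s \<Longrightarrow> s \<le> t \<Longrightarrow> t < b \<Longrightarrow> 1 / w t \<le> 1 / w s"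
  using volterra_mono[OF w, of s t] w_ge_1[of s] by (intro divide_left_mono) (auto intro: mult_pos_pos)

lemma u_converges:
  assumes "0 \<le> t" "t < b" "0 < \<epsilon>"
  shows "(\<lambda>n. measure (M n) {\<omega>\<in>space (M n). \<epsilon> < \<bar>u n \<omega> t - 1 / w t\<bar>}) \<longlonglongrightarrow> 0"
  using unburnt_fraction_converges[OF d rs w assms] by (simp add: unburnt_fraction_def)

text \<open>Covering too early is excluded by convergence at a time shortly before \<open>b\<close>. For the upper bound, convergence at
  a time \<open>t\<close> with \<open>1 / w t < \<delta> / 2\<close> leaves at most \<open>\<delta> n^d\<close> unburnt vertices.\<close>

lemma covering_time_converges:
  "tendsto_in_prob M (\<lambda>n \<omega>. real (covering_time d n (\<lambda>i. Y n i \<omega>)) / time_scale d n) b"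
  unfolding tendsto_in_prob_def
proof (intro conjI allI impI)
  show "\<forall>\<^sub>F n in sequentially. (\<lambda>\<omega>. real (covering_time d n (\<lambda>i. Y n i \<omega>)) / time_scale d n) \<in> borel_measurable (M n)"
    using eventually_ge_at_top[of 1] by eventually_elim (rule rejection_process.covering_time_measurable[OF process])
  fix \<epsilon> :: real assume \<epsilon>: "0 < \<epsilon>"
  show "(\<lambda>n. measure (M n) {\<omega>\<in>space (M n). \<epsilon> < \<bar>real (covering_time d n (\<lambda>i. Y n i \<omega>)) / time_scale d n - b\<bar>}) \<longlonglongrightarrow> 0"
  proof (rule order_tendstoI)
    fix \<theta> :: real assume "\<theta> < 0"
    then show "\<forall>\<^sub>F n in sequentially. \<theta> < measure (M n) {\<omega>\<in>space (M n). \<epsilon> < \<bar>real (covering_time d n (\<lambda>i. Y n i \<omega>)) / time_scale d n - b\<bar>}"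
      by (intro always_eventually allI) (rule less_le_trans[OF _ measure_nonneg])
  next
    fix \<theta> :: real assume \<theta>: "0 < \<theta>"
    define h where "h = \<epsilon> / 3"
    define a where "a = 2 ^ d * (h / real (d + 1)) ^ (d + 1)"
    define C where "C = 128 * 4 ^ (d + 1) / a ^ 4"
    have h: "0 < h" using \<epsilon> by (simp add: h_def)
    have C: "0 \<le> C" by (simp add: C_def)
    define \<delta> where "\<delta> = min 1 (\<theta> / (3 * (C + 1)))"
    have \<delta>: "0 < \<delta>" "\<delta> \<le> 1" using \<theta> C by (auto simp: \<delta>_def)
    have C\<delta>: "C * \<delta> ^ 3 < \<theta> / 2"
    proof -
      have "\<delta> ^ 3 \<le> \<delta> ^ 1" using \<delta> by (intro power_decreasing) auto
      then have "C * \<delta> ^ 3 \<le> C * \<delta>" using C by (intro mult_left_mono) auto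
      also have "\<dots> \<le> (C + 1) * \<delta>" using \<delta> by (intro mult_right_mono) auto
      also have "\<dots> \<le> (C + 1) * (\<theta> / (3 * (C + 1)))" using C by (intro mult_left_mono) (auto simp: \<delta>_def)
      also have "\<dots> = \<theta> / 3" using C by (simp add: field_simps)
      finally show ?thesis using \<theta> by linarith
    qed
    \<comment> \<open>If the torus is covered before b - \<epsilon>, the unburnt fraction vanishes at s, where its limit is positive.\<close>
    define s where "s = max 0 (b - \<epsilon> / 2)"
    have s: "0 \<le> s" "s < b" using b \<epsilon> by (auto simp: s_def)
    have ws: "0 < 1 / w s / 2" using w_ge_1[OF s] by simp
    have \<delta>2: "0 < \<delta> / 2" using \<delta> by simp
    obtain t where t: "0 \<le> t" "t < b" "1 / w t < \<delta> / 2" using inverse_w_small[OF \<delta>2] .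
    have \<theta>4: "0 < \<theta> / 4" using \<theta> by simp
    show "\<forall>\<^sub>F n in sequentially. measure (M n) {\<omega>\<in>space (M n). \<epsilon> < \<bar>real (covering_time d n (\<lambda>i. Y n i \<omega>)) / time_scale d n - b\<bar>} < \<theta>"
      using order_tendstoD(2)[OF u_converges[OF s ws] \<theta>4]
        order_tendstoD(2)[OF u_converges[OF t(1,2) \<delta>2] \<theta>4]
        eventually_ge_at_top[of 1] eventually_time_scale_ge[OF d, of 1]
        eventually_time_scale_ge[OF d, of "(real (d + 1) / h)\<^sup>2"] eventually_time_scale_less[of "2 * h + 2" d]
    proof eventually_elim
      case (elim n)
      interpret rejection_process d n "M n" "Y n" by (rule process[OF elim(3)])
      let ?N = "time_scale d n"
      let ?\<tau> = "\<lambda>\<omega>. real (covering_time d n (path \<omega>))"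
      let ?k0 = "nat \<lfloor>t * ?N\<rfloor>"
      have N: "0 < ?N" using elim by linarith
      let ?early = "{\<omega>\<in>space (M n). 1 / w s / 2 < \<bar>u n \<omega> s - 1 / w s\<bar>}"
      let ?late = "{\<omega>\<in>space (M n). real ?k0 + 3 * h * ?N < ?\<tau> \<omega>}"
      let ?mid = "{\<omega>\<in>space (M n). \<delta> / 2 < \<bar>u n \<omega> t - 1 / w t\<bar>}"
      have late_sets: "?late \<in> sets (M n)"
        by (rule borel_measurable_less[OF borel_measurable_const]) (use covering_time_measurable[of 1] in simp)
      have tN: "real ?k0 \<le> b * ?N"
      proof -
        have "0 \<le> t * ?N" "t * ?N \<le> b * ?N" using t N by auto
        then show ?thesis by linarith
      qed
      have "{\<omega>\<in>space (M n). \<epsilon> < \<bar>?\<tau> \<omega> / ?N - b\<bar>} \<subseteq> ?early \<union> ?late"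
      proof
        fix \<omega> assume "\<omega> \<in> {\<omega>\<in>space (M n). \<epsilon> < \<bar>?\<tau> \<omega> / ?N - b\<bar>}"
        then have \<omega>: "\<omega> \<in> space (M n)" and dev: "\<epsilon> < \<bar>?\<tau> \<omega> / ?N - b\<bar>" by auto
        consider "?\<tau> \<omega> / ?N < b - \<epsilon>" | "b + \<epsilon> < ?\<tau> \<omega> / ?N" using dev by linarith
        then show "\<omega> \<in> ?early \<union> ?late"
        proof cases
          case 1
          then have "?\<tau> \<omega> < (b - \<epsilon>) * ?N" using N by (simp add: field_simps)
          also have "\<dots> \<le> s * ?N" using N \<epsilon> by (intro mult_right_mono) (auto simp: s_def)
          finally have "covering_time d n (path \<omega>) \<le> nat \<lfloor>s * ?N\<rfloor>" by linarith
          then have "unburnt d n (path \<omega>) (nat \<lfloor>s * ?N\<rfloor>) = {}"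
            unfolding covering_time_le_iff unburnt_empty_iff .
          then have "u n \<omega> s = 0" by (simp add: unburnt_fraction_def)
          moreover have "x / 2 < \<bar>v - x\<bar>" if "v = 0" "0 < x / 2" for v x :: real
            using that by simp
          ultimately have "1 / w s / 2 < \<bar>u n \<omega> s - 1 / w s\<bar>" using ws by blast
          then show ?thesis using \<omega> by blast
        next
          case 2
          then have "(b + \<epsilon>) * ?N < ?\<tau> \<omega>" using N by (simp add: field_simps)
          moreover have "(b + \<epsilon>) * ?N = b * ?N + 3 * h * ?N" by (simp add: h_def distrib_right)
          ultimately show ?thesis using \<omega> tN by auto
        qed
      qed
      then have "prob {\<omega>\<in>space (M n). \<epsilon> < \<bar>?\<tau> \<omega> / ?N - b\<bar>} \<le> prob (?early \<union> ?late)"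
        using deviation_sets late_sets by (intro finite_measure_mono) auto
      also have "\<dots> \<le> prob ?early + prob ?late"
        by (rule measure_Un_le[OF deviation_sets late_sets])
      also have "prob ?late \<le> prob {\<omega>\<in>space (M n). \<delta> * real n ^ d < real (card (unburnt d n (path \<omega>) ?k0))} + C * \<delta> ^ 3"
        unfolding C_def
      proof (rule prob_covering_late[OF h \<delta> _ _ _ a_def])
        show "1 \<le> ?N" by (rule elim)
        have "real (d + 1) / h \<le> sqrt ?N" using elim(5) by (rule real_le_rsqrt)
        then show "real (d + 1) \<le> h * sqrt ?N" using h by (simp add: field_simps)
        have "2 * h * ?N + 2 \<le> (2 * h + 2) * ?N" using elim(4) by (simp add: distrib_right)
        then show "2 * h * ?N + 2 < real n" using elim(6) by linarith
      qed
      also have "prob {\<omega>\<in>space (M n). \<delta> * real n ^ d < real (card (unburnt d n (path \<omega>) ?k0))} \<le> prob ?mid"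
      proof (rule finite_measure_mono[OF _ deviation_sets], rule subsetI)
        fix \<omega> assume *: "\<omega> \<in> {\<omega>\<in>space (M n). \<delta> * real n ^ d < real (card (unburnt d n (path \<omega>) ?k0))}"
        have "0 < real n ^ d" using elim(3) by simp
        with * have "\<delta> < u n \<omega> t" unfolding unburnt_fraction_def by (simp add: pos_less_divide_eq)
        then have "\<delta> / 2 < u n \<omega> t - 1 / w t" using t by linarith
        then have "\<delta> / 2 < \<bar>u n \<omega> t - 1 / w t\<bar>" by linarith
        then show "\<omega> \<in> ?mid" using * by blast
      qed
      finally show ?case using elim(1,2) C\<delta> by linarith
    qed
  qed
qed

text \<open>By monotonicity, closeness at the points of a fine subdivision of \<open>[0,t]\<close>, where \<open>1 / w t\<close> is already small, implies
  closeness on \<open>[0,b)\<close>.\<close>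

lemma u_converges_uniformly:
  "tendsto_in_prob M (\<lambda>n \<omega>. SUP t\<in>{0..<b}. \<bar>u n \<omega> t - 1 / w t\<bar>) 0"
  unfolding tendsto_in_prob_def
proof (intro conjI allI impI)
  show "\<forall>\<^sub>F n in sequentially. (\<lambda>\<omega>. SUP t\<in>{0..<b}. \<bar>u n \<omega> t - 1 / w t\<bar>) \<in> borel_measurable (M n)"
    using eventually_ge_at_top[of 1] by eventually_elim (rule rejection_process.sup_deviation_measurable[OF process])
  fix \<epsilon> :: real assume \<epsilon>: "0 < \<epsilon>"
  have \<epsilon>4: "0 < \<epsilon> / 4" using \<epsilon> by simp
  obtain t where t: "0 \<le> t" "t < b" "1 / w t < \<epsilon> / 4" using inverse_w_small[OF \<epsilon>4] .
  have "w x \<noteq> 0" if "x \<in> {0..t}" for x using volterra_pos[OF w, of x] that t by simp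
  then have "continuous_on {0..t} (\<lambda>x. 1 / w x)"
    by (intro continuous_intros volterra_cont[OF w t(2)]) blast
  then have "uniformly_continuous_on {0..t} (\<lambda>x. 1 / w x)" by (intro compact_uniformly_continuous) auto
  then obtain r where r: "r > 0"
    "\<And>x z. x \<in> {0..t} \<Longrightarrow> z \<in> {0..t} \<Longrightarrow> dist z x < r \<Longrightarrow> dist (1 / w z) (1 / w x) < \<epsilon> / 4"
    unfolding uniformly_continuous_on_def using \<epsilon>4 by meson
  obtain p :: nat where p: "t / r < real p" using reals_Archimedean2 by blast
  have p0: "0 < real p"
  proof -
    have "0 \<le> t / r" using t r by simp
    then show ?thesis using p by linarith
  qed
  have tp: "t / real p < r" using p p0 r by (simp add: field_simps)
  define q where "q i = real i * (t / real p)" for i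
  have q: "0 \<le> q i" "q i \<le> t" if "i \<le> p" for i
  proof -
    show "0 \<le> q i" using t p0 by (simp add: q_def)
    have "q i \<le> real p * (t / real p)" unfolding q_def using that t p0 by (intro mult_right_mono) auto
    then show "q i \<le> t" using p0 by simp
  qed
  have close: "(SUP t\<in>{0..<b}. \<bar>u n \<omega> t - 1 / w t\<bar>) \<le> \<epsilon>"
    if good: "\<And>i. i \<le> p \<Longrightarrow> \<bar>u n \<omega> (q i) - 1 / w (q i)\<bar> \<le> \<epsilon> / 4" for n \<omega>
  proof (rule cSUP_least)
    show "{0..<b} \<noteq> {}" using b by simp
    fix x assume x: "x \<in> {0..<b}"
    have u0: "0 \<le> u n \<omega> x" by (rule unburnt_fraction_nonneg)
    have w0: "0 \<le> 1 / w x" using w_ge_1[of x] x by simp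
    show "\<bar>u n \<omega> x - 1 / w x\<bar> \<le> \<epsilon>"
    proof (cases "t \<le> x")
      case True
      have "q p = t" using p0 by (simp add: q_def)
      with good[of p] have "\<bar>u n \<omega> t - 1 / w t\<bar> \<le> \<epsilon> / 4" by simp
      then have "u n \<omega> t \<le> 1 / w t + \<epsilon> / 4" by linarith
      moreover have "u n \<omega> x \<le> u n \<omega> t" by (rule unburnt_fraction_antimono[OF True])
      moreover have "1 / w x \<le> 1 / w t" using inverse_w_antimono t True x by auto
      ultimately show ?thesis using u0 w0 t \<epsilon> by linarith
    next
      case False
      then have t0: "0 < t" using x by auto
      define i where "i = nat \<lfloor>x / (t / real p)\<rfloor>"
      have pos: "0 < t / real p" using t0 p0 by simp
      have "0 \<le> x / (t / real p)" using x pos by (intro divide_nonneg_pos) auto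
      then have "real i \<le> x / (t / real p)" "x / (t / real p) \<le> real (Suc i)" unfolding i_def by linarith+
      then have i: "q i \<le> x" "x \<le> q (Suc i)" unfolding q_def using pos by (auto simp only: pos_le_divide_eq pos_divide_le_eq)
      have "x < real p * (t / real p)" using False p0 by simp
      then have "x / (t / real p) < real p" by (simp only: pos_divide_less_eq[OF pos])
      then have ip: "Suc i \<le> p" using \<open>real i \<le> x / (t / real p)\<close> by linarith
      have len: "q (Suc i) = q i + t / real p" by (simp only: q_def of_nat_Suc distrib_right mult_1_left add.commute)
      have x': "x \<in> {0..t}" "q i \<in> {0..t}" "q (Suc i) \<in> {0..t}" using x False q[of i] q[of "Suc i"] ip by auto
      have "dist (q i) x < r" "dist (q (Suc i)) x < r" using i len tp by (auto simp: dist_real_def)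
      then have "\<bar>1 / w (q i) - 1 / w x\<bar> < \<epsilon> / 4" "\<bar>1 / w (q (Suc i)) - 1 / w x\<bar> < \<epsilon> / 4"
        using r(2) x' by (auto simp: dist_real_def)
      moreover have "u n \<omega> x \<le> u n \<omega> (q i)" "u n \<omega> (q (Suc i)) \<le> u n \<omega> x"
        by (intro unburnt_fraction_antimono i)+
      moreover have "\<bar>u n \<omega> (q i) - 1 / w (q i)\<bar> \<le> \<epsilon> / 4" "\<bar>u n \<omega> (q (Suc i)) - 1 / w (q (Suc i))\<bar> \<le> \<epsilon> / 4"
        using good ip by auto
      ultimately show ?thesis using \<epsilon> by linarith
    qed
  qed
  let ?bad = "\<lambda>n i. {\<omega>\<in>space (M n). \<epsilon> / 4 < \<bar>u n \<omega> (q i) - 1 / w (q i)\<bar>}"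
  have "(\<lambda>n. \<Sum>i\<le>p. measure (M n) (?bad n i)) \<longlonglongrightarrow> (\<Sum>i\<le>p. 0)"
    using q t by (intro tendsto_sum u_converges \<epsilon>4) (auto intro: le_less_trans)
  then have lim: "(\<lambda>n. \<Sum>i\<le>p. measure (M n) (?bad n i)) \<longlonglongrightarrow> 0" by simp
  show "(\<lambda>n. measure (M n) {\<omega>\<in>space (M n). \<epsilon> < \<bar>(SUP t\<in>{0..<b}. \<bar>u n \<omega> t - 1 / w t\<bar>) - 0\<bar>}) \<longlonglongrightarrow> 0"
  proof (rule tendsto_sandwich[OF _ _ tendsto_const lim])
    show "\<forall>\<^sub>F n in sequentially. 0 \<le> measure (M n) {\<omega>\<in>space (M n). \<epsilon> < \<bar>(SUP t\<in>{0..<b}. \<bar>u n \<omega> t - 1 / w t\<bar>) - 0\<bar>}"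
      by simp
    show "\<forall>\<^sub>F n in sequentially. measure (M n) {\<omega>\<in>space (M n). \<epsilon> < \<bar>(SUP t\<in>{0..<b}. \<bar>u n \<omega> t - 1 / w t\<bar>) - 0\<bar>}
      \<le> (\<Sum>i\<le>p. measure (M n) (?bad n i))"
      using eventually_ge_at_top[of 1]
    proof eventually_elim
      case (elim n)
      interpret rejection_process d n "M n" "Y n" by (rule process[OF elim])
      have bad_sets: "?bad n ` {..p} \<subseteq> sets (M n)"
        by (rule image_subsetI) (rule deviation_sets)
      have "{\<omega>\<in>space (M n). \<epsilon> < \<bar>(SUP t\<in>{0..<b}. \<bar>u n \<omega> t - 1 / w t\<bar>) - 0\<bar>} \<subseteq> (\<Union>i\<in>{..p}. ?bad n i)"
      proof (rule subsetI, rule ccontr)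
        fix \<omega> assume *: "\<omega> \<in> {\<omega>\<in>space (M n). \<epsilon> < \<bar>(SUP t\<in>{0..<b}. \<bar>u n \<omega> t - 1 / w t\<bar>) - 0\<bar>}"
          "\<omega> \<notin> (\<Union>i\<in>{..p}. ?bad n i)"
        then have good: "\<bar>u n \<omega> (q i) - 1 / w (q i)\<bar> \<le> \<epsilon> / 4" if "i \<le> p" for i
          using that by (auto simp: not_less)
        have upper: "(SUP t\<in>{0..<b}. \<bar>u n \<omega> t - 1 / w t\<bar>) \<le> \<epsilon>" by (rule close[OF good])
        have bd: "bdd_above ((\<lambda>t. \<bar>u n \<omega> t - 1 / w t\<bar>) ` {0..<b})"
        proof (rule bdd_aboveI2)
          fix x assume x: "x \<in> {0..<b}"
          have "u n \<omega> x \<le> u n \<omega> 0" using x by (intro unburnt_fraction_antimono) auto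
          moreover have "0 \<le> 1 / w x" "1 / w x \<le> 1" using w_ge_1[of x] x by auto
          ultimately show "\<bar>u n \<omega> x - 1 / w x\<bar> \<le> u n \<omega> 0 + 1"
            using unburnt_fraction_nonneg[of d n "path \<omega>" x] by linarith
        qed
        have "0 \<le> \<bar>u n \<omega> 0 - 1 / w 0\<bar>" by simp
        also have "\<dots> \<le> (SUP t\<in>{0..<b}. \<bar>u n \<omega> t - 1 / w t\<bar>)"
          using b by (intro cSUP_upper bd) auto
        finally show False using upper * by simp
      qed
      then have "prob {\<omega>\<in>space (M n). \<epsilon> < \<bar>(SUP t\<in>{0..<b}. \<bar>u n \<omega> t - 1 / w t\<bar>) - 0\<bar>} \<le> prob (\<Union>i\<in>{..p}. ?bad n i)"
        using bad_sets by (intro finite_measure_mono sets.finite_UN) auto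
      also have "\<dots> \<le> (\<Sum>i\<le>p. prob (?bad n i))"
        by (rule finite_measure_subadditive_finite[OF _ bad_sets]) simp
      finally show ?case .
    qed
  qed
qed

end

theorem theorem2:
  fixes d :: nat
    and M :: "nat \<Rightarrow> 'a measure"
    and Y :: "nat \<Rightarrow> nat \<Rightarrow> 'a \<Rightarrow> (nat \<Rightarrow> nat)"
    and T :: ereal
    and y :: "real \<Rightarrow> real"
  assumes "d \<ge> 1"
    and "\<And>n. n \<ge> 1 \<Longrightarrow> rejection_sampling d n (M n) (Y n)"
    and "maximal_blasius_solution d T y"
  shows "0 < T \<and> T < \<infinity> \<and>
    tendsto_in_prob M
      (\<lambda>n \<omega>. real (covering_time d n (\<lambda>i. Y n i \<omega>)) / real n powr (real d / real (d + 1)))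
      (real_of_ereal T) \<and>
    tendsto_in_prob M
      (\<lambda>n \<omega>. SUP t\<in>time_interval T.
         \<bar>real (card (torus d n - burnt d n (\<lambda>i. Y n i \<omega>)
                   (nat \<lfloor>t * real n powr (real d / real (d + 1))\<rfloor>))) / real n ^ d
           - 1 / nth_deriv_on (time_interval T) d y t\<bar>)
      0"
proof -
  obtain b where profile: "0 < b" "T = ereal b" "volterra d 0 b (nth_deriv_on {0..<b} d y)"
    "\<And>K. \<exists>t\<in>{0..<b}. K < nth_deriv_on {0..<b} d y t"
    by (rule maximal_blasius_profile[OF assms(3)]) blast
  interpret rejection_profile d M Y b "nth_deriv_on {0..<b} d y"
    by unfold_locales (use assms profile in auto)
  show ?thesis
    using covering_time_converges u_converges_uniformly profile(1)
    by (simp add: profile(2) time_interval_ereal time_scale_def unburnt_fraction_def unburnt_def)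
qed

end
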